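(* Let $k,m\in\mathbb N$, let $T_1$ be a tree with $k$ edges and let $T_2$ be a tree with $m$ edges; put $k_1:=k$ and $k_2:=m$. Suppose that for each $i\in\{1,2\}$ at least one of the following holds: (1) $T_i$ has diameter at most $5$; (2) there are $\ell_i,c_i\in\mathbb N$ with $\ell_i\geq c_i$ and $T_i\in\mathcal T(k_i,\ell_i,c_i)$, such that $c_i$ is even or $\ell_i+c_i\geq\lfloor (k+m)/2\rfloor$ (or both). Then $r(T_1,T_2)\leq k+m$.
   Context: Here $\mathbb N=\{1,2,3,\dots\}$. Graphs are finite, simple and undirected. The diameter of a graph is the longest distance between any two of its vertices, where distance is the number of edges of a shortest path. The length of a path is its number of edges. The Ramsey number $r(T_1,T_2)$ of two trees is the minimal integer $n$ such that any colouring of the edges of the complete graph $K^n$ of order $n$ with two colours, red and blue, yields a red copy of $T_1$ or a blue copy of $T_2$ (or both). $\mathcal T(k,\ell,c)$ denotes the class of all trees with $k$ edges which can be obtained from a path $P$ of length $k-\ell$ and two stars $S_1$ and $S_2$ by identifying the centres of the $S_i$ with two vertices that lie at distance $c$ from each other on $P$. Equivalently: for integers $a,b,c,d,e\ge 0$ let $C(a,b,c,d,e)$ be the tree obtained from a path $P$ of length $a+c+e$ by attaching $b$ new leaves to the $(a+1)$th vertex of $P$ and $d$ new leaves to the $(a+c+1)$th vertex of $P$; then $\mathcal T(k,\ell,c)$ is the class of all trees $C(a,b,c,d,e)$ with $b+d=\ell$ and $a+b+c+d+e=k$ (a star may be trivial, i.e. $b=0$ or $d=0$ is allowed). *)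

theory Defs
  imports "HOL-Library.Ramsey"
begin

record 'a sgraph =
  vertices :: "'a set"
  edges :: "'a set set"

definition simple_graph :: "'a sgraph \<Rightarrow> bool" where
  "simple_graph G \<longleftrightarrow> finite (vertices G) \<and> edges G \<subseteq> [vertices G]\<^bsup>2\<^esup>"

text \<open>A path is given by its nonempty list of vertices; its length is one less than
  the length of the list.\<close>

definition is_path :: "'a sgraph \<Rightarrow> 'a list \<Rightarrow> bool" where
  "is_path G p \<longleftrightarrow> p \<noteq> [] \<and> distinct p \<and> set p \<subseteq> vertices G \<and>
     successively (\<lambda>u v. {u, v} \<in> edges G) p"

definition path_between :: "'a sgraph \<Rightarrow> 'a \<Rightarrow> 'a list \<Rightarrow> 'a \<Rightarrow> bool" where
  "path_between G u p v \<longleftrightarrow> is_path G p \<and> hd p = u \<and> last p = v"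

definition connected_graph :: "'a sgraph \<Rightarrow> bool" where
  "connected_graph G \<longleftrightarrow> vertices G \<noteq> {} \<and>
     (\<forall>u\<in>vertices G. \<forall>v\<in>vertices G. \<exists>p. path_between G u p v)"

definition acyclic_graph :: "'a sgraph \<Rightarrow> bool" where
  "acyclic_graph G \<longleftrightarrow>
     \<not> (\<exists>p. is_path G p \<and> length p \<ge> 3 \<and> {last p, hd p} \<in> edges G)"

definition is_tree :: "'a sgraph \<Rightarrow> bool" where
  "is_tree G \<longleftrightarrow> simple_graph G \<and> connected_graph G \<and> acyclic_graph G"

text \<open>Distance and diameter are only meaningful for connected graphs, where the
  minimum and the maximum below exist.\<close>

definition graph_dist :: "'a sgraph \<Rightarrow> 'a \<Rightarrow> 'a \<Rightarrow> nat" where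
  "graph_dist G u v = (LEAST n. \<exists>p. path_between G u p v \<and> n = length p - 1)"

definition graph_diameter :: "'a sgraph \<Rightarrow> nat" where
  "graph_diameter G = Max {graph_dist G u v | u v. u \<in> vertices G \<and> v \<in> vertices G}"

definition graph_iso :: "'a sgraph \<Rightarrow> 'b sgraph \<Rightarrow> bool" where
  "graph_iso G H \<longleftrightarrow> (\<exists>f. bij_betw f (vertices G) (vertices H) \<and>
     edges H = (\<lambda>e. f ` e) ` edges G)"

text \<open>The graph \<open>G\<close> contains a copy of \<open>T\<close> as a (not necessarily induced) subgraph.\<close>

definition contains_copy :: "'a sgraph \<Rightarrow> 'b sgraph \<Rightarrow> bool" where
  "contains_copy G T \<longleftrightarrow> (\<exists>f. inj_on f (vertices T) \<and> f ` vertices T \<subseteq> vertices G \<and>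
     (\<forall>e\<in>edges T. f ` e \<in> edges G))"

datatype colour = Red | Blue

definition colour_class :: "nat \<Rightarrow> (nat set \<Rightarrow> colour) \<Rightarrow> colour \<Rightarrow> nat sgraph" where
  "colour_class n col x =
     \<lparr>vertices = {..<n}, edges = {e \<in> [{..<n}]\<^bsup>2\<^esup>. col e = x}\<rparr>"

definition ramsey_property :: "nat \<Rightarrow> 'a sgraph \<Rightarrow> 'b sgraph \<Rightarrow> bool" where
  "ramsey_property n T1 T2 \<longleftrightarrow> (\<forall>col. contains_copy (colour_class n col Red) T1 \<or>
     contains_copy (colour_class n col Blue) T2)"

definition ramsey_number :: "'a sgraph \<Rightarrow> 'b sgraph \<Rightarrow> nat" where
  "ramsey_number T1 T2 = (LEAST n. ramsey_property n T1 T2)"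

text \<open>The tree \<open>C(a,b,c,d,e)\<close>: the path is \<open>0, \<dots>, a + c + e\<close>; the next \<open>b\<close> numbers are the
  leaves attached to its vertex \<open>a\<close>, the last \<open>d\<close> numbers are the leaves attached to its
  vertex \<open>a + c\<close> (the path vertices being counted from \<open>0\<close>).\<close>

definition caterpillar :: "nat \<Rightarrow> nat \<Rightarrow> nat \<Rightarrow> nat \<Rightarrow> nat \<Rightarrow> nat sgraph" where
  "caterpillar a b c d e =
     \<lparr>vertices = {0..a + c + e + b + d},
      edges = {{i, Suc i} | i. i < a + c + e} \<union>
        {{a, j} | j. a + c + e < j \<and> j \<le> a + c + e + b} \<union>
        {{a + c, j} | j. a + c + e + b < j \<and> j \<le> a + c + e + b + d}\<rparr>"

text \<open>The class of trees \<open>\<T>(k,\<ell>,c)\<close>, closed under isomorphism.\<close>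

definition caterpillar_class :: "nat \<Rightarrow> nat \<Rightarrow> nat \<Rightarrow> 'a sgraph set" where
  "caterpillar_class k l c = {T. simple_graph T \<and>
     (\<exists>a b d e. b + d = l \<and> a + b + c + d + e = k \<and> graph_iso T (caterpillar a b c d e))}"

text \<open>The minimum defining the Ramsey number is attained.\<close>

lemma contains_copy_homogeneous:
  assumes T: "simple_graph T" and H: "H \<in> [{..<N}]\<^bsup>card (vertices T)\<^esup>"
    and mono: "\<forall>e\<in>[H]\<^bsup>2\<^esup>. col e = x"
  shows "contains_copy (colour_class N col x) T"
proof -
  have "finite H" "card H = card (vertices T)" "H \<subseteq> {..<N}"
    using H by (auto simp: nsets_def)
  moreover have "finite (vertices T)"
    using T by (simp add: simple_graph_def)
  ultimately obtain f where f: "bij_betw f (vertices T) H"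
    using finite_same_card_bij[of "vertices T" H] by auto
  then have inj: "inj_on f (vertices T)" and im: "f ` vertices T = H"
    by (auto simp: bij_betw_def)
  have "f ` e \<in> [H]\<^bsup>2\<^esup>" if "e \<in> edges T" for e
  proof -
    have "e \<in> [vertices T]\<^bsup>2\<^esup>"
      using T that by (auto simp: simple_graph_def)
    then obtain u v where "e = {u, v}" "u \<in> vertices T" "v \<in> vertices T" "u \<noteq> v"
      by (rule nsets2_E)
    moreover from this have "f u \<noteq> f v" "f u \<in> H" "f v \<in> H"
      using inj im by (auto dest: inj_onD)
    ultimately show ?thesis
      by (auto simp: nsets_def)
  qed
  moreover have "[H]\<^bsup>2\<^esup> \<subseteq> [{..<N}]\<^bsup>2\<^esup>"
    using \<open>H \<subseteq> {..<N}\<close> by (rule nsets_mono)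
  ultimately show ?thesis
    using inj im mono \<open>H \<subseteq> {..<N}\<close>
    unfolding contains_copy_def colour_class_def by (intro exI[of _ f] conjI ballI) (simp_all add: subset_iff)
qed

lemma ramsey_property_ramsey_number:
  assumes "simple_graph T1" "simple_graph T2"
  shows "ramsey_property (ramsey_number T1 T2) T1 T2"
proof -
  obtain N :: nat where N: "partn_lst {..<N} [card (vertices T1), card (vertices T2)] 2"
    using ramsey_full by blast
  have "ramsey_property N T1 T2"
    unfolding ramsey_property_def
  proof
    fix col :: "nat set \<Rightarrow> colour"
    define f where "f e = (if col e = Red then 0 else Suc 0)" for e
    have "f \<in> [{..<N}]\<^bsup>2\<^esup> \<rightarrow> {..<2}"
      by (auto simp: f_def)
    then obtain i H where "i < length [card (vertices T1), card (vertices T2)]"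
      and H: "H \<in> [{..<N}]\<^bsup>([card (vertices T1), card (vertices T2)] ! i)\<^esup>"
      and f: "f ` [H]\<^bsup>2\<^esup> \<subseteq> {i}"
      by (rule partn_lstE[OF N]) simp_all
    then have i: "i < 2" by simp
    from i consider "i = 0" | "i = 1" by linarith
    then show "contains_copy (colour_class N col Red) T1 \<or>
        contains_copy (colour_class N col Blue) T2"
    proof cases
      case 1
      have "\<forall>e\<in>[H]\<^bsup>2\<^esup>. col e = Red"
        using f 1 by (auto simp: f_def split: if_splits)
      moreover have "H \<in> [{..<N}]\<^bsup>card (vertices T1)\<^esup>"
        using H 1 by simp
      ultimately show ?thesis
        using contains_copy_homogeneous[OF assms(1)] by blast
    next
      case 2
      have "\<forall>e\<in>[H]\<^bsup>2\<^esup>. col e = Blue"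
      proof
        fix e assume "e \<in> [H]\<^bsup>2\<^esup>"
        then have "f e = Suc 0" using f 2 by auto
        then show "col e = Blue" by (cases "col e") (simp_all add: f_def)
      qed
      moreover have "H \<in> [{..<N}]\<^bsup>card (vertices T2)\<^esup>"
        using H 2 by simp
      ultimately show ?thesis
        using contains_copy_homogeneous[OF assms(2)] by blast
    qed
  qed
  then show ?thesis
    unfolding ramsey_number_def by (rule LeastI)
qed

end

theory Submission
  imports Defs
begin


text \<open>
  Let \<open>n = k + m\<close>. At each vertex the red and the blue degree add up to \<open>k + m - 1\<close>, so each vertex has red
  degree at least \<open>k\<close> or blue degree at least \<open>m\<close>, and one of the two colours has at least \<open>n / 2\<close> such
  vertices. It remains to prove the Loebl--Komlos--Sos conjecture for the trees in question: a graph in which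
  the set \<open>L\<close> of vertices of degree at least \<open>k\<close> contains at least half of all vertices contains the tree.
  Edges outside \<open>L\<close> can be deleted, so the complement \<open>S\<close> of \<open>L\<close> is independent.

  For diameter at most five, the tree is an edge \<open>r1 r2\<close> with everything at distance at most two from it. If no
  adjacent pair of vertices can host \<open>r1 r2\<close>, then every vertex of \<open>L\<close> has so few neighbours in \<open>L\<close> and so many
  in \<open>S\<close> that double counting the edges between \<open>L\<close> and the vertices of \<open>S\<close> of degree below \<open>k / 2\<close>
  contradicts \<open>|S| \<le> |L|\<close>.

  For caterpillars, leaves at vertices of \<open>L\<close> can be added greedily, so one needs a path whose two
  branching vertices, at distance \<open>c\<close>, lie in \<open>L\<close>. Sliding such a window along a path with \<open>k\<close> edges either
  succeeds or forces the path to alternate between \<open>L\<close> and \<open>S\<close>, which is impossible for even \<open>c\<close>. The path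
  exists because, in a connected graph without long paths, \<open>S\<close> outnumbers \<open>L\<close>. For odd \<open>c\<close> the graph is
  dense enough for a cycle through all of \<open>L\<close>, along which the window can be rotated; if the cycle
  alternates, then a chord inside \<open>L\<close> changes the parity.
\<close>

section \<open>Paths and components\<close>

text \<open>The obstacle is the path with \<open>k\<close> edges, since vertices outside
  \<open>L\<close> have no lower degree bound. \<open>surplus\<close> proves more than is used, in a
  form that survives deleting an initial segment of a longest path from a root: degree bound and
  length bound vary independently, and the excess of vertices outside \<open>L\<close> is at least
  their difference. Entering a component after \<open>j\<close> path vertices lowers the length
  bound by \<open>j\<close> and the degree bound only by the number of neighbours lost, so the
  difference does not shrink if at most \<open>j\<close> are lost.

  For odd \<open>c\<close>, the condition \<open>l + c \<ge> n div 2\<close> leaves two regimes. If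
  \<open>n \<le> 2 * k\<close>, degrees in \<open>L\<close> reach \<open>n / 2\<close>, and
  \<open>c \<le> l\<close> keeps the spine, with its \<open>k - l\<close> edges, short enough for
  the cycles that occur. Otherwise only \<open>n = 2 * k + 1\<close> with \<open>l + c = k\<close>
  remains, so the spine ends at its branching vertices; the degree bound just misses
  \<open>n / 2\<close>, and a path through \<open>L\<close> takes the place of the cycle.\<close>

lemma card_no_consecutive:
  fixes N :: nat
  assumes "\<And>t. Suc t < N \<Longrightarrow> \<not> (A t \<and> B (Suc t))"
  shows "card {t. Suc t < N \<and> A t} + card {t. Suc t < N \<and> B (Suc t)} \<le> N - 1"
proof -
  have "card {t. Suc t < N \<and> A t} + card {t. Suc t < N \<and> B (Suc t)}
    = card ({t. Suc t < N \<and> A t} \<union> {t. Suc t < N \<and> B (Suc t)})"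
    using assms by (intro card_Un_disjoint[symmetric]) (auto intro: finite_subset[of _ "{..<N}"])
  also have "\<dots> \<le> card {..<N - 1}" by (intro card_mono) auto
  finally show ?thesis by simp
qed

lemma card_shift_le:
  fixes N :: nat
  shows "card {t. t < N \<and> B t} \<le> card {t. Suc t < N \<and> B (Suc t)} + (if B 0 then 1 else 0)"
proof -
  have "{t. t < N \<and> B t} \<subseteq> Suc ` {t. Suc t < N \<and> B (Suc t)} \<union> (if B 0 then {0} else {})"
  proof
    fix t assume "t \<in> {t. t < N \<and> B t}"
    then show "t \<in> Suc ` {t. Suc t < N \<and> B (Suc t)} \<union> (if B 0 then {0} else {})"
      by (cases t) auto
  qed
  moreover have "finite {t. Suc t < N \<and> B (Suc t)}" by (rule finite_subset[of _ "{..<N}"]) auto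
  ultimately have "card {t. t < N \<and> B t}
    \<le> card (Suc ` {t. Suc t < N \<and> B (Suc t)} \<union> (if B 0 then {0} else {}))"
    by (intro card_mono) auto
  also have "\<dots> \<le> card (Suc ` {t. Suc t < N \<and> B (Suc t)}) + card (if B 0 then {0::nat} else {})"
    by (rule card_Un_le)
  also have "\<dots> = card {t. Suc t < N \<and> B (Suc t)} + (if B 0 then 1 else 0)"
    by (simp add: card_image)
  finally show ?thesis .
qed

lemma not_last_index:
  fixes N :: nat
  assumes "\<not> A (N - 1)"
  shows "{t. t < N \<and> A t} = {t. Suc t < N \<and> A t}"
proof -
  have "t < N \<and> A t \<longleftrightarrow> Suc t < N \<and> A t" for t
  proof -
    have "t = N - 1 \<or> Suc t < N" if "t < N" using that by linarith
    with \<open>\<not> A (N - 1)\<close> show ?thesis by auto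
  qed
  then show ?thesis by simp
qed

locale sym_graph =
  fixes adj :: "'v \<Rightarrow> 'v \<Rightarrow> bool"
  assumes adj_sym: "adj u v \<Longrightarrow> adj v u"
    and adj_irrefl: "\<not> adj u u"
begin

definition nb :: "'v \<Rightarrow> 'v set" where
  "nb u = {v. adj u v}"

lemma mem_nb [simp]: "v \<in> nb u \<longleftrightarrow> adj u v"
  by (simp add: nb_def)

definition gpath :: "'v set \<Rightarrow> 'v list \<Rightarrow> bool" where
  "gpath X xs \<longleftrightarrow> xs \<noteq> [] \<and> distinct xs \<and> set xs \<subseteq> X \<and> successively adj xs"

lemma gpath_single [simp]: "gpath X [x] \<longleftrightarrow> x \<in> X"
  by (auto simp: gpath_def)

lemma gpath_ne: "gpath X xs \<Longrightarrow> xs \<noteq> []"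
  by (simp add: gpath_def)

lemma gpath_mono: "gpath X xs \<Longrightarrow> X \<subseteq> Y \<Longrightarrow> gpath Y xs"
  by (auto simp: gpath_def)

lemma gpath_rev [simp]: "gpath X (rev xs) \<longleftrightarrow> gpath X xs"
proof -
  have "(\<lambda>x y. adj y x) = adj"
    using adj_sym by blast
  then have "successively adj (rev xs) = successively adj xs"
    by (simp only: successively_rev)
  then show ?thesis
    by (simp add: gpath_def)
qed

lemma gpath_append:
  "xs \<noteq> [] \<Longrightarrow> ys \<noteq> [] \<Longrightarrow> gpath X (xs @ ys) \<longleftrightarrow>
    gpath X xs \<and> gpath X ys \<and> set xs \<inter> set ys = {} \<and> adj (last xs) (hd ys)"
  by (auto simp: gpath_def successively_append_iff)

lemma gpath_takeI: "gpath X xs \<Longrightarrow> 0 < n \<Longrightarrow> gpath X (take n xs)"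
  by (metis append_take_drop_id gpath_append gpath_def gr_implies_not0 append_Nil2 take_eq_Nil)

lemma gpath_dropI: "gpath X xs \<Longrightarrow> n < length xs \<Longrightarrow> gpath X (drop n xs)"
  by (metis append_take_drop_id gpath_append drop_eq_Nil not_le append_Nil)

lemma gpath_length: "finite X \<Longrightarrow> gpath X xs \<Longrightarrow> length xs \<le> card X"
  by (metis card_mono distinct_card gpath_def)

definition reach :: "'v set \<Rightarrow> 'v \<Rightarrow> 'v \<Rightarrow> bool" where
  "reach X = (\<lambda>a b. a \<in> X \<and> b \<in> X \<and> adj a b)\<^sup>*\<^sup>*"

definition component :: "'v set \<Rightarrow> 'v \<Rightarrow> 'v set" where
  "component X u = {x. reach X u x}"

lemma reach_refl [simp]: "reach X u u"
  by (simp add: reach_def)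

lemma reach_step: "reach X u x \<Longrightarrow> x \<in> X \<Longrightarrow> y \<in> X \<Longrightarrow> adj x y \<Longrightarrow> reach X u y"
  unfolding reach_def by (rule rtranclp.rtrancl_into_rtrancl) auto

lemma reach_trans: "reach X u x \<Longrightarrow> reach X x y \<Longrightarrow> reach X u y"
  unfolding reach_def by (rule rtranclp_trans)

lemma reach_sym: "reach X u x \<Longrightarrow> reach X x u"
proof -
  have "symp (\<lambda>a b. a \<in> X \<and> b \<in> X \<and> adj a b)"
    using adj_sym by (auto intro!: sympI)
  then show "reach X u x \<Longrightarrow> reach X x u"
    unfolding reach_def using symp_rtranclp sympD by metis
qed

lemma reach_mem: "reach X u x \<Longrightarrow> u \<in> X \<Longrightarrow> x \<in> X"
  unfolding reach_def by (induction rule: rtranclp_induct) auto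

lemma reach_mono: "reach X u x \<Longrightarrow> X \<subseteq> Y \<Longrightarrow> reach Y u x"
  unfolding reach_def by (erule rtranclp_mono[THEN predicate2D, rotated]) auto

lemma reach_path: "reach X u x \<Longrightarrow> u \<in> X \<Longrightarrow> \<exists>xs. gpath X xs \<and> hd xs = u \<and> last xs = x"
  unfolding reach_def
proof (induction rule: rtranclp_induct)
  case base
  then show ?case by (intro exI[of _ "[u]"]) simp
next
  case (step y z)
  then obtain xs where xs: "gpath X xs" "hd xs = u" "last xs = y" by blast
  show ?case
  proof (cases "z \<in> set xs")
    case True
    then obtain as bs where ab: "xs = as @ z # bs" by (meson split_list)
    have "gpath X (take (length (as @ [z])) xs)"
      using xs(1) by (intro gpath_takeI) auto
    then have "gpath X (as @ [z])" by (simp add: ab)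
    moreover have "hd (as @ [z]) = u" using xs(2) ab by (cases as) auto
    ultimately show ?thesis by (metis last_snoc)
  next
    case False
    then have "gpath X (xs @ [z])"
      using xs step gpath_ne[OF xs(1)] by (subst gpath_append) auto
    moreover have "hd (xs @ [z]) = u" using xs gpath_ne[OF xs(1)] by simp
    ultimately show ?thesis by (metis last_snoc)
  qed
qed

lemma path_reach: "gpath X xs \<Longrightarrow> x \<in> set xs \<Longrightarrow> reach X (hd xs) x"
proof (induction xs arbitrary: x rule: rev_induct)
  case Nil
  then show ?case by simp
next
  case (snoc y ys)
  show ?case
  proof (cases "ys = []")
    case True
    then show ?thesis using snoc.prems by simp
  next
    case False
    then have p: "gpath X ys" "y \<in> X" "adj (last ys) y"
      using snoc.prems(1) by (auto simp: gpath_append)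
    show ?thesis
    proof (cases "x = y")
      case True
      have "reach X (hd ys) (last ys)" using snoc.IH p False by simp
      then have "reach X (hd ys) y"
        using p False by (meson gpath_def last_in_set reach_step subset_iff)
      then show ?thesis using True False by simp
    next
      case False
      then show ?thesis using snoc \<open>ys \<noteq> []\<close> p by auto
    qed
  qed
qed

lemma component_refl [simp]: "u \<in> component X u"
  by (simp add: component_def)

lemma component_subset: "u \<in> X \<Longrightarrow> component X u \<subseteq> X"
  by (auto simp: component_def reach_mem)

lemma component_closed: "x \<in> component X u \<Longrightarrow> u \<in> X \<Longrightarrow> y \<in> X \<Longrightarrow> adj x y \<Longrightarrow> y \<in> component X u"
  unfolding component_def by (auto intro: reach_step dest: reach_mem)

text \<open>Every vertex on the way is itself in the component. This makes a component a connected
  graph of its own, to which an induction hypothesis can be applied.\<close>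

lemma reach_in_component: assumes "reach X u x" "u \<in> X" shows "reach (component X u) u x"
proof -
  have "(\<lambda>a b. a \<in> X \<and> b \<in> X \<and> adj a b)\<^sup>*\<^sup>* u x"
    using assms(1) by (simp add: reach_def)
  then show ?thesis
  proof (induction rule: rtranclp_induct)
    case base
    then show ?case by simp
  next
    case (step y z)
    then have "reach X u y" by (simp add: reach_def)
    with step have "y \<in> component X u" "z \<in> component X u"
      by (auto simp: component_def intro: reach_step)
    with step show ?case by (blast intro: reach_step)
  qed
qed

lemma component_eq: assumes "x \<in> component X u" shows "component X x = component X u"
  using assms unfolding component_def by (auto intro: reach_trans reach_sym)

lemma component_subset_closed:
  assumes "u \<in> Z" "\<And>x y. x \<in> Z \<Longrightarrow> y \<in> X \<Longrightarrow> adj x y \<Longrightarrow> y \<in> Z"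
  shows "component X u \<subseteq> Z"
proof
  fix x assume "x \<in> component X u"
  then have "reach X u x" by (simp add: component_def)
  then show "x \<in> Z"
    unfolding reach_def by (induction rule: rtranclp_induct) (use assms in auto)
qed

lemma longest_path:
  assumes "finite X" "u \<in> X"
  obtains P where "gpath X P" "hd P = u" "\<And>q. gpath X q \<Longrightarrow> hd q = u \<Longrightarrow> length q \<le> length P"
proof -
  let ?Q = "\<lambda>q. gpath X q \<and> hd q = u"
  have "?Q [u]" using assms by simp
  moreover have "\<forall>q. ?Q q \<longrightarrow> length q < Suc (card X)"
    using gpath_length[OF assms(1)] by (auto simp: less_Suc_eq_le)
  ultimately obtain P where "?Q P" "\<forall>q. ?Q q \<longrightarrow> length q \<le> length P"
    using ex_has_greatest_nat[of ?Q _ length "Suc (card X)"] by blast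
  then show ?thesis using that by blast
qed

lemma card_nb_list:
  assumes "distinct xs"
  shows "card (nb a \<inter> set xs) = card {t. t < length xs \<and> adj a (xs ! t)}"
proof -
  have "nb a \<inter> set xs = (!) xs ` {t. t < length xs \<and> adj a (xs ! t)}"
    by (auto simp: set_conv_nth)
  moreover have "inj_on ((!) xs) {t. t < length xs \<and> adj a (xs ! t)}"
    using assms by (auto simp: inj_on_def nth_eq_iff_index_eq)
  ultimately show ?thesis by (simp add: card_image)
qed

lemma double_count:
  assumes "finite X" "finite Y"
  shows "(\<Sum>x\<in>X. card (nb x \<inter> Y)) = (\<Sum>y\<in>Y. card (nb y \<inter> X))"
proof -
  have c: "card (nb x \<inter> Z) = (\<Sum>y\<in>Z. if adj x y then 1 else 0)" if "finite Z" for x Z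
    using that by (simp add: sum.If_cases nb_def Int_commute)
  have "(\<Sum>x\<in>X. card (nb x \<inter> Y)) = (\<Sum>y\<in>Y. \<Sum>x\<in>X. if adj x y then 1 else 0)"
    unfolding c[OF assms(2)] by (rule sum.swap)
  also have "\<dots> = (\<Sum>y\<in>Y. \<Sum>x\<in>X. if adj y x then 1 else 0)"
    using adj_sym by (intro sum.cong refl if_cong) blast+
  finally show ?thesis unfolding c[OF assms(1)] .
qed

lemma gpath_append3:
  "xs \<noteq> [] \<Longrightarrow> ys \<noteq> [] \<Longrightarrow> zs \<noteq> [] \<Longrightarrow> gpath X (xs @ ys @ zs) \<longleftrightarrow>
    gpath X xs \<and> gpath X ys \<and> gpath X zs \<and> set xs \<inter> set ys = {} \<and> set xs \<inter> set zs = {} \<and>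
    set ys \<inter> set zs = {} \<and> adj (last xs) (hd ys) \<and> adj (last ys) (hd zs)"
  by (auto simp: gpath_append)

context
  fixes X u n F G
  assumes max: "\<And>q. gpath X q \<Longrightarrow> hd q = u \<Longrightarrow> length q \<le> n"
    and F: "gpath X F" "hd F = u" and G: "gpath X G"
    and dis: "set F \<inter> set G = {}" and len: "n < length F + length G"
begin

text \<open>\<open>F\<close>, \<open>R\<close> and \<open>G\<close> in a row would be a path from
  \<open>u\<close> with more than \<open>n\<close> vertices.\<close>

lemma cross_no_route:
  assumes "gpath X R" "set R \<inter> set F = {}" "set R \<inter> set G = {}" "adj (last F) (hd R)"
  shows "\<not> adj (last R) (hd G)"
proof
  assume "adj (last R) (hd G)"
  then have "gpath X (F @ R @ G)"
    using F G dis assms gpath_ne by (subst gpath_append3) auto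
  moreover have "hd (F @ R @ G) = u" using F gpath_ne by simp
  ultimately show False using max len by fastforce
qed

text \<open>The crossing argument of Ore and Posa, for the path that an edge from \<open>last F\<close> to \<open>hd G\<close> would close.\<close>

lemma cross_degrees:
  "card (nb (last F) \<inter> (set F \<union> set G)) + card (nb (hd G) \<inter> (set F \<union> set G))
    \<le> length F + length G - 1"
proof -
  let ?a = "last F" and ?b = "hd G"
  have ne: "F \<noteq> []" "G \<noteq> []" using F G gpath_ne by auto
  have dF: "distinct F" and dG: "distinct G" using F G by (auto simp: gpath_def)
  \<comment> \<open>Otherwise run along \<open>F\<close> to \<open>F ! t\<close>, jump to
    \<open>last F\<close>, go back to \<open>F ! Suc t\<close> and jump to
    \<open>hd G\<close>.\<close>
  have nF: "\<not> (adj ?a (F ! t) \<and> adj ?b (F ! Suc t))" if "Suc t < length F" for t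
  proof
    assume h: "adj ?a (F ! t) \<and> adj ?b (F ! Suc t)"
    let ?A = "take (Suc t) F" and ?B = "drop (Suc t) F"
    have FAB: "gpath X (?A @ ?B)" using F by simp
    have ne': "?A \<noteq> []" "?B \<noteq> []" using that by auto
    have s: "set F = set ?A \<union> set ?B" by (metis append_take_drop_id set_append)
    have l: "last ?A = F ! t" using that by (simp add: take_Suc_conv_app_nth)
    have h2: "hd (rev ?B) = ?a" using ne' by (simp add: hd_rev)
    have l2: "last (rev ?B) = F ! Suc t" using that by (simp add: last_rev hd_drop_conv_nth)
    have "gpath X (?A @ rev ?B @ G)"
      using FAB[unfolded gpath_append[OF ne']] h adj_sym G dis s ne ne'
      by (subst gpath_append3) (auto simp: l h2 l2 Int_Un_distrib2)
    moreover have "hd (?A @ rev ?B @ G) = u" using F ne' by (simp add: hd_append)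
    moreover have "length (?A @ rev ?B @ G) = length F + length G" using that by simp
    ultimately show False using max len by fastforce
  qed
  \<comment> \<open>The mirror image: from \<open>last F\<close> jump to \<open>G ! t\<close>, go
    back to \<open>hd G\<close>, jump to \<open>G ! Suc t\<close> and run to the end.\<close>
  have nG: "\<not> (adj ?a (G ! t) \<and> adj ?b (G ! Suc t))" if "Suc t < length G" for t
  proof
    assume h: "adj ?a (G ! t) \<and> adj ?b (G ! Suc t)"
    let ?A = "take (Suc t) G" and ?B = "drop (Suc t) G"
    have GAB: "gpath X (?A @ ?B)" using G by simp
    have ne': "?A \<noteq> []" "?B \<noteq> []" using that by auto
    have s: "set G = set ?A \<union> set ?B" by (metis append_take_drop_id set_append)
    have l: "last (rev ?A) = ?b" using ne ne' by (simp add: last_rev)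
    have h2: "hd (rev ?A) = G ! t" using that ne' by (simp add: hd_rev take_Suc_conv_app_nth)
    have l2: "hd ?B = G ! Suc t" using that by (simp add: hd_drop_conv_nth)
    have "gpath X (F @ rev ?A @ ?B)"
      using GAB[unfolded gpath_append[OF ne']] h adj_sym F dis s ne ne'
      by (subst gpath_append3) (auto simp: l h2 l2 Int_Un_distrib)
    moreover have "hd (F @ rev ?A @ ?B) = u" using F ne by simp
    moreover have "length (F @ rev ?A @ ?B) = length F + length G" using that by simp
    ultimately show False using max len by fastforce
  qed
  have nl: "\<not> adj ?a (last G)"
  proof
    assume h: "adj ?a (last G)"
    have "gpath X (F @ rev G)"
      using h F G dis ne by (subst gpath_append) (auto simp: hd_rev)
    moreover have "hd (F @ rev G) = u" using F ne by simp
    ultimately show False using max[of "F @ rev G"] len by simp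
  qed
  have aF: "card (nb ?a \<inter> set F) = card {t. Suc t < length F \<and> adj ?a (F ! t)}"
  proof -
    have "\<not> adj ?a (F ! (length F - 1))" using ne adj_irrefl by (simp add: last_conv_nth)
    from not_last_index[of "\<lambda>t. adj ?a (F ! t)", OF this] show ?thesis by (simp add: card_nb_list[OF dF])
  qed
  have aG: "card (nb ?a \<inter> set G) = card {t. Suc t < length G \<and> adj ?a (G ! t)}"
  proof -
    have "\<not> adj ?a (G ! (length G - 1))" using ne nl by (simp add: last_conv_nth)
    from not_last_index[of "\<lambda>t. adj ?a (G ! t)", OF this] show ?thesis by (simp add: card_nb_list[OF dG])
  qed
  \<comment> \<open>The \<open>+ 1\<close> pays for a neighbour of \<open>hd G\<close> at
    \<open>hd F\<close>, which has no predecessor to cross with. In \<open>bG\<close> nothing is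
    lost, as \<open>hd G\<close> is not adjacent to itself.\<close>
  have bF: "card (nb ?b \<inter> set F) \<le> card {t. Suc t < length F \<and> adj ?b (F ! Suc t)} + 1"
    using card_shift_le[of "length F" "\<lambda>t. adj ?b (F ! t)"] by (auto simp: card_nb_list[OF dF] split: if_splits)
  have bG: "card (nb ?b \<inter> set G) \<le> card {t. Suc t < length G \<and> adj ?b (G ! Suc t)}"
    using card_shift_le[of "length G" "\<lambda>t. adj ?b (G ! t)"] ne adj_irrefl
    by (auto simp: card_nb_list[OF dG] hd_conv_nth split: if_splits)
  have cF: "card (nb ?a \<inter> set F) + card (nb ?b \<inter> set F) \<le> length F"
    using aF bF card_no_consecutive[of "length F" "\<lambda>t. adj ?a (F ! t)" "\<lambda>t. adj ?b (F ! t)"] nF ne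
    by (cases "length F") fastforce+
  have cG: "card (nb ?a \<inter> set G) + card (nb ?b \<inter> set G) \<le> length G - 1"
    using aG bG card_no_consecutive[of "length G" "\<lambda>t. adj ?a (G ! t)" "\<lambda>t. adj ?b (G ! t)"] nG by fastforce
  have sp: "card (nb x \<inter> (set F \<union> set G)) = card (nb x \<inter> set F) + card (nb x \<inter> set G)" for x
    unfolding Int_Un_distrib using dis by (subst card_Un_disjoint) auto
  show ?thesis using cF cG sp ne by (cases G) auto
qed

end

end

section \<open>Surplus of low-degree vertices in path-free graphs\<close>

lemma split_at:
  assumes "Suc i < length P"
  obtains F G where "P = F @ G" "F \<noteq> []" "G \<noteq> []" "last F = P ! i" "hd G = P ! Suc i"
    "length F = Suc i" "length G = length P - Suc i"
proof (rule that[of "take (Suc i) P" "drop (Suc i) P"])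
  show "last (take (Suc i) P) = P ! i"
    using assms by (simp add: take_Suc_conv_app_nth)
  show "hd (drop (Suc i) P) = P ! Suc i"
    using assms by (simp add: hd_drop_conv_nth)
qed (use assms in auto)

lemma split_at2:
  assumes "i < j" "Suc j < length P"
  obtains F M G where "P = F @ M @ G" "F \<noteq> []" "M \<noteq> []" "G \<noteq> []" "last F = P ! i"
    "hd M = P ! Suc i" "last M = P ! j" "hd G = P ! Suc j" "length F = Suc i" "length M = j - i"
    "F @ M = take (Suc j) P"
proof -
  have "Suc i < length P" using assms by simp
  then obtain F Q where 1: "P = F @ Q" "F \<noteq> []" "last F = P ! i" "hd Q = P ! Suc i"
    "length F = Suc i" "length Q = length P - Suc i"
    by (rule split_at)
  have "Suc (j - Suc i) < length Q" using assms 1(6) by linarith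
  then obtain M G where 2: "Q = M @ G" "M \<noteq> []" "G \<noteq> []" "last M = Q ! (j - Suc i)"
    "hd G = Q ! Suc (j - Suc i)" "length M = Suc (j - Suc i)"
    by (rule split_at)
  have 3: "Q ! (j - Suc i) = P ! j" "Q ! Suc (j - Suc i) = P ! Suc j"
    using assms 1(5) by (auto simp: 1(1) nth_append Suc_diff_Suc)
  have 4: "hd M = P ! Suc i" using 1(4) 2(1,2) by simp
  have 5: "length M = j - i" using 2(6) assms by simp
  have "F @ M = take (Suc j) P" using 1(5) 5 assms by (simp add: 1(1) 2(1))
  then show ?thesis
    using that[of F M G] 1 2 3 4 5 by simp
qed

section \<open>The excess of vertices outside \<open>L\<close>\<close>

locale lgraph = sym_graph adj for adj :: "'v \<Rightarrow> 'v \<Rightarrow> bool" +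
  fixes L :: "'v set"
  assumes indep: "adj u v \<Longrightarrow> u \<in> L \<or> v \<in> L"
begin

text \<open>A signed sum, so that the excess is additive over disjoint sets and may be
  negative.\<close>

definition phi :: "'v set \<Rightarrow> int" where
  "phi Z = (\<Sum>x\<in>Z. if x \<in> L then -1 else 1)"

lemma phi_Un: "finite A \<Longrightarrow> finite B \<Longrightarrow> A \<inter> B = {} \<Longrightarrow> phi (A \<union> B) = phi A + phi B"
  unfolding phi_def by (rule sum.union_disjoint)

lemma phi_eq: "finite A \<Longrightarrow> phi A = int (card (A - L)) - int (card (A \<inter> L))"
proof -
  assume A: "finite A"
  have "phi ((A - L) \<union> (A \<inter> L)) = phi (A - L) + phi (A \<inter> L)"
    using A by (intro phi_Un) auto
  moreover have "(A - L) \<union> (A \<inter> L) = A" by auto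
  moreover have "phi (A - L) = int (card (A - L))" by (simp add: phi_def)
  moreover have "phi (A \<inter> L) = - int (card (A \<inter> L))" by (simp add: phi_def)
  ultimately show ?thesis by simp
qed

lemma phi_eq2: "finite A \<Longrightarrow> phi A = 2 * int (card (A - L)) - int (card A)"
proof -
  assume A: "finite A"
  have "card A = card (A - L) + card (A \<inter> L)"
    using A by (subst card_Un_disjoint[symmetric]) (auto intro: arg_cong[of _ _ card])
  then show ?thesis using phi_eq[OF A] by simp
qed

lemma card_components_le_phi:
  assumes "finite Z" "Z \<subseteq> H" "\<And>x y. x \<in> Z \<Longrightarrow> y \<in> H \<Longrightarrow> adj x y \<Longrightarrow> y \<in> Z"
    and one: "\<And>z. z \<in> Z \<Longrightarrow> 1 \<le> phi (component H z)"
  shows "int (card (component H ` Z)) \<le> phi Z"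
proof -
  have sub: "component H z \<subseteq> Z" if "z \<in> Z" for z
    using that assms by (intro component_subset_closed) auto
  have "\<Union> (component H ` Z) = Z" using sub by auto
  moreover have "phi (\<Union> (component H ` Z)) = (\<Sum>C\<in>component H ` Z. phi C)"
    unfolding phi_def
  proof (subst sum.Union_disjoint)
    show "\<forall>A\<in>component H ` Z. finite A" using sub assms(1) by (auto intro: finite_subset)
    show "\<forall>A\<in>component H ` Z. \<forall>B\<in>component H ` Z. A \<noteq> B \<longrightarrow> A \<inter> B = {}"
      using component_eq by blast
  qed simp
  moreover have "(\<Sum>C\<in>component H ` Z. 1) \<le> (\<Sum>C\<in>component H ` Z. phi C)"
    using one by (intro sum_mono) auto
  ultimately show ?thesis by simp
qed

end

section \<open>Rerouting a longest path from a root\<close>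

locale rooted_path = lgraph adj L for adj :: "'v \<Rightarrow> 'v \<Rightarrow> bool" and L +
  fixes X :: "'v set" and u :: 'v and \<kappa> \<mu> :: nat and P :: "'v list"
  assumes finX: "finite X" and uX: "u \<in> X" and conn: "\<And>x. x \<in> X \<Longrightarrow> reach X u x"
    and XL: "X \<inter> L \<noteq> {}" and deg: "\<And>x. x \<in> X \<Longrightarrow> x \<in> L \<Longrightarrow> \<kappa> \<le> card (nb x \<inter> X)"
    and P: "gpath X P" "hd P = u" "length P = Suc \<mu>"
    and max: "\<And>q. gpath X q \<Longrightarrow> hd q = u \<Longrightarrow> length q \<le> Suc \<mu>"
    and lt: "\<mu> < \<kappa>"
begin

lemma P_facts: "P \<noteq> []" "distinct P" "set P \<subseteq> X" "finite (set P)" "card (set P) = Suc \<mu>"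
  "P ! 0 = u" "u \<in> set P" "last P = P ! \<mu>"
  using P by (auto simp: gpath_def distinct_card hd_conv_nth last_conv_nth)

lemma P_adj: "Suc i \<le> \<mu> \<Longrightarrow> adj (P ! i) (P ! Suc i)"
  using P successively_nth[of adj P i] by (auto simp: gpath_def)

lemma last_nb: assumes "gpath X q" "hd q = u" "length q = Suc \<mu>"
  shows "nb (last q) \<inter> X \<subseteq> set q - {last q}"
proof
  fix z assume z: "z \<in> nb (last q) \<inter> X"
  have "z \<in> set q"
  proof (rule ccontr)
    assume "z \<notin> set q"
    then have "gpath X (q @ [z])" using z assms gpath_ne by (subst gpath_append) auto
    moreover have "hd (q @ [z]) = u" using assms gpath_ne by simp
    ultimately show False using max[of "q @ [z]"] assms by simp
  qed
  then show "z \<in> set q - {last q}" using z adj_irrefl by auto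
qed

text \<open>An endpoint has at most \<open>\<mu> < \<kappa>\<close> neighbours, all of them on the
  path. It is stated for every longest path \<open>q\<close>, because it is also applied to rerouted
  copies of \<open>P\<close>.\<close>

lemma last_notin_L: assumes "gpath X q" "hd q = u" "length q = Suc \<mu>" shows "last q \<notin> L"
proof
  assume l: "last q \<in> L"
  have q: "q \<noteq> []" "distinct q" "set q \<subseteq> X" using assms by (auto simp: gpath_def)
  then have "last q \<in> X" by auto
  then have "\<kappa> \<le> card (nb (last q) \<inter> X)" using deg l by blast
  also have "\<dots> \<le> card (set q - {last q})" using last_nb[OF assms] by (intro card_mono) auto
  also have "\<dots> = \<mu>" using q assms by (simp add: card_Diff_singleton distinct_card)
  finally show False using lt by simp
qed

text \<open>Since the neighbours of \<open>last P\<close> all lie on \<open>P\<close>, the vertex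
  \<open>x\<close> misses \<open>last P\<close> and sees at most \<open>\<mu>\<close>
  vertices.\<close>

lemma trivial_notin_L: assumes "x \<in> X - set P" "nb x \<inter> X \<subseteq> set P" shows "x \<notin> L"
proof
  assume "x \<in> L"
  then have "\<kappa> \<le> card (nb x \<inter> X)" using deg assms by blast
  also have "\<dots> \<le> card (set P - {last P})"
  proof (intro card_mono)
    show "nb x \<inter> X \<subseteq> set P - {last P}"
    proof
      fix z assume z: "z \<in> nb x \<inter> X"
      have "z \<noteq> last P"
      proof
        assume "z = last P"
        then have "x \<in> nb (last P) \<inter> X" using z assms adj_sym by auto
        then show False using last_nb[OF P] assms by auto
      qed
      then show "z \<in> set P - {last P}" using z assms by auto
    qed
  qed simp
  also have "\<dots> = \<mu>" using P_facts by (metis card_Diff_singleton diff_Suc_1 last_in_set)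
  finally show False using lt by simp
qed

lemma off_degree: assumes "x \<in> set P" "x \<in> L" shows "\<kappa> \<le> card (nb x \<inter> (X - set P)) + \<mu>"
proof -
  have "\<kappa> \<le> card (nb x \<inter> X)" using deg assms P_facts by blast
  also have "\<dots> \<le> card ((nb x \<inter> (X - set P)) \<union> (set P - {x}))"
    using finX adj_irrefl by (intro card_mono) auto
  also have "\<dots> \<le> card (nb x \<inter> (X - set P)) + card (set P - {x})" by (rule card_Un_le)
  also have "card (set P - {x}) = \<mu>" using P_facts assms by (simp add: card_Diff_singleton)
  finally show ?thesis .
qed

lemma lambda_pos: "0 < \<mu>"
proof (rule ccontr)
  assume "\<not> 0 < \<mu>"
  then have Pu: "P = [u]" using P by (cases P) auto
  have "component X u \<subseteq> {u}"
    using last_nb[OF P] Pu by (intro component_subset_closed) auto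
  then have "X \<subseteq> {u}" using conn by (auto simp: component_def)
  then show False using XL last_notin_L[OF P] Pu by auto
qed

lemma P_ends: "P ! \<mu> \<notin> L" "P ! (\<mu> - 1) \<in> L"
proof -
  show "P ! \<mu> \<notin> L" using last_notin_L[OF P] P_facts by simp
  then show "P ! (\<mu> - 1) \<in> L"
    using P_adj[of "\<mu> - 1"] lambda_pos indep by fastforce
qed

lemma no_insert:
  assumes "Suc i \<le> \<mu>" "gpath X R" "set R \<inter> set P = {}" "adj (P ! i) (hd R)"
  shows "\<not> adj (last R) (P ! Suc i)"
proof
  assume a: "adj (last R) (P ! Suc i)"
  obtain F G where FG: "P = F @ G" "F \<noteq> []" "G \<noteq> []" "last F = P ! i" "hd G = P ! Suc i"
    using split_at[of i P] assms(1) P(3) by (metis Suc_le_eq le_imp_less_Suc)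
  have "gpath X (F @ R @ G)"
    using P(1)[unfolded FG(1) gpath_append[OF FG(2,3)]] FG assms a gpath_ne
    by (subst gpath_append3) (auto simp: FG(4,5))
  moreover have "hd (F @ R @ G) = u" using FG P by auto
  ultimately show False using max[of "F @ R @ G"] P FG gpath_ne[OF assms(2)] by (cases R) auto
qed

text \<open>Follow \<open>P\<close> to \<open>P ! i\<close>, take the detour \<open>R\<close> to
  \<open>P ! j\<close> and return along \<open>P\<close> to \<open>P ! Suc i\<close>;
  \<open>G\<close> is the untouched rest. Together \<open>F\<close> and \<open>G\<close> have more
  than \<open>Suc \<mu>\<close> vertices, which is the situation of the crossing argument.\<close>

lemma swap:
  assumes ij: "i < j" "j < \<mu>" and R: "gpath X R" "set R \<inter> set P = {}"
    and a: "adj (P ! i) (hd R)" "adj (last R) (P ! j)"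
  obtains F G where "gpath X F" "hd F = u" "last F = P ! Suc i" "gpath X G" "hd G = P ! Suc j"
    "set F \<inter> set G = {}" "set F \<union> set G = set P \<union> set R" "length F = Suc j + length R"
    "length F + length G = Suc \<mu> + length R" "set F = set (take (Suc j) P) \<union> set R"
proof -
  obtain F M G where FG: "P = F @ M @ G" "F \<noteq> []" "M \<noteq> []" "G \<noteq> []" "last F = P ! i"
    "hd M = P ! Suc i" "last M = P ! j" "hd G = P ! Suc j" "length F = Suc i" "length M = j - i"
    "F @ M = take (Suc j) P"
    using split_at2[of i j P] assms P by (metis Suc_less_eq)
  note * = P(1)[unfolded FG(1) gpath_append3[OF FG(2,3,4)]]
  show ?thesis
  proof (rule that[of "F @ R @ rev M" G])
    show "gpath X (F @ R @ rev M)"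
      using * FG R a gpath_ne[OF R(1)] by (subst gpath_append3) (auto simp: hd_rev)
    show "set (F @ R @ rev M) = set (take (Suc j) P) \<union> set R"
      unfolding FG(11)[symmetric] by auto
    show "last (F @ R @ rev M) = P ! Suc i" using FG by (simp add: last_rev)
    show "hd (F @ R @ rev M) = u" using FG P by auto
    show "length (F @ R @ rev M) = Suc j + length R" using FG ij by simp
    show "length (F @ R @ rev M) + length G = Suc \<mu> + length R" using P(3) FG(1) by simp
  qed (use * FG R in auto)
qed

lemma swap_no_route:
  assumes ij: "i < j" "j < \<mu>" and R: "gpath X R" "set R \<inter> set P = {}"
    and a: "adj (P ! i) (hd R)" "adj (last R) (P ! j)"
    and R': "gpath X R'" "set R' \<inter> set P = {}" "set R \<inter> set R' = {}" "adj (P ! Suc i) (hd R')"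
  shows "\<not> adj (last R') (P ! Suc j)"
proof -
  obtain F G where FG: "gpath X F" "hd F = u" "last F = P ! Suc i" "gpath X G" "hd G = P ! Suc j"
    "set F \<inter> set G = {}" "set F \<union> set G = set P \<union> set R"
    "length F + length G = Suc \<mu> + length R"
    using swap[OF ij R a] by metis
  have d: "set R' \<inter> set F = {}" "set R' \<inter> set G = {}" using FG(7) R' by blast+
  have "length F + length G > Suc \<mu>" using FG gpath_ne[OF R(1)] by (cases R) auto
  then show ?thesis
    using cross_no_route[OF max FG(1,2,4,6) _ R'(1) d] FG R' by metis
qed

text \<open>Two counts are added: on \<open>insert w (set P)\<close> the crossing argument bounds
  the degree sum by \<open>\<mu> + 1\<close>, and elsewhere the two vertices have no common
  neighbour, by \<open>swap_no_route\<close>.\<close>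

lemma swap_degrees:
  assumes ij: "i < j" "j < \<mu>" and w: "w \<in> X - set P" "adj (P ! i) w" "adj w (P ! j)"
    and l: "P ! Suc i \<in> L" "P ! Suc j \<in> L"
  shows "2 * \<kappa> \<le> \<mu> + 1 + card ((nb (P ! Suc i) \<union> nb (P ! Suc j)) \<inter> (X - set P))"
proof -
  let ?a = "P ! Suc i" and ?b = "P ! Suc j"
  have R: "gpath X [w]" "set [w] \<inter> set P = {}" "adj (P ! i) (hd [w])" "adj (last [w]) (P ! j)"
    using w by auto
  obtain F G where FG: "gpath X F" "hd F = u" "last F = ?a" "gpath X G" "hd G = ?b"
    "set F \<inter> set G = {}" "set F \<union> set G = set P \<union> set [w]"
    "length F + length G = Suc \<mu> + length [w]"
    using swap[OF ij R] by metis
  have "length F + length G > Suc \<mu>" using FG by simp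
  from cross_degrees[OF max FG(1,2,4,6) this] FG(3,5,7,8)
  have 1: "card (nb ?a \<inter> insert w (set P)) + card (nb ?b \<inter> insert w (set P)) \<le> \<mu> + 1"
    by simp
  let ?W = "X - set P"
  have 2: "\<kappa> \<le> card (nb z \<inter> insert w (set P)) + card (nb z \<inter> (?W - {w}))" if "z \<in> X" "z \<in> L" for z
  proof -
    have "\<kappa> \<le> card (nb z \<inter> X)" using deg that by blast
    also have "\<dots> \<le> card ((nb z \<inter> insert w (set P)) \<union> (nb z \<inter> (?W - {w})))"
      using finX P_facts by (intro card_mono) auto
    also have "\<dots> \<le> card (nb z \<inter> insert w (set P)) + card (nb z \<inter> (?W - {w}))" by (rule card_Un_le)
    finally show ?thesis .
  qed
  have ab: "?a \<in> X" "?b \<in> X" using ij P P_facts by (auto simp: subset_iff)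
  have "nb ?a \<inter> (?W - {w}) \<inter> (nb ?b \<inter> (?W - {w})) = {}"
  proof (rule ccontr)
    assume "\<not> ?thesis"
    then obtain z where "z \<in> ?W" "z \<noteq> w" "adj ?a z" "adj ?b z" by force
    then show False using swap_no_route[OF ij R, of "[z]"] adj_sym by auto
  qed
  then have "card (nb ?a \<inter> (?W - {w})) + card (nb ?b \<inter> (?W - {w}))
    = card ((nb ?a \<inter> (?W - {w})) \<union> (nb ?b \<inter> (?W - {w})))"
    using finX by (intro card_Un_disjoint[symmetric]) auto
  also have "\<dots> \<le> card ((nb ?a \<union> nb ?b) \<inter> ?W)" using finX by (intro card_mono) auto
  finally show ?thesis using 1 2[OF ab(1) l(1)] 2[OF ab(2) l(2)] by linarith
qed

text \<open>Every vertex off \<open>P\<close> sees only \<open>P\<close>, hence lies outside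
  \<open>L\<close>. The claim then reads \<open>\<kappa> + 1 \<le> card ?W + 2 * ?s\<close>: if few
  path vertices lie outside \<open>L\<close>, there must be many vertices off the path.\<close>

lemma surplus_trivial:
  assumes triv: "\<And>x y y'. x \<in> set P \<Longrightarrow> y \<in> X - set P \<Longrightarrow> adj x y \<Longrightarrow> y' \<in> X - set P \<Longrightarrow> \<not> adj y y'"
  shows "int \<kappa> - int \<mu> \<le> phi X"
proof -
  let ?W = "X - set P"
  let ?s = "card (set P - L)"
  have "component X u \<subseteq> set P \<union> {y \<in> ?W. \<exists>x\<in>set P. adj x y}"
    using P_facts triv adj_sym by (intro component_subset_closed) blast+
  then have cov: "\<exists>x\<in>set P. adj x y" if "y \<in> ?W" for y
    using that conn[of y] by (auto simp: component_def)
  have W: "y \<notin> L" if "y \<in> ?W" for y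
  proof (rule trivial_notin_L[OF that])
    have yW: "y \<in> ?W" by (rule that)
    obtain x where "x \<in> set P" "adj x y" using cov[OF yW] by blast
    then have "\<not> adj y y'" if "y' \<in> X - set P" for y' using triv[OF _ yW _ that] by blast
    then show "nb y \<inter> X \<subseteq> set P" by (simp add: nb_def) blast
  qed
  have phiX: "phi X = 2 * int ?s - int (Suc \<mu>) + int (card ?W)"
  proof -
    have "phi (set P \<union> ?W) = phi (set P) + phi ?W"
      using finX by (intro phi_Un) auto
    moreover have "set P \<union> ?W = X" using P_facts by auto
    moreover have "?W - L = ?W" "?W \<inter> L = {}" using W by auto
    ultimately show ?thesis using finX P_facts by (simp add: phi_eq2 phi_eq[of ?W])
  qed
  define N where "N = {j. j < \<mu> \<and> P ! j \<notin> L}"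
  have finN: "finite N" unfolding N_def by simp
  have cN: "card N + 1 = ?s"
  proof -
    have "set P - L = (!) P ` insert \<mu> N"
      using P P_ends by (auto simp: N_def set_conv_nth less_Suc_eq)
    moreover have "inj_on ((!) P) (insert \<mu> N)"
      using P P_facts by (auto simp: inj_on_def N_def nth_eq_iff_index_eq)
    moreover have "\<mu> \<notin> N" by (simp add: N_def)
    ultimately show ?thesis using finN by (simp add: card_image)
  qed
  \<comment> \<open>The positions where a shared neighbour off \<open>P\<close> can be exploited.
    Position \<open>\<mu> - 1\<close> belongs to them although its successor is outside
    \<open>L\<close>: rerouting from there absorbs all of \<open>P\<close>, so the new path has
    maximal length and ends in \<open>L\<close> at the successor of the other position.\<close>
  define J where "J = {j. j < \<mu> \<and> P ! j \<in> L \<and> (j = \<mu> - 1 \<or> P ! Suc j \<in> L)}"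
  have finJ: "finite J" unfolding J_def by simp
  have zJ: "\<mu> - 1 \<in> J" using lambda_pos P_ends by (simp add: J_def)
  then have "card J \<noteq> 0" using finJ by (metis card_0_eq empty_iff)
  then have J1: "1 \<le> card J" by simp
  \<comment> \<open>A position of \<open>L\<close> outside \<open>J\<close> is followed by a
    position in \<open>N\<close>.\<close>
  have cJ: "\<mu> \<le> card J + 2 * card N"
  proof -
    have "{..<\<mu>} \<subseteq> J \<union> N \<union> {j. Suc j \<in> N}"
    proof
      fix j assume "j \<in> {..<\<mu>}"
      moreover from this have "j = \<mu> - 1 \<or> Suc j < \<mu>" by auto
      ultimately show "j \<in> J \<union> N \<union> {j. Suc j \<in> N}" by (auto simp: J_def N_def)
    qed
    moreover have fS: "finite {j. Suc j \<in> N}" by (rule finite_subset[of _ "{..<\<mu>}"]) (auto simp: N_def)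
    ultimately have "card {..<\<mu>} \<le> card (J \<union> N \<union> {j. Suc j \<in> N})"
      using finJ finN by (intro card_mono) auto
    also have "\<dots> \<le> card (J \<union> N) + card {j. Suc j \<in> N}" by (rule card_Un_le)
    also have "card (J \<union> N) \<le> card J + card N" by (rule card_Un_le)
    also have "card {j. Suc j \<in> N} = card (Suc ` {j. Suc j \<in> N})" by (simp add: card_image)
    also have "\<dots> \<le> card N" using finN by (intro card_mono) auto
    finally show ?thesis by simp
  qed
  define C where "C j = nb (P ! j) \<inter> ?W" for j
  have finW: "finite ?W" using finX by simp
  have "\<kappa> + 1 \<le> card ?W + 2 * ?s"
  proof (cases "\<exists>i\<in>J. \<exists>j\<in>J. i < j \<and> C i \<inter> C j \<noteq> {}")
    case True
    then obtain i j where ij: "i \<in> J" "j \<in> J" "i < j" and "C i \<inter> C j \<noteq> {}" by blast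
    then obtain w where "w \<in> C i" "w \<in> C j" by blast
    then have w: "w \<in> ?W" "adj (P ! i) w" "adj (P ! j) w" by (simp_all add: C_def)
    have jl: "j < \<mu>" and iL: "P ! Suc i \<in> L" using ij by (auto simp: J_def)
    show ?thesis
    proof (cases "j = \<mu> - 1")
      case True
      have R: "gpath X [w]" "set [w] \<inter> set P = {}" "adj (P ! i) (hd [w])" "adj (last [w]) (P ! j)"
        using w adj_sym by auto
      obtain F where F: "gpath X F" "hd F = u" "last F = P ! Suc i" "length F = Suc j + length [w]"
        using swap[OF \<open>i < j\<close> jl R] by metis
      then have "length F = Suc \<mu>" using True lambda_pos by simp
      from last_notin_L[OF F(1,2) this] F iL show ?thesis by simp
    next
      case False
      then have jL: "P ! Suc j \<in> L" using ij by (auto simp: J_def)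
      have "2 * \<kappa> \<le> \<mu> + 1 + card ((nb (P ! Suc i) \<union> nb (P ! Suc j)) \<inter> ?W)"
        using swap_degrees[OF \<open>i < j\<close> jl _ _ _ iL jL] w adj_sym by blast
      also have "card ((nb (P ! Suc i) \<union> nb (P ! Suc j)) \<inter> ?W) \<le> card ?W"
        using finW by (intro card_mono) auto
      finally show ?thesis using cN lt by linarith
    qed
  next
    case False
    have "card J * (\<kappa> - \<mu>) = (\<Sum>j\<in>J. \<kappa> - \<mu>)" by simp
    also have "\<dots> \<le> (\<Sum>j\<in>J. card (C j))"
    proof (intro sum_mono)
      fix j assume "j \<in> J"
      then have "P ! j \<in> set P" "P ! j \<in> L" using P by (auto simp: J_def)
      from off_degree[OF this] show "\<kappa> - \<mu> \<le> card (C j)" by (simp add: C_def)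
    qed
    also have "\<dots> = card (\<Union>j\<in>J. C j)"
    proof (rule card_UN_disjoint[symmetric])
      show "\<forall>i\<in>J. \<forall>j\<in>J. i \<noteq> j \<longrightarrow> C i \<inter> C j = {}"
        using False by (metis Int_commute linorder_neqE_nat)
    qed (use finJ finW in \<open>auto simp: C_def\<close>)
    also have "\<dots> \<le> card ?W" using finW by (intro card_mono) (auto simp: C_def)
    finally have *: "card J * (\<kappa> - \<mu>) \<le> card ?W" .
    \<comment> \<open>\<open>x + y \<le> x * y + 1\<close> for positive \<open>x\<close> and
      \<open>y\<close>; this turns the count by disjoint neighbourhoods into a linear bound.\<close>
    have "card J + (\<kappa> - \<mu>) \<le> card J * (\<kappa> - \<mu>) + 1"
    proof -
      obtain x y where "card J = Suc x" "\<kappa> - \<mu> = Suc y"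
        using J1 lt by (metis One_nat_def Suc_le_D zero_less_diff gr0_implies_Suc)
      then show ?thesis by simp
    qed
    then show ?thesis using * cJ cN lt by linarith
  qed
  then show ?thesis using phiX by linarith
qed

end

lemma nat_greatest:
  fixes Q :: "nat \<Rightarrow> bool"
  assumes "Q j" "\<And>j. Q j \<Longrightarrow> j \<le> b"
  shows "\<exists>i. Q i \<and> (\<forall>j. Q j \<longrightarrow> j \<le> i)"
  using GreatestI_nat[of Q j b] Greatest_le_nat[of Q _ b] assms by blast

section \<open>The induction step with a nontrivial component off the path\<close>

context rooted_path
begin

context
  assumes IH: "\<And>Z z k' l'. Z \<subset> X \<Longrightarrow> z \<in> Z \<Longrightarrow> (\<And>x. x \<in> Z \<Longrightarrow> reach Z z x) \<Longrightarrow> Z \<inter> L \<noteq> {} \<Longrightarrow>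
      (\<And>x. x \<in> Z \<Longrightarrow> x \<in> L \<Longrightarrow> k' \<le> card (nb x \<inter> Z)) \<Longrightarrow>
      (\<And>q. gpath Z q \<Longrightarrow> hd q = z \<Longrightarrow> length q \<le> Suc l') \<Longrightarrow> l' < k' \<Longrightarrow> int k' - int l' \<le> phi Z"
begin

text \<open>A path in \<open>C\<close> from \<open>e\<close> prolongs \<open>Q\<close>, so it has at
  most \<open>Suc \<mu> - length Q\<close> vertices, while vertices of \<open>L\<close> in
  \<open>C\<close> lose at most \<open>t\<close> neighbours. For \<open>t = length Q\<close> the
  full difference \<open>\<kappa> - \<mu>\<close> is inherited, and every further vertex of
  \<open>Q\<close> is a gain.\<close>

lemma piece:
  assumes C: "C \<subseteq> X" "e \<in> C" "\<And>x. x \<in> C \<Longrightarrow> reach C e x" "C \<inter> L \<noteq> {}"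
    and Q: "gpath X Q" "hd Q = u" "adj (last Q) e" "set Q \<inter> C = {}"
    and D: "\<And>x. x \<in> C \<Longrightarrow> x \<in> L \<Longrightarrow> card (nb x \<inter> (X - C)) \<le> t"
    and t: "t \<le> length Q"
  shows "int \<kappa> - int t - int \<mu> + int (length Q) \<le> phi C"
proof -
  have neQ: "Q \<noteq> []" using Q gpath_ne by auto
  have ext: "length Q + length q \<le> Suc \<mu>" if "gpath C q" "hd q = e" for q
  proof -
    have "gpath X (Q @ q)"
      using that Q gpath_mono[OF that(1) C(1)] gpath_ne[OF that(1)] neQ
      by (subst gpath_append) (auto simp: gpath_def)
    moreover have "hd (Q @ q) = u" using Q neQ by simp
    ultimately show ?thesis using max[of "Q @ q"] by simp
  qed
  have lQ: "length Q \<le> \<mu>" using ext[of "[e]"] C by simp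
  have "u \<in> set Q" using Q neQ by auto
  then have "C \<subset> X" using C Q uX by auto
  moreover have "\<kappa> - t \<le> card (nb x \<inter> C)" if "x \<in> C" "x \<in> L" for x
  proof -
    have "\<kappa> \<le> card (nb x \<inter> X)" using deg that C by blast
    also have "\<dots> \<le> card ((nb x \<inter> C) \<union> (nb x \<inter> (X - C)))"
      using finX C by (intro card_mono) (auto intro: finite_subset)
    also have "\<dots> \<le> card (nb x \<inter> C) + card (nb x \<inter> (X - C))" by (rule card_Un_le)
    finally show ?thesis using D[OF that] by simp
  qed
  moreover have "length q \<le> Suc (\<mu> - length Q)" if "gpath C q" "hd q = e" for q
    using ext[OF that] lQ by linarith
  moreover have "\<mu> - length Q < \<kappa> - t" using t lQ lt by linarith
  ultimately have "int (\<kappa> - t) - int (\<mu> - length Q) \<le> phi C"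
    using IH[of C e "\<kappa> - t" "\<mu> - length Q"] C by blast
  then show ?thesis using t lQ lt by linarith
qed

lemma take_path: "gpath X (take (Suc j) P)" "hd (take (Suc j) P) = u"
  "j \<le> \<mu> \<Longrightarrow> last (take (Suc j) P) = P ! j" "j \<le> \<mu> \<Longrightarrow> length (take (Suc j) P) = Suc j"
  using P by (auto intro: gpath_takeI simp: take_Suc_conv_app_nth)

text \<open>Enter the component from its last attachment \<open>P ! j\<close>. At most
  \<open>Suc j\<close> neighbours are lost and \<open>Suc j\<close> path vertices precede, so
  \<open>piece\<close> yields \<open>\<kappa> - \<mu> \<ge> 1\<close>. A component avoiding
  \<open>L\<close> has positive excess because it is nonempty.\<close>

lemma component_pos:
  assumes i: "i < \<mu>" and z: "z \<in> X - set (take (Suc i) P)"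
  shows "1 \<le> phi (component (X - set (take (Suc i) P)) z)"
proof -
  let ?A = "set (take (Suc i) P)"
  let ?C = "component (X - ?A) z"
  have CH: "?C \<subseteq> X - ?A" using z by (rule component_subset)
  then have finC: "finite ?C" using finX by (auto intro: finite_subset)
  show ?thesis
  proof (cases "?C \<inter> L = {}")
    case True
    then have "phi ?C = int (card ?C)"
      using phi_eq[OF finC] by (simp add: Diff_triv)
    moreover have "z \<in> ?C" by simp
    then have "card ?C > 0" using finC card_gt_0_iff by blast
    ultimately show ?thesis by simp
  next
    case False
    have Aeq: "x \<in> ?A \<longleftrightarrow> (\<exists>j\<le>i. x = P ! j)" for x
      using i P(3) by (auto simp: in_set_conv_nth less_Suc_eq_le)
    define Q where "Q j \<longleftrightarrow> j \<le> i \<and> (\<exists>e\<in>?C. adj (P ! j) e)" for j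
    have "\<exists>j. Q j"
    proof (rule ccontr)
      assume no: "\<not> (\<exists>j. Q j)"
      have "component X z \<subseteq> ?C"
      proof (rule component_subset_closed)
        fix x y assume xy: "x \<in> ?C" "y \<in> X" "adj x y"
        have "y \<notin> ?A" using no xy adj_sym by (auto simp: Q_def Aeq)
        then show "y \<in> ?C" using component_closed[OF xy(1)] z xy by auto
      qed simp
      moreover have "u \<in> component X z" using conn[of z] z by (auto simp: component_def intro: reach_sym)
      moreover have "u \<in> ?A" using P_facts(6) by (auto simp: Aeq intro!: exI[of _ 0])
      ultimately show False using CH by auto
    qed
    then obtain j0 where j0: "Q j0" ..
    have "\<And>j. Q j \<Longrightarrow> j \<le> i" by (simp add: Q_def)
    from nat_greatest[of Q, OF j0 this]
    obtain j where j: "Q j" and jmax: "\<And>j'. Q j' \<Longrightarrow> j' \<le> j" by blast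
    obtain e where e: "e \<in> ?C" "adj (P ! j) e" and ji: "j \<le> i" using j by (auto simp: Q_def)
    have eH: "e \<in> X - ?A" using e(1) CH by blast
    have Ce: "?C = component (X - ?A) e" using component_eq[OF e(1)] by simp
    have "int \<kappa> - int (Suc j) - int \<mu> + int (length (take (Suc j) P)) \<le> phi ?C"
    proof (rule piece)
      show "reach ?C e x" if "x \<in> ?C" for x
        using that reach_in_component[OF _ eH, of x] unfolding Ce by (simp add: component_def)
      have sub: "set (take (Suc j) P) \<subseteq> ?A" using ji by (simp add: set_take_subset_set_take)
      show "set (take (Suc j) P) \<inter> ?C = {}" using sub CH by auto
      show "card (nb x \<inter> (X - ?C)) \<le> Suc j" if x: "x \<in> ?C" "x \<in> L" for x
      proof -
        have "nb x \<inter> (X - ?C) \<subseteq> set (take (Suc j) P)"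
        proof
          fix y assume y: "y \<in> nb x \<inter> (X - ?C)"
          then have "y \<in> ?A" using component_closed[OF x(1)] z by auto
          then obtain j' where j': "j' \<le> i" "y = P ! j'" by (auto simp: Aeq)
          then have "Q j'" using x y adj_sym by (auto simp: Q_def)
          then have "j' \<le> j" by (rule jmax)
          then show "y \<in> set (take (Suc j) P)"
            using j' i P(3) by (auto simp: in_set_conv_nth intro!: exI[of _ j'])
        qed
        then have "card (nb x \<inter> (X - ?C)) \<le> card (set (take (Suc j) P))"
          by (intro card_mono) auto
        also have "\<dots> \<le> length (take (Suc j) P)" by (rule card_length)
        finally show ?thesis by simp
      qed
    qed (use CH e False take_path[of j] ji i in auto)
    then show ?thesis using lt take_path(4)[of j] ji i by simp
  qed
qed

text \<open>
  Let \<open>p i\<close> be the last vertex of \<open>P\<close> to which a component \<open>Y\<close> of \<open>X - P\<close> with at least two vertices is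
  attached. Delete \<open>A = {p 0, \<dots>, p i}\<close> and apply induction to the component \<open>K\<close> of the rest of \<open>P\<close>, to
  \<open>Y\<close>, and to the remaining components. If \<open>y0\<close> in \<open>Y\<close> has \<open>r\<close> neighbours \<open>p a\<close> in \<open>A\<close>, then the
  successors \<open>p (Suc a)\<close> in \<open>L\<close> are attached to pairwise distinct components outside \<open>P\<close>, since otherwise \<open>P\<close> could
  be made longer. Those attached outside \<open>K\<close> (\<open>I1\<close>) contribute one further component each; if
  only one of them is attached inside \<open>K\<close> only (\<open>I2\<close>), then \<open>K\<close> can be entered after a path that
  is longer by one, and if there are two of them, then they have many neighbours in \<open>K\<close>.
\<close>

lemma surplus_nontrivial:
  assumes nontriv: "\<exists>x y y'. x \<in> set P \<and> y \<in> X - set P \<and> adj x y \<and> y' \<in> X - set P \<and> adj y y'"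
  shows "int \<kappa> - int \<mu> \<le> phi X"
proof -
  define Q where "Q i \<longleftrightarrow> i \<le> \<mu> \<and> (\<exists>y y'. y \<in> X - set P \<and> y' \<in> X - set P \<and> adj (P ! i) y \<and> adj y y')" for i
  obtain x0 y1 y2 where 0: "x0 \<in> set P" "y1 \<in> X - set P" "adj x0 y1" "y2 \<in> X - set P" "adj y1 y2"
    using nontriv by blast
  obtain i0 where "i0 \<le> \<mu>" "x0 = P ! i0"
    using 0(1) P(3) by (auto simp: in_set_conv_nth less_Suc_eq_le)
  with 0 have i0: "Q i0" unfolding Q_def by blast
  have "\<And>j. Q j \<Longrightarrow> j \<le> \<mu>" by (simp add: Q_def)
  from nat_greatest[of Q, OF i0 this]
  obtain i where i: "Q i" and imax: "\<And>j. Q j \<Longrightarrow> j \<le> i" by blast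
  obtain y y' where y: "y \<in> X - set P" "y' \<in> X - set P" "adj (P ! i) y" "adj y y'" and i\<mu>: "i \<le> \<mu>"
    using i by (auto simp: Q_def)
  \<comment> \<open>\<open>P ! 0, \<dots>, P ! i, y, y'\<close> is a path. Hence
    \<open>P ! Suc i\<close> and \<open>P ! (\<mu> - 1)\<close> both lie beyond \<open>A\<close>,
    and \<open>P ! (\<mu> - 1)\<close> is the vertex that makes \<open>K\<close> meet
    \<open>L\<close>.\<close>
  have i2: "i + 2 \<le> \<mu>"
  proof -
    have ne: "take (Suc i) P \<noteq> []" using P_facts by simp
    have "gpath X (take (Suc i) P @ [y] @ [y'])"
      using take_path[of i] i\<mu> y ne adj_irrefl
      by (subst gpath_append3) (auto dest: in_set_takeD)
    moreover have "hd (take (Suc i) P @ [y] @ [y']) = u" using take_path(2)[of i] ne by simp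
    ultimately have "length (take (Suc i) P @ [y] @ [y']) \<le> Suc \<mu>" by (rule max)
    then show ?thesis using take_path(4)[OF i\<mu>] by simp
  qed
  define A where "A = set (take (Suc i) P)"
  define T where "T = set (drop (Suc i) P)"
  define H where "H = X - A"
  define Y where "Y = component (X - set P) y"
  define K where "K = component H (P ! Suc i)"
  have PAT: "set P = A \<union> T" unfolding A_def T_def by (metis append_take_drop_id set_append)
  have ATd: "A \<inter> T = {}" unfolding A_def T_def
    using P_facts(2) by (metis append_take_drop_id distinct_append)
  have Aeq: "x \<in> A \<longleftrightarrow> (\<exists>j\<le>i. x = P ! j)" for x
    unfolding A_def using i2 P(3) by (auto simp: in_set_conv_nth less_Suc_eq_le)
  have Peq: "x \<in> set P \<longleftrightarrow> (\<exists>j\<le>\<mu>. x = P ! j)" for x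
    using P(3) by (auto simp: in_set_conv_nth less_Suc_eq_le)
  have Pinj: "P ! a = P ! b \<longleftrightarrow> a = b" if "a \<le> \<mu>" "b \<le> \<mu>" for a b
    using that P(3) P_facts(2) by (simp add: nth_eq_iff_index_eq)
  have Tjeq: "P ! j \<in> T \<longleftrightarrow> i < j" if "j \<le> \<mu>" for j
    using that PAT ATd Aeq[of "P ! j"] Peq[of "P ! j"] Pinj i\<mu> by (metis Int_iff Un_iff emptyE le_trans not_le)
  have AX: "A \<subseteq> X" "T \<subseteq> X" using PAT P_facts(3) by auto
  have fin: "finite A" "finite T" by (auto simp: A_def T_def)
  have cA: "card A = Suc i" using PAT ATd P_facts take_path(4)[OF i\<mu>] take_path(1)[of i]
    unfolding A_def gpath_def by (metis distinct_card)
  have cT: "card T = \<mu> - i"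
    using cA card_Un_disjoint[OF fin ATd] PAT P_facts(5) by simp
  have TH: "T \<subseteq> H" using AX ATd by (auto simp: H_def)
  have PsT: "P ! Suc i \<in> T" using Tjeq[of "Suc i"] i2 by simp

  have YX: "Y \<subseteq> X - set P" unfolding Y_def using y by (intro component_subset) auto
  have yY: "y \<in> Y" by (simp add: Y_def)
  have y'Y: "y' \<in> Y" unfolding Y_def by (rule component_closed[OF component_refl]) (use y in auto)
  \<comment> \<open>Thus the maximality of \<open>i\<close> applies to every vertex of
    \<open>Y\<close>, not only to \<open>y\<close>, and \<open>Y\<close> is attached to
    \<open>A\<close> alone.\<close>
  have Ynb: "\<exists>z'\<in>X - set P. adj z z'" if z: "z \<in> Y" for z
  proof (cases "z = y")
    case True
    then show ?thesis using y by auto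
  next
    case False
    have "(\<lambda>a b. a \<in> X - set P \<and> b \<in> X - set P \<and> adj a b)\<^sup>*\<^sup>* y z"
      using z by (simp add: Y_def component_def reach_def)
    then show ?thesis using False by (cases rule: rtranclp.cases) (use adj_sym in auto)
  qed
  have Yatt: "j \<le> i" if t: "z \<in> Y" "j \<le> \<mu>" "adj (P ! j) z" for z j
  proof (rule imax)
    obtain z' where "z' \<in> X - set P" "adj z z'" using Ynb[OF t(1)] by blast
    then show "Q j" using t YX by (auto simp: Q_def)
  qed
  have YA: "x \<in> Y \<or> x \<in> A" if "z \<in> Y" "x \<in> X" "adj z x" for x z
  proof (cases "x \<in> set P")
    case True
    then obtain j where "j \<le> \<mu>" "x = P ! j" by (auto simp: Peq)
    then show ?thesis using Yatt[of z j] that adj_sym Aeq by blast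
  next
    case False
    then show ?thesis using component_closed[of z "X - set P" y x] that y by (auto simp: Y_def)
  qed
  have YH: "Y \<subseteq> H" using YX PAT by (auto simp: H_def)
  have KH: "K \<subseteq> H" unfolding K_def using PsT TH by (intro component_subset) auto
  have TK: "T \<subseteq> K"
  proof
    fix x assume x: "x \<in> T"
    have "gpath H (drop (Suc i) P)"
      using gpath_dropI[OF P(1), of "Suc i"] i2 P(3) TH by (auto simp: gpath_def T_def)
    from path_reach[OF this] x have "reach H (hd (drop (Suc i) P)) x" by (simp add: T_def)
    moreover have "hd (drop (Suc i) P) = P ! Suc i" using i2 P(3) by (simp add: hd_drop_conv_nth)
    ultimately show "x \<in> K" by (simp add: K_def component_def)
  qed
  have KY: "K \<inter> Y = {}"
  proof (rule ccontr)
    assume "K \<inter> Y \<noteq> {}"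
    then obtain x where x: "x \<in> K" "x \<in> Y" by auto
    have "component H x \<subseteq> Y"
      using x YA by (intro component_subset_closed) (auto simp: H_def)
    moreover have "component H x = K" using component_eq x(1) by (auto simp: K_def)
    ultimately have "P ! Suc i \<in> Y" using TK PsT by auto
    then show False using YX PAT PsT by auto
  qed
  \<comment> \<open>The off-path vertices attached beyond \<open>i\<close>. By maximality of
    \<open>i\<close> they have no neighbour off \<open>P\<close>, so they lie outside
    \<open>L\<close>, and \<open>K\<close> consists of \<open>T\<close> and some of them.\<close>
  define W where "W = {z \<in> X - set P. \<exists>j\<le>\<mu>. i < j \<and> adj (P ! j) z}"
  have Wnb: "nb z \<inter> X \<subseteq> set P" if z: "z \<in> W" for z
  proof (rule ccontr)
    assume "\<not> ?thesis"
    then obtain z' where "z' \<in> nb z \<inter> X" "z' \<notin> set P" by blast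
    then have z': "z' \<in> X - set P" "adj z z'" by auto
    obtain j where j: "j \<le> \<mu>" "i < j" "adj (P ! j) z" "z \<in> X - set P" using z by (auto simp: W_def)
    then have "Q j" using z' unfolding Q_def by blast
    then show False using imax j by fastforce
  qed
  have WL: "z \<notin> L" if z: "z \<in> W" for z
    using trivial_notin_L[OF _ Wnb[OF z]] z by (auto simp: W_def)
  have KTW: "K \<subseteq> T \<union> W"
    unfolding K_def
  proof (rule component_subset_closed)
    show "P ! Suc i \<in> T \<union> W" using PsT by simp
    fix x z assume x: "x \<in> T \<union> W" and z: "z \<in> H" and xz: "adj x z"
    show "z \<in> T \<union> W"
    proof (cases "z \<in> set P")
      case True
      then show ?thesis using z PAT by (auto simp: H_def)
    next
      case False
      have "x \<notin> W" using subsetD[OF Wnb[of x], of z] False xz z by (auto simp: H_def)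
      then have "x \<in> T" using x by simp
      then obtain j where "j \<le> \<mu>" "x = P ! j" using PAT Peq by blast
      moreover have "i < j" using calculation \<open>x \<in> T\<close> Tjeq by simp
      ultimately show ?thesis using False z xz unfolding W_def H_def by blast
    qed
  qed
  have finK: "finite K" "finite Y" "finite W"
    using KH YX finX by (auto simp: H_def W_def intro: finite_subset)

  \<comment> \<open>The maximum runs over \<open>Y \<inter> L\<close> only: it is the loss of degree
    when \<open>piece\<close> is applied to \<open>Y\<close>, and a vertex attaining it supplies the
    indices \<open>I\<close>.\<close>
  define r where "r = Max ((\<lambda>z. card (nb z \<inter> A)) ` (Y \<inter> L))"
  have YL: "Y \<inter> L \<noteq> {}" using indep[OF y(4)] yY y'Y by auto
  have rmax: "card (nb z \<inter> A) \<le> r" if "z \<in> Y" "z \<in> L" for z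
    unfolding r_def using that finK by (intro Max_ge) auto
  have "r \<in> (\<lambda>z. card (nb z \<inter> A)) ` (Y \<inter> L)"
    unfolding r_def using YL finK by (intro Max_in) auto
  then obtain y0 where y0: "y0 \<in> Y" "y0 \<in> L" "card (nb y0 \<inter> A) = r" by auto
  have rle: "r \<le> Suc i" using y0(3) cA card_mono[OF fin(1), of "nb y0 \<inter> A"] by simp

  have lA: "last (take (Suc i) P) = P ! i" "length (take (Suc i) P) = Suc i"
    using take_path i\<mu> by auto
  have phiY: "int \<kappa> - int r - int \<mu> + int (Suc i) \<le> phi Y"
  proof -
    have "int \<kappa> - int r - int \<mu> + int (length (take (Suc i) P)) \<le> phi Y"
    proof (rule piece)
      show "reach Y y x" if "x \<in> Y" for x
        using that reach_in_component[of "X - set P" y x] y unfolding Y_def by (auto simp: component_def)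
      show "card (nb x \<inter> (X - Y)) \<le> r" if "x \<in> Y" "x \<in> L" for x
      proof -
        have "nb x \<inter> (X - Y) \<subseteq> nb x \<inter> A" using that by (auto dest: YA)
        then have "card (nb x \<inter> (X - Y)) \<le> card (nb x \<inter> A)" using fin by (intro card_mono) auto
        then show ?thesis using rmax[OF that] by simp
      qed
      show "set (take (Suc i) P) \<inter> Y = {}" using YH by (auto simp: H_def A_def)
    qed (use YX yY YL take_path[of i] lA y rle in auto)
    then show ?thesis using lA by simp
  qed
  have "P ! (\<mu> - 1) \<in> T" using Tjeq[of "\<mu> - 1"] i2 by simp
  then have KL: "K \<inter> L \<noteq> {}" using TK P_ends(2) by auto
  have KDeg: "card (nb x \<inter> (X - K)) \<le> Suc i" if "x \<in> K" for x
  proof -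
    have "nb x \<inter> (X - K) \<subseteq> A"
    proof
      fix z assume z: "z \<in> nb x \<inter> (X - K)"
      have "z \<notin> H" using component_closed[of x H "P ! Suc i" z] that z PsT TH by (auto simp: K_def)
      then show "z \<in> A" using z by (auto simp: H_def)
    qed
    then show ?thesis using card_mono[OF fin(1)] cA by metis
  qed
  have Kreach: "reach K e x" if "x \<in> K" "e \<in> K" for x e
  proof -
    have eq: "K = component H e" using component_eq that by (auto simp: K_def)
    have "e \<in> H" using that KH by blast
    moreover have "reach H e x" using that(1) eq by (simp add: component_def)
    ultimately show ?thesis unfolding eq by (metis reach_in_component)
  qed
  have phiK: "int \<kappa> - int \<mu> \<le> phi K"
  proof -
    have "int \<kappa> - int (Suc i) - int \<mu> + int (length (take (Suc i) P)) \<le> phi K"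
    proof (rule piece)
      show "adj (last (take (Suc i) P)) (P ! Suc i)"
        using lA P_adj[of i] i2 by simp
      show "set (take (Suc i) P) \<inter> K = {}" using KH by (auto simp: H_def A_def)
    qed (use KH TK PsT KL take_path[of i] lA KDeg Kreach in \<open>auto simp: H_def\<close>)
    then show ?thesis using lA by simp
  qed
  define s where "s = card (A - L)"
  have phiA: "phi A = 2 * int s - int (Suc i)" using phi_eq2[OF fin(1)] cA by (simp add: s_def)
  define R where "R = H - K - Y"
  have finR: "finite R" using finX by (simp add: R_def H_def)
  have XU: "phi X = phi A + phi K + phi Y + phi R"
  proof -
    have "X = A \<union> (K \<union> (Y \<union> R))" using AX KH YH by (auto simp: R_def H_def)
    moreover have "phi (A \<union> (K \<union> (Y \<union> R))) = phi A + (phi K + (phi Y + phi R))"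
      using fin finK finR KY KH YH
      by (subst phi_Un, simp, simp, fastforce simp: R_def H_def)+ simp
    ultimately show ?thesis by simp
  qed
  have Rcl: "z \<in> R" if "x \<in> R" "z \<in> H" "adj x z" for x z
  proof -
    have "z \<notin> Y" using YA[of z x] that adj_sym by (auto simp: R_def H_def)
    moreover have "z \<notin> K" using component_closed[of z H "P ! Suc i" x] that adj_sym PsT TH
      by (auto simp: R_def K_def)
    ultimately show ?thesis using that by (simp add: R_def)
  qed
  have Rc: "int (card (component H ` R)) \<le> phi R"
  proof (rule card_components_le_phi[OF finR])
    show "R \<subseteq> H" by (auto simp: R_def)
    show "1 \<le> phi (component H z)" if "z \<in> R" for z
      using component_pos[of i z] i2 that by (simp add: R_def H_def A_def)
  qed (rule Rcl)

  \<comment> \<open>So far \<open>phi X\<close> is at least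
    \<open>2 * (\<kappa> - \<mu>) + 2 * s - r + phi R\<close>, so
    \<open>r \<le> (\<kappa> - \<mu>) + 2 * s + phi R\<close> would suffice. What is missing has to
    come from \<open>R\<close> or from a better bound for \<open>K\<close>.\<close>
  show ?thesis
  proof (cases "r = 0")
    case True
    then show ?thesis using XU phiA phiK phiY Rc lt by linarith
  next
    case False
    define I where "I = {a. a \<le> i \<and> adj y0 (P ! a)}"
    have finI: "finite I" unfolding I_def by simp
    have cI: "card I = r"
    proof -
      have "nb y0 \<inter> A = (!) P ` I" by (auto simp: I_def Aeq)
      moreover have "inj_on ((!) P) I" using Pinj i\<mu> by (auto simp: inj_on_def I_def)
      ultimately show ?thesis using y0 by (simp add: card_image)
    qed
    define m where "m = Max I"
    have Ine: "I \<noteq> {}" using cI False by auto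
    have m: "m \<in> I" "\<And>a. a \<in> I \<Longrightarrow> a \<le> m" using finI Ine by (auto simp: m_def)
    \<comment> \<open>The largest index is dropped because its successor may lie outside
      \<open>A\<close>; this is the \<open>1\<close> in \<open>cI'\<close>. Successors outside
      \<open>L\<close> are paid for by \<open>s\<close>.\<close>
    define I' where "I' = {a \<in> I. a \<noteq> m \<and> P ! Suc a \<in> L}"
    have finI': "finite I'" using finI by (simp add: I'_def)
    have I'D: "adj y0 (P ! a)" "a < m" "Suc a \<le> i" "P ! Suc a \<in> L" "a < \<mu>" if "a \<in> I'" for a
    proof -
      show "adj y0 (P ! a)" "P ! Suc a \<in> L" using that by (auto simp: I'_def I_def)
      have "a \<in> I" "a \<noteq> m" using that by (auto simp: I'_def)
      then show "a < m" using m(2) by (simp add: le_neq_implies_less)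
      then show "Suc a \<le> i" "a < \<mu>" using m(1) i\<mu> by (auto simp: I_def)
    qed
    have cI': "r \<le> card I' + s + 1"
    proof -
      have "I \<subseteq> insert m (I' \<union> {a. a < m \<and> P ! Suc a \<notin> L})"
        using m by (auto simp: I'_def le_neq_implies_less)
      from card_mono[OF _ this] have "r \<le> card (insert m (I' \<union> {a. a < m \<and> P ! Suc a \<notin> L}))"
        using finI' cI by simp
      also have "\<dots> \<le> Suc (card (I' \<union> {a. a < m \<and> P ! Suc a \<notin> L}))" by (simp add: card_insert_if finI')
      also have "card (I' \<union> {a. a < m \<and> P ! Suc a \<notin> L}) \<le> card I' + card {a. a < m \<and> P ! Suc a \<notin> L}"
        by (rule card_Un_le)
      also have "card {a. a < m \<and> P ! Suc a \<notin> L} \<le> s"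
        unfolding s_def
      proof (rule card_inj_on_le[of "\<lambda>a. P ! Suc a"])
        have "m \<le> i" using m(1) by (simp add: I_def)
        then show "inj_on (\<lambda>a. P ! Suc a) {a. a < m \<and> P ! Suc a \<notin> L}"
          using Pinj i\<mu> by (auto simp: inj_on_def)
        show "(\<lambda>a. P ! Suc a) ` {a. a < m \<and> P ! Suc a \<notin> L} \<subseteq> A - L"
        proof
          fix x assume "x \<in> (\<lambda>a. P ! Suc a) ` {a. a < m \<and> P ! Suc a \<notin> L}"
          then obtain a where "a < m" "x = P ! Suc a" "x \<notin> L" by auto
          moreover from this have "Suc a \<le> i" using \<open>m \<le> i\<close> by simp
          ultimately show "x \<in> A - L" by (auto simp: Aeq)
        qed
      qed (use fin in auto)
      finally show ?thesis by simp
    qed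
    have y0P: "y0 \<in> X - set P" using y0 YX by auto
    define Off where "Off a = nb (P ! Suc a) \<inter> (X - set P)" for a
    have Off_ne: "Off a \<noteq> {}" if "a \<in> I'" for a
    proof
      assume "Off a = {}"
      moreover have "P ! Suc a \<in> set P" using I'D(5)[OF that] P(3) by simp
      ultimately show False
        using off_degree[OF _ I'D(4)[OF that]] lt by (simp add: Off_def)
    qed
    \<comment> \<open>A path through \<open>Y\<close> from \<open>y0\<close> to such a neighbour
      could be inserted between \<open>P ! a\<close> and \<open>P ! Suc a\<close>.\<close>
    have OffY: "Off a \<inter> Y = {}" if a: "a \<in> I'" for a
    proof (rule ccontr)
      assume "Off a \<inter> Y \<noteq> {}"
      then obtain z where z: "z \<in> Y" "adj (P ! Suc a) z" by (auto simp: Off_def)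
      have "reach (X - set P) y0 z"
        using y0 z by (auto simp: Y_def component_def intro: reach_trans reach_sym)
      then obtain q where q: "gpath (X - set P) q" "hd q = y0" "last q = z"
        using reach_path y0P by metis
      have "\<not> adj (last q) (P ! Suc a)"
        by (rule no_insert) (use q I'D[OF a] i\<mu> adj_sym gpath_mono[OF q(1)] in \<open>auto simp: gpath_def\<close>)
      then show False using q z adj_sym by blast
    qed
    define I1 where "I1 = {a \<in> I'. \<not> Off a \<subseteq> K}"
    define I2 where "I2 = {a \<in> I'. Off a \<subseteq> K}"
    have cI12: "card I' = card I1 + card I2"
      using finI' by (subst card_Un_disjoint[symmetric]) (auto simp: I1_def I2_def intro: arg_cong[of _ _ card])
    have ry0: "gpath X [y0]" "set [y0] \<inter> set P = {}" using y0P by auto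
    have c1: "card I1 \<le> card (component H ` R)"
    proof -
      have "\<forall>a\<in>I1. \<exists>z. z \<in> Off a \<and> z \<notin> K" by (auto simp: I1_def)
      then obtain f where f: "\<And>a. a \<in> I1 \<Longrightarrow> f a \<in> Off a \<and> f a \<notin> K" by metis
      have fR: "f a \<in> R" if "a \<in> I1" for a
        using f[OF that] OffY[of a] that PAT by (auto simp: R_def H_def I1_def Off_def)
      \<comment> \<open>A connection within \<open>R\<close> would be a route from
        \<open>P ! Suc a\<close> to \<open>P ! Suc b\<close> that avoids the detour over
        \<open>y0\<close>.\<close>
      have neq: "component H (f a) \<noteq> component H (f b)" if ab: "a \<in> I1" "b \<in> I1" "a < b" for a b
      proof
        assume eq: "component H (f a) = component H (f b)"
        have "f b \<in> component H (f a)" using eq component_refl by auto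
        then have rab: "reach R (f a) (f b)"
        proof -
          have "component H (f a) \<subseteq> R"
            using fR[OF ab(1)] Rcl by (intro component_subset_closed) auto
          moreover have "reach (component H (f a)) (f a) (f b)"
            using \<open>f b \<in> component H (f a)\<close> fR[OF ab(1)] by (intro reach_in_component) (auto simp: component_def R_def)
          ultimately show ?thesis by (rule reach_mono[rotated])
        qed
        then obtain q where q: "gpath R q" "hd q = f a" "last q = f b"
          using reach_path fR[OF ab(1)] by metis
        have RP: "R \<subseteq> X - set P" using TK PAT by (auto simp: R_def H_def)
        have ab': "a \<in> I'" "b \<in> I'" using ab by (auto simp: I1_def)
        have "\<not> adj (last q) (P ! Suc b)"
        proof (rule swap_no_route[OF ab(3) _ ry0])
          show "set q \<inter> set P = {}" using q(1) RP by (auto simp: gpath_def)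
          show "set [y0] \<inter> set q = {}" using q(1) y0(1) by (auto simp: gpath_def R_def)
          show "gpath X q" using q(1) RP by (auto simp: gpath_def)
          show "adj (P ! Suc a) (hd q)" using f[OF ab(1)] q by (simp add: Off_def)
        qed (use I'D[OF ab'(1)] I'D[OF ab'(2)] adj_sym in auto)
        then show False using f[OF ab(2)] q adj_sym by (auto simp: Off_def)
      qed
      have "inj_on (\<lambda>a. component H (f a)) I1"
        using neq by (metis (no_types, lifting) inj_onI linorder_neqE_nat)
      moreover have "(\<lambda>a. component H (f a)) ` I1 \<subseteq> component H ` R" using fR by auto
      ultimately show ?thesis using finR by (meson card_inj_on_le finite_imageI)
    qed
    consider "card I2 = 0" | "card I2 = 1" | "2 \<le> card I2" by linarith
    then show ?thesis
    proof cases
      case 1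
      then show ?thesis using XU phiA phiK phiY Rc lt c1 cI12 cI' by linarith
    next
      case 2
      then obtain a where a: "a \<in> I2" by (metis card.empty ex_in_conv zero_neq_one)
      then have aI: "a \<in> I'" by (simp add: I2_def)
      obtain z where z: "z \<in> Off a" using Off_ne[OF aI] by auto
      then have zK: "z \<in> K" using a by (auto simp: I2_def)
      have "reach (X - set P) y0 y"
        using y0 by (auto simp: Y_def component_def intro: reach_sym)
      then obtain q where q: "gpath (X - set P) q" "hd q = y0" "last q = y"
        using reach_path y0P by metis
      have qY: "set q \<subseteq> Y"
      proof
        fix x assume "x \<in> set q"
        from path_reach[OF q(1) this] have "x \<in> component (X - set P) y0" using q by (simp add: component_def)
        then show "x \<in> Y" using component_eq y0(1) by (auto simp: Y_def)
      qed
      \<comment> \<open>From \<open>P ! a\<close> through \<open>Y\<close> to \<open>P ! i\<close>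
        and back to \<open>P ! Suc a\<close>: all of \<open>A\<close> and at least one vertex of
        \<open>Y\<close> precede the entry into \<open>K\<close>, while vertices of \<open>K\<close>
        still lose at most \<open>Suc i\<close> neighbours.\<close>
      obtain F where F: "gpath X F" "hd F = u" "last F = P ! Suc a" "length F = Suc i + length q"
        "set F = set (take (Suc i) P) \<union> set q"
      proof (rule swap[of a i q])
        show "a < i" "i < \<mu>" "adj (P ! a) (hd q)" using I'D[OF aI] i2 q adj_sym by auto
        show "gpath X q" "set q \<inter> set P = {}" using q(1) by (auto simp: gpath_def)
        show "adj (last q) (P ! i)" using q y adj_sym by simp
      qed (use that in blast)
      have lq: "1 \<le> length q" using gpath_ne[OF q(1)] by (cases q) auto
      have "int \<kappa> - int (Suc i) - int \<mu> + int (length F) \<le> phi K"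
      proof (rule piece)
        show "adj (last F) z" using F z by (simp add: Off_def)
        show "set F \<inter> K = {}" using F(5) KH KY qY by (auto simp: H_def A_def)
      qed (use KH zK KL F KDeg Kreach in \<open>auto simp: H_def\<close>)
      then have "int \<kappa> - int \<mu> + 1 \<le> phi K" using F lq by linarith
      then show ?thesis using XU phiA phiY Rc lt c1 cI12 cI' 2 by linarith
    next
      case 3
      then obtain a b where ab: "a \<in> I2" "b \<in> I2" "a < b"
        by (metis (no_types, opaque_lifting) card_le_Suc0_iff_eq card.infinite le_zero_eq linorder_neqE_nat
            not_less_eq_eq numeral_2_eq_2 zero_neq_numeral)
      then have ab': "a \<in> I'" "b \<in> I'" by (auto simp: I2_def)
      have 0: "2 * \<kappa> \<le> \<mu> + 1 + card ((nb (P ! Suc a) \<union> nb (P ! Suc b)) \<inter> (X - set P))"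
        by (rule swap_degrees[OF ab(3) _ y0P])
          (use I'D[OF ab'(1)] I'D[OF ab'(2)] adj_sym in auto)
      have "card ((nb (P ! Suc a) \<union> nb (P ! Suc b)) \<inter> (X - set P)) \<le> card (K - T)"
      proof (intro card_mono)
        have "(nb (P ! Suc a) \<union> nb (P ! Suc b)) \<inter> (X - set P) = Off a \<union> Off b"
          by (auto simp: Off_def)
        then show "(nb (P ! Suc a) \<union> nb (P ! Suc b)) \<inter> (X - set P) \<subseteq> K - T"
          using ab PAT by (auto simp: I2_def Off_def)
      qed (use finK in simp)
      then have 1: "2 * \<kappa> \<le> \<mu> + 1 + card (K - T)" using 0 by linarith
      have "T \<union> (K - T) = K" using TK by auto
      then have "phi K = phi T + phi (K - T)"
        using phi_Un[of T "K - T"] fin finK by simp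
      \<comment> \<open>\<open>K - T\<close> consists of vertices of \<open>W\<close>, all outside
        \<open>L\<close>, so the many neighbours in \<open>K\<close> count fully towards the
        excess.\<close>
      moreover have "phi (K - T) = int (card (K - T))"
      proof -
        have "(K - T) \<inter> L = {}" "K - T - L = K - T" using KTW WL by auto
        then show ?thesis using phi_eq[of "K - T"] finK by simp
      qed
      moreover have "2 - int (\<mu> - i) \<le> phi T"
      proof -
        have "P ! \<mu> \<in> T - L" using Tjeq[of \<mu>] i2 P_ends(1) by auto
        then have "1 \<le> card (T - L)" using fin by (metis Suc_leI One_nat_def card_gt_0_iff empty_iff finite_Diff)
        then show ?thesis using phi_eq2[OF fin(2)] cT by linarith
      qed
      ultimately have "2 * int \<kappa> - int \<mu> - 1 + 2 - int (\<mu> - i) \<le> phi K" using 1 by linarith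
      then show ?thesis using XU phiA phiY Rc lt rle i2 by linarith
    qed
  qed
qed

end

end

context lgraph
begin

theorem surplus:
  assumes "finite X" "u \<in> X" "\<And>x. x \<in> X \<Longrightarrow> reach X u x" "X \<inter> L \<noteq> {}"
    "\<And>x. x \<in> X \<Longrightarrow> x \<in> L \<Longrightarrow> k \<le> card (nb x \<inter> X)"
    "\<And>q. gpath X q \<Longrightarrow> hd q = u \<Longrightarrow> length q \<le> Suc l" "l < k"
  shows "int k - int l \<le> phi X"
  using assms
proof (induction "card X" arbitrary: X u k l rule: less_induct)
  case less
  obtain P where P: "gpath X P" "hd P = u" and max: "\<And>q. gpath X q \<Longrightarrow> hd q = u \<Longrightarrow> length q \<le> length P"
    using longest_path less.prems(1,2) by metis
  define m where "m = length P - 1"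
  have m: "length P = Suc m" using gpath_ne[OF P(1)] by (simp add: m_def)
  have ml: "m \<le> l" using less.prems(6)[OF P] m by simp
  have max': "\<And>q. gpath X q \<Longrightarrow> hd q = u \<Longrightarrow> length q \<le> Suc m" using max m by simp
  \<comment> \<open>The argument runs with the exact length \<open>m \<le> l\<close> of a longest
    path, which only improves the bound.\<close>
  interpret rooted_path adj L X u k m P
    using less.prems P m max' ml by unfold_locales auto
  have IH: "int k' - int l' \<le> phi Z"
    if "Z \<subset> X" "z \<in> Z" "\<And>x. x \<in> Z \<Longrightarrow> reach Z z x" "Z \<inter> L \<noteq> {}"
      "\<And>x. x \<in> Z \<Longrightarrow> x \<in> L \<Longrightarrow> k' \<le> card (nb x \<inter> Z)"
      "\<And>q. gpath Z q \<Longrightarrow> hd q = z \<Longrightarrow> length q \<le> Suc l'" "l' < k'" for Z z k' l'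
    using that less.prems(1) by (intro less.hyps[of Z z]) (auto intro: psubset_card_mono finite_subset)
  have "int k - int m \<le> phi X"
  proof (cases "\<exists>x y y'. x \<in> set P \<and> y \<in> X - set P \<and> adj x y \<and> y' \<in> X - set P \<and> adj y y'")
    case True
    show ?thesis by (rule surplus_nontrivial[OF IH True])
  next
    case False
    show ?thesis by (rule surplus_trivial) (use False in blast)
  qed
  then show ?case using ml by linarith
qed

end

section \<open>Long paths and caterpillars\<close>

text \<open>Each \<open>A x\<close> keeps \<open>card M\<close> admissible elements, so the choices
  made for the other indices never exhaust it. The embeddings below place their vertices in this
  way.\<close>

lemma greedy_choice:
  assumes "finite M" "\<And>x. x \<in> M \<Longrightarrow> card M \<le> card (A x - F)"
  shows "\<exists>g. inj_on g M \<and> (\<forall>x\<in>M. g x \<in> A x - F)"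
  using assms
proof (induction M rule: finite_induct)
  case empty
  then show ?case by simp
next
  case (insert x M)
  have "card M \<le> card (A y - F)" if "y \<in> M" for y
    using insert.prems[of y] insert.hyps that by simp
  then obtain g where g: "inj_on g M" "\<forall>y\<in>M. g y \<in> A y - F"
    using insert.IH by blast
  have "card (g ` M) < card (A x - F)"
    using insert.prems[of x] insert.hyps card_image_le[of M g] by simp
  then have "\<not> A x - F \<subseteq> g ` M"
    using insert.hyps card_mono[of "g ` M" "A x - F"] by auto
  then obtain z where z: "z \<in> A x - F" "z \<notin> g ` M" by blast
  have "inj_on (g(x := z)) (insert x M)"
    using g z insert.hyps by (auto simp: inj_on_def)
  moreover have "\<forall>y\<in>insert x M. (g(x := z)) y \<in> A y - F"
    using g z insert.hyps by auto
  ultimately show ?case by blast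
qed

context sym_graph
begin

definition hosts :: "'v set \<Rightarrow> 'a sgraph \<Rightarrow> bool" where
  "hosts V T \<longleftrightarrow> (\<exists>f. inj_on f (vertices T) \<and> f ` vertices T \<subseteq> V \<and>
    (\<forall>u v. {u, v} \<in> edges T \<longrightarrow> u \<noteq> v \<longrightarrow> adj (f u) (f v)))"

lemma hosts_iso:
  assumes T: "simple_graph T" and iso: "graph_iso T H" and H: "hosts V H"
  shows "hosts V T"
proof -
  obtain h where h: "bij_betw h (vertices T) (vertices H)" "edges H = (\<lambda>e. h ` e) ` edges T"
    using iso by (auto simp: graph_iso_def)
  obtain f where f: "inj_on f (vertices H)" "f ` vertices H \<subseteq> V"
    "\<And>u v. {u, v} \<in> edges H \<Longrightarrow> u \<noteq> v \<Longrightarrow> adj (f u) (f v)"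
    using H by (auto simp: hosts_def)
  have im: "h ` vertices T = vertices H" and inj: "inj_on h (vertices T)"
    using h(1) by (auto simp: bij_betw_def)
  have "inj_on (f \<circ> h) (vertices T)" using inj f(1) im by (auto intro: comp_inj_on)
  moreover have "(f \<circ> h) ` vertices T \<subseteq> V" using f(2) im by auto
  moreover have "adj ((f \<circ> h) u) ((f \<circ> h) v)" if uv: "{u, v} \<in> edges T" "u \<noteq> v" for u v
  proof -
    have "h ` {u, v} \<in> edges H" using uv(1) unfolding h(2) by (rule imageI)
    then have "{h u, h v} \<in> edges H" by simp
    moreover have "u \<in> vertices T" "v \<in> vertices T"
      using uv T by (auto simp: simple_graph_def nsets_def)
    then have "h u \<noteq> h v" using inj uv(2) by (auto dest: inj_onD)
    ultimately show ?thesis using f(3) by simp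
  qed
  ultimately show ?thesis unfolding hosts_def by blast
qed

end

section \<open>Host graphs with at least half of the vertices in \<open>L\<close>\<close>

locale lks = lgraph adj L for adj :: "'v \<Rightarrow> 'v \<Rightarrow> bool" and L +
  fixes V :: "'v set" and k :: nat
  assumes finV: "finite V" and LV: "L \<subseteq> V" and adjV: "adj u v \<Longrightarrow> u \<in> V"
    and Ldeg: "u \<in> L \<Longrightarrow> k \<le> card (nb u)"
    and Sdeg: "u \<in> V - L \<Longrightarrow> card (nb u) < k"
    and half: "card (V - L) \<le> card L" and Lne: "L \<noteq> {}" and k_pos: "1 \<le> k"
begin

lemma adjV2: "adj u v \<Longrightarrow> v \<in> V"
  using adjV adj_sym by blast

lemma nbV: "nb u \<subseteq> V"
  by (auto intro: adjV2)

lemma finN [simp]: "finite (nb u)"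
  using finV nbV finite_subset by blast

lemma finL [simp]: "finite L"
  using finV LV finite_subset by blast

text \<open>Otherwise every component has positive excess: those that meet \<open>L\<close> by
  \<open>surplus\<close> with bounds \<open>k\<close> and \<open>k - 1\<close>, the others because
  they are nonempty. Added up, this contradicts \<open>half\<close>.\<close>

lemma long_path: "\<exists>xs. gpath V xs \<and> length xs = Suc k"
proof (rule ccontr)
  assume no: "\<nexists>xs. gpath V xs \<and> length xs = Suc k"
  have len: "length q \<le> k" if "gpath V q" for q
  proof (rule ccontr)
    assume "\<not> length q \<le> k"
    then have "gpath V (take (Suc k) q) \<and> length (take (Suc k) q) = Suc k"
      using gpath_takeI[OF that] by simp
    then show False using no by blast
  qed
  have pos: "1 \<le> phi (component V z)" if z: "z \<in> V" for z
  proof -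
    let ?C = "component V z"
    have sub: "?C \<subseteq> V" using z by (rule component_subset)
    have finC: "finite ?C" using sub finV finite_subset by blast
    have zC: "z \<in> ?C" by simp
    show ?thesis
    proof (cases "?C \<inter> L = {}")
      case True
      then have "phi ?C = int (card ?C)" using phi_eq[OF finC] by (simp add: Diff_triv)
      moreover have "card ?C > 0" using finC zC card_gt_0_iff by blast
      ultimately show ?thesis by simp
    next
      case False
      have "int k - int (k - 1) \<le> phi ?C"
      proof (rule surplus[OF finC zC _ False])
        show "reach ?C z x" if "x \<in> ?C" for x
          using that z reach_in_component by (simp add: component_def)
        show "k \<le> card (nb x \<inter> ?C)" if x: "x \<in> ?C" "x \<in> L" for x
        proof -
          have "nb x \<inter> ?C = nb x"
            using component_closed[OF x(1) z] nbV[of x] by auto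
          then show ?thesis using Ldeg x by simp
        qed
        show "length q \<le> Suc (k - 1)" if "gpath ?C q" for q
          using len[OF gpath_mono[OF that sub]] by simp
      qed (use k_pos in simp)
      then show ?thesis using k_pos by linarith
    qed
  qed
  have "int (card (component V ` V)) \<le> phi V"
    by (rule card_components_le_phi) (use finV pos in auto)
  moreover have "phi V \<le> 0"
  proof -
    have "V \<inter> L = L" using LV by auto
    then show ?thesis using phi_eq[OF finV] half by simp
  qed
  moreover have "card (component V ` V) > 0"
    using finV LV Lne by (auto simp: card_gt_0_iff)
  ultimately show False by linarith
qed

text \<open>The caterpillar without its attached leaves. Their division into \<open>b\<close> and
  \<open>d\<close> does not enter: a vertex of \<open>L\<close> on such a path has
  \<open>b + d\<close> neighbours off it.\<close>

definition spine :: "nat \<Rightarrow> nat \<Rightarrow> nat \<Rightarrow> bool" where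
  "spine a c e \<longleftrightarrow> (\<exists>ys. gpath V ys \<and> length ys = Suc (a + c + e) \<and> ys ! a \<in> L \<and> ys ! (a + c) \<in> L)"

lemma spineI:
  assumes "gpath V xs" "a \<le> i" "i + c + e < length xs" "xs ! i \<in> L" "xs ! (i + c) \<in> L"
  shows "spine a c e"
proof -
  let ?ys = "take (Suc (a + c + e)) (drop (i - a) xs)"
  have "gpath V (drop (i - a) xs)" using assms by (intro gpath_dropI) auto
  then have "gpath V ?ys" by (rule gpath_takeI) simp
  moreover have "length ?ys = Suc (a + c + e)" using assms by simp
  moreover have "?ys ! a = xs ! i" "?ys ! (a + c) = xs ! (i + c)"
    using assms by (auto simp: algebra_simps)
  ultimately show ?thesis using assms unfolding spine_def by metis
qed

lemma spine_rev: "spine e c a \<Longrightarrow> spine a c e"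
proof -
  assume "spine e c a"
  then obtain ys where ys: "gpath V ys" "length ys = Suc (e + c + a)" "ys ! e \<in> L" "ys ! (e + c) \<in> L"
    by (auto simp: spine_def)
  have "gpath V (rev ys)" using ys by simp
  moreover have "length (rev ys) = Suc (a + c + e)" using ys by simp
  moreover have "rev ys ! a = ys ! (e + c)" "rev ys ! (a + c) = ys ! e"
    using ys by (auto simp: rev_nth)
  ultimately show ?thesis using ys unfolding spine_def by metis
qed

lemma path_indep: "gpath V xs \<Longrightarrow> Suc i < length xs \<Longrightarrow> xs ! i \<in> L \<or> xs ! Suc i \<in> L"
  using indep successively_nth[of adj xs i] by (auto simp: gpath_def)

lemma spine_even:
  assumes "even c" "1 \<le> c" "c \<le> l" "a + c + e + l = k"
  shows "spine a c e"
proof (rule ccontr)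
  assume no: "\<not> spine a c e"
  obtain xs where xs: "gpath V xs" "length xs = Suc k" using long_path by blast
  define \<sigma> where "\<sigma> i \<longleftrightarrow> xs ! i \<in> L" for i
  \<comment> \<open>Here \<open>i\<close> is the position of the first branching vertex; the range
    is the set of positions for which the spine fits into a path with
    \<open>k = a + c + e + l\<close> edges.\<close>
  have nb2: "\<not> (\<sigma> i \<and> \<sigma> (i + c))" if "a \<le> i" "i \<le> a + l" for i
    using spineI[OF xs(1) that(1), of c e] that assms xs no by (auto simp: \<sigma>_def)
  have one: "\<sigma> i \<or> \<sigma> (Suc i)" if "i < k" for i
    using path_indep[OF xs(1), of i] that xs by (simp add: \<sigma>_def)
  \<comment> \<open>Two consecutive vertices of \<open>L\<close> would succeed: one of the two
    vertices \<open>c\<close> places further on is in \<open>L\<close> as well.\<close>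
  have step: "\<sigma> (Suc i) \<longleftrightarrow> \<not> \<sigma> i" if "a \<le> i" "i < a + l" for i
  proof
    assume "\<not> \<sigma> i"
    then show "\<sigma> (Suc i)" using one[of i] that assms by auto
  next
    assume s: "\<sigma> (Suc i)"
    show "\<not> \<sigma> i"
    proof
      assume "\<sigma> i"
      then have "\<not> \<sigma> (i + c)" using nb2[of i] that by auto
      then have "\<sigma> (Suc i + c)" using one[of "i + c"] that assms by auto
      then show False using nb2[of "Suc i"] s that by auto
    qed
  qed
  have alt: "j \<le> l \<Longrightarrow> \<sigma> (a + j) \<longleftrightarrow> (\<sigma> a \<longleftrightarrow> even j)" for j
  proof (induction j)
    case 0
    then show ?case by simp
  next
    case (Suc j)
    then show ?case using step[of "a + j"] by auto
  qed
  \<comment> \<open>For even \<open>c\<close> both ends of the first window have the same type, so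
    both lie outside \<open>L\<close>; then the window one step further has both ends in
    \<open>L\<close>.\<close>
  have ac: "\<sigma> (a + c) \<longleftrightarrow> \<sigma> a" using alt[of c] assms by simp
  then have na: "\<not> \<sigma> a" using nb2[of a] by auto
  have "2 \<le> c" using assms by (cases "c = 1") auto
  then have "\<sigma> (Suc a)" using na step[of a] assms by auto
  moreover have "\<sigma> (Suc a + c)" using one[of "a + c"] na ac assms \<open>2 \<le> c\<close> by auto
  ultimately show False using nb2[of "Suc a"] assms \<open>2 \<le> c\<close> by auto
qed

lemma caterpillar_hosts:
  assumes sp: "spine a c e" and c: "1 \<le> c" and k: "a + b + c + d + e = k"
  shows "hosts V (caterpillar a b c d e)"
proof -
  obtain ys where ys: "gpath V ys" "length ys = Suc (a + c + e)" "ys ! a \<in> L" "ys ! (a + c) \<in> L"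
    using sp by (auto simp: spine_def)
  have dy: "distinct ys" "set ys \<subseteq> V" using ys by (auto simp: gpath_def)
  let ?p = "a + c + e"
  define M where "M = {?p<..?p + b + d}"
  define A where "A x = (if x \<le> ?p + b then nb (ys ! a) else nb (ys ! (a + c)))" for x
  have av: "b + d \<le> card (nb z - set ys)" if z: "z \<in> set ys" "z \<in> L" for z
  proof -
    have "card (nb z \<inter> set ys) \<le> card (set ys - {z})"
      using adj_irrefl by (intro card_mono) auto
    also have "\<dots> = ?p" using z ys dy by (simp add: distinct_card)
    finally have "card (nb z \<inter> set ys) \<le> ?p" .
    moreover have "card (nb z - set ys) = card (nb z) - card (nb z \<inter> set ys)"
      by (simp add: card_Diff_subset_Int)
    ultimately show ?thesis using Ldeg[OF z(2)] k by linarith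
  qed
  have "\<exists>g. inj_on g M \<and> (\<forall>x\<in>M. g x \<in> A x - set ys)"
  proof (rule greedy_choice)
    show "card M \<le> card (A x - set ys)" if "x \<in> M" for x
      using av[of "ys ! a"] av[of "ys ! (a + c)"] ys by (auto simp: M_def A_def)
  qed (simp add: M_def)
  then obtain g where g: "inj_on g M" "\<And>x. x \<in> M \<Longrightarrow> g x \<in> A x" "\<And>x. x \<in> M \<Longrightarrow> g x \<notin> set ys"
    by blast
  define f where "f i = (if i \<le> ?p then ys ! i else g i)" for i
  have verts: "vertices (caterpillar a b c d e) = {..?p} \<union> M"
    by (auto simp: caterpillar_def M_def)
  have fM: "f x = g x" if "x \<in> M" for x using that by (simp add: f_def M_def)
  have inj: "inj_on f ({..?p} \<union> M)"
  proof -
    have "inj_on f {..?p}"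
      using ys dy by (auto simp: inj_on_def f_def nth_eq_iff_index_eq)
    moreover have "inj_on f M" using g(1) fM by (simp cong: inj_on_cong)
    moreover have "f ` ({..?p} - M) \<inter> f ` (M - {..?p}) = {}"
    proof -
      have "f ` {..?p} \<subseteq> set ys" using ys by (auto simp: f_def)
      moreover have "f ` M \<inter> set ys = {}" using g(3) fM by auto
      ultimately show ?thesis by blast
    qed
    ultimately show ?thesis by (simp add: inj_on_Un)
  qed
  have im: "f ` ({..?p} \<union> M) \<subseteq> V"
  proof
    fix z assume "z \<in> f ` ({..?p} \<union> M)"
    then consider x where "x \<le> ?p" "z = f x" | x where "x \<in> M" "z = f x" by auto
    then show "z \<in> V"
    proof cases
      case 1
      then show ?thesis using ys dy by (auto simp: f_def)
    next
      case 2
      then have "z \<in> A x" using g(2) fM by simp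
      then show ?thesis by (auto simp: A_def split: if_splits intro: adjV2)
    qed
  qed
  have e1: "adj (f i) (f (Suc i))" if "i < ?p" for i
    using that ys successively_nth[of adj ys i] by (auto simp: f_def gpath_def)
  have e2: "adj (f a) (f j)" if "?p < j" "j \<le> ?p + b" for j
    using g(2)[of j] that fM[of j] by (auto simp: M_def A_def f_def)
  have e3: "adj (f (a + c)) (f j)" if "?p + b < j" "j \<le> ?p + b + d" for j
    using g(2)[of j] that fM[of j] by (auto simp: M_def A_def f_def)
  have "adj (f u) (f v)" if "{u, v} \<in> edges (caterpillar a b c d e)" for u v
    using that e1 e2 e3 adj_sym by (auto simp: caterpillar_def doubleton_eq_iff)
  then show ?thesis
    unfolding hosts_def verts using inj im by blast
qed

end

section \<open>Trees with two adjacent centres\<close>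

text \<open>The form in which a tree is embedded: a central edge and a parent map that reaches it in
  at most two steps. An inclusion for the edges is enough, since an embedding only has to respect
  the edges present.\<close>

locale lks_tree = lks adj L V k for adj :: "'v \<Rightarrow> 'v \<Rightarrow> bool" and L V k +
  fixes T :: "'a sgraph" and r1 r2 :: 'a and \<pi> :: "'a \<Rightarrow> 'a"
  assumes cardT: "card (vertices T) = Suc k"
    and r: "r1 \<in> vertices T" "r2 \<in> vertices T" "r1 \<noteq> r2"
    and edgesT: "edges T \<subseteq> insert {r1, r2} {{x, \<pi> x} | x. x \<in> vertices T - {r1, r2}}"
    and levels: "x \<in> vertices T - {r1, r2} \<Longrightarrow>
      \<pi> x \<in> {r1, r2} \<or> \<pi> x \<in> vertices T - {r1, r2} \<and> \<pi> (\<pi> x) \<in> {r1, r2}"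
begin

definition "Q = vertices T - {r1, r2}"
definition "V1 = {x \<in> Q. \<pi> x = r1}"
definition "V2 = {x \<in> Q. \<pi> x = r2}"
definition "W1 = {x \<in> Q. \<pi> x \<in> V1}"
definition "W2 = {x \<in> Q. \<pi> x \<in> V2}"
text \<open>\<open>C\<close> and \<open>B\<close> collect the vertices with at least
  \<open>k / 2\<close> neighbours in \<open>L\<close>, outside and inside \<open>L\<close>; for
  \<open>C\<close> all neighbours lie in \<open>L\<close>. Such a vertex can take fewer than
  \<open>k / 2\<close> tree vertices into \<open>L\<close>.\<close>

definition "C = {c \<in> V - L. k \<le> 2 * card (nb c)}"
definition "B = {b \<in> L. k \<le> 2 * card (nb b \<inter> L)}"

lemma finT: "finite (vertices T)"
  using cardT by (intro card_ge_0_finite) simp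

lemma fin [simp]: "finite Q" "finite V1" "finite V2" "finite W1" "finite W2"
  using finT by (auto simp: Q_def V1_def V2_def W1_def W2_def)

lemma O_eq: "Q = V1 \<union> V2 \<union> W1 \<union> W2"
  using levels by (auto simp: Q_def V1_def V2_def W1_def W2_def)

lemma O_disj: "V1 \<inter> V2 = {}" "V1 \<inter> W1 = {}" "V1 \<inter> W2 = {}" "V2 \<inter> W1 = {}" "V2 \<inter> W2 = {}" "W1 \<inter> W2 = {}"
  using r by (auto simp: V1_def V2_def W1_def W2_def Q_def)

lemma card_O: "card V1 + card V2 + card W1 + card W2 + 1 = k"
proof -
  have "card Q = card V1 + card V2 + card W1 + card W2"
    unfolding O_eq using O_disj by (simp add: card_Un_disjoint Int_Un_distrib2)
  moreover have "card Q = Suc k - 2"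
    unfolding Q_def using r finT cardT by (subst card_Diff_subset) auto
  ultimately show ?thesis using k_pos by linarith
qed

lemma inner: "\<pi> ` W1 \<subseteq> V1" "\<pi> ` W2 \<subseteq> V2" "card (\<pi> ` W1) \<le> card W1" "card (\<pi> ` W2) \<le> card W2"
  by (auto simp: W1_def W2_def V1_def V2_def intro: card_image_le)

lemma inner_le: "card (\<pi> ` W2) \<le> card V2" "card (\<pi> ` W1) \<le> card V1"
  using inner by (auto intro: card_mono)

text \<open>A vertex of \<open>L\<close> has at least \<open>k\<close> neighbours, of which at most
  \<open>card D - 1\<close> are images already. This leaves room for all
  \<open>Suc k - card D\<close> remaining vertices of the tree.\<close>

lemma complete:
  assumes D: "D \<subseteq> vertices T" "r1 \<in> D" "r2 \<in> D" and f: "inj_on f D" "f ` D \<subseteq> V"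
    and e: "adj (f r1) (f r2)" "\<And>x. x \<in> D \<inter> Q \<Longrightarrow> \<pi> x \<in> D \<and> adj (f (\<pi> x)) (f x)"
    and rest: "\<And>x. x \<in> vertices T - D \<Longrightarrow> \<pi> x \<in> D \<and> f (\<pi> x) \<in> L"
  shows "hosts V T"
proof -
  have finD: "finite D" using D finT finite_subset by blast
  define M where "M = vertices T - D"
  have cM: "card M + card D = Suc k"
    using card_Diff_subset[OF finD D(1)] card_mono[OF finT D(1)] cardT by (simp add: M_def)
  have "\<exists>g. inj_on g M \<and> (\<forall>x\<in>M. g x \<in> nb (f (\<pi> x)) - f ` D)"
  proof (rule greedy_choice)
    show "card M \<le> card (nb (f (\<pi> x)) - f ` D)" if x: "x \<in> M" for x
    proof -
      let ?z = "f (\<pi> x)"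
      have z: "?z \<in> f ` D" "?z \<in> L" using rest x by (auto simp: M_def)
      have "card (nb ?z \<inter> f ` D) \<le> card (f ` D - {?z})"
        using adj_irrefl finD by (intro card_mono) auto
      also have "\<dots> = card D - 1" using z finD f(1) by (simp add: card_image)
      finally have "card (nb ?z \<inter> f ` D) \<le> card D - 1" .
      moreover have "card (nb ?z - f ` D) = card (nb ?z) - card (nb ?z \<inter> f ` D)"
        by (simp add: card_Diff_subset_Int)
      moreover have "card D \<noteq> 0" using D finD by auto
      ultimately show ?thesis using Ldeg[OF z(2)] cM by linarith
    qed
  qed (use finT in \<open>simp add: M_def\<close>)
  then obtain g where g: "inj_on g M" "\<And>x. x \<in> M \<Longrightarrow> adj (f (\<pi> x)) (g x)"
    "\<And>x. x \<in> M \<Longrightarrow> g x \<notin> f ` D" by auto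
  define h where "h x = (if x \<in> D then f x else g x)" for x
  have hM: "x \<in> M \<Longrightarrow> h x = g x" for x by (simp add: h_def M_def)
  have hD: "x \<in> D \<Longrightarrow> h x = f x" for x by (simp add: h_def)
  have VT: "vertices T = D \<union> M" using D by (auto simp: M_def)
  have "inj_on h (D \<union> M)"
  proof -
    have "inj_on h D" using f(1) hD by (simp cong: inj_on_cong)
    moreover have "inj_on h M" using g(1) hM by (simp cong: inj_on_cong)
    moreover have "h ` D \<inter> h ` M = {}"
    proof -
      have "h x \<noteq> h y" if "x \<in> D" "y \<in> M" for x y
        using g(3)[OF that(2)] that(1) hD[OF that(1)] hM[OF that(2)] by (metis imageI)
      then show ?thesis by blast
    qed
    ultimately show ?thesis by (auto simp: inj_on_Un)
  qed
  moreover have "h ` (D \<union> M) \<subseteq> V"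
    using f(2) hD hM adjV2[OF g(2)] by auto
  moreover have par: "adj (h (\<pi> x)) (h x)" if x: "x \<in> Q" for x
  proof (cases "x \<in> D")
    case True
    then show ?thesis using e(2)[of x] x hD by simp
  next
    case False
    then have "x \<in> M" using x by (simp add: M_def Q_def)
    then show ?thesis using g(2)[of x] rest[of x] hM hD by (simp add: M_def)
  qed
  moreover have "adj (h u) (h v)" if uv: "{u, v} \<in> edges T" for u v
  proof -
    consider "{u, v} = {r1, r2}" | x where "x \<in> Q" "{u, v} = {x, \<pi> x}"
      using edgesT uv by (auto simp: Q_def)
    then show ?thesis
    proof cases
      case 1
      then show ?thesis using e(1) hD D adj_sym by (auto simp: doubleton_eq_iff)
    next
      case 2
      then show ?thesis using par[of x] adj_sym by (auto simp: doubleton_eq_iff)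
    qed
  qed
  ultimately show ?thesis unfolding hosts_def VT by blast
qed

text \<open>\<open>V2\<close> and the children of vertices placed in \<open>C\<close> go to \<open>L\<close>; all remaining vertices are leaves at
  vertices placed in \<open>L\<close>.\<close>

lemma embed_via_C:
  assumes xy: "adj x y" "x \<in> L" and y: "k \<le> 2 * card (nb y \<inter> L)" "\<And>c. c \<in> C \<Longrightarrow> y \<in> L \<Longrightarrow> \<not> adj y c"
    and x: "card (\<pi> ` W1) < card (nb x \<inter> (L \<union> C))"
    and small: "2 * (card V2 + card W1) < k"
  shows "hosts V T"
proof -
  let ?V' = "\<pi> ` W1"
  have "\<exists>g. inj_on g ?V' \<and> (\<forall>z\<in>?V'. g z \<in> nb x \<inter> (L \<union> C) - {y})"
  proof (rule greedy_choice)
    have "card (nb x \<inter> (L \<union> C)) - card {y} \<le> card (nb x \<inter> (L \<union> C) - {y})"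
      by (rule diff_card_le_card_Diff) simp
    then show "card ?V' \<le> card (nb x \<inter> (L \<union> C) - {y})" using x by simp
  qed simp
  then obtain g where g: "inj_on g ?V'" "\<And>z. z \<in> ?V' \<Longrightarrow> adj x (g z)" "\<And>z. z \<in> ?V' \<Longrightarrow> g z \<in> L \<union> C"
    "\<And>z. z \<in> ?V' \<Longrightarrow> g z \<noteq> y" by auto
  define WC where "WC = {w \<in> W1. g (\<pi> w) \<in> C}"
  define A where "A z = (if z \<in> V2 then nb y \<inter> L else nb (g (\<pi> z)))" for z
  define F where "F = insert x (g ` ?V')"
  have CL: "C \<inter> L = {}" "c \<in> C \<Longrightarrow> nb c \<subseteq> L" for c
    by (auto simp: C_def dest: indep)
  have finWC: "finite WC" by (simp add: WC_def)
  \<comment> \<open>Besides \<open>x\<close>, the set \<open>F\<close> meets \<open>L\<close> only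
    in parents of vertices of \<open>W1\<close> outside \<open>WC\<close>. Hence parents in
    \<open>L\<close> and the new vertices for \<open>WC\<close> together use at most
    \<open>card W1\<close> places, however the parents are spread over \<open>L\<close> and
    \<open>C\<close>.\<close>
  have FL: "card (F \<inter> L) \<le> Suc (card W1 - card WC)"
  proof -
    have "F \<inter> L \<subseteq> insert x (g ` \<pi> ` (W1 - WC))"
    proof
      fix v assume v: "v \<in> F \<inter> L"
      show "v \<in> insert x (g ` \<pi> ` (W1 - WC))"
      proof (cases "v = x")
        case False
        then obtain w where w: "w \<in> W1" "v = g (\<pi> w)" using v by (auto simp: F_def)
        then have "w \<notin> WC" using v CL(1) by (auto simp: WC_def)
        then show ?thesis using w by blast
      qed simp
    qed
    then have "card (F \<inter> L) \<le> card (insert x (g ` \<pi> ` (W1 - WC)))"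
      by (intro card_mono) auto
    also have "\<dots> \<le> Suc (card (g ` \<pi> ` (W1 - WC)))" by (simp add: card_insert_if)
    also have "card (g ` \<pi> ` (W1 - WC)) \<le> card (W1 - WC)"
      unfolding image_image by (rule card_image_le) simp
    also have "card (W1 - WC) = card W1 - card WC"
      using finWC by (intro card_Diff_subset) (auto simp: WC_def)
    finally show ?thesis by simp
  qed
  have WCle: "card WC \<le> card W1" by (intro card_mono) (auto simp: WC_def)
  have "\<exists>h. inj_on h (V2 \<union> WC) \<and> (\<forall>z\<in>V2 \<union> WC. h z \<in> A z - F)"
  proof (rule greedy_choice)
    fix z assume z: "z \<in> V2 \<union> WC"
    have A: "A z \<subseteq> L" "k \<le> 2 * card (A z)"
    proof -
      have "A z \<subseteq> L \<and> k \<le> 2 * card (A z)"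
      proof (cases "z \<in> V2")
        case False
        then have "g (\<pi> z) \<in> C" using z by (simp add: WC_def)
        then show ?thesis using False CL(2) by (simp add: A_def C_def)
      qed (use y in \<open>simp add: A_def\<close>)
      then show "A z \<subseteq> L" "k \<le> 2 * card (A z)" by auto
    qed
    have "card (V2 \<union> WC) \<le> card V2 + card WC" by (rule card_Un_le)
    also have "\<dots> \<le> card (A z) - card (F \<inter> L)"
    proof -
      have "card V2 + card W1 < card (A z)" using A(2) small by presburger
      then show ?thesis using FL WCle by linarith
    qed
    also have "\<dots> \<le> card (A z - F \<inter> L)"
      by (rule diff_card_le_card_Diff) (simp add: F_def)
    also have "A z - F \<inter> L = A z - F" using A(1) by auto
    finally show "card (V2 \<union> WC) \<le> card (A z - F)" .
  qed (use finWC in simp)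
  then obtain h where h: "inj_on h (V2 \<union> WC)" "\<And>z. z \<in> V2 \<union> WC \<Longrightarrow> h z \<in> A z"
    "\<And>z. z \<in> V2 \<union> WC \<Longrightarrow> h z \<notin> F" by auto
  \<comment> \<open>Images of \<open>WC\<close> lie in \<open>L\<close> and have a neighbour in
    \<open>C\<close>, whereas \<open>y\<close>, if it is in \<open>L\<close>, has none.\<close>
  have hy: "h z \<noteq> y" if z: "z \<in> V2 \<union> WC" for z
  proof (cases "z \<in> V2")
    case True
    then show ?thesis using h(2)[OF z] adj_irrefl by (auto simp: A_def)
  next
    case False
    then have c: "g (\<pi> z) \<in> C" using z by (simp add: WC_def)
    then have "h z \<in> L" "adj (g (\<pi> z)) (h z)"
      using h(2)[OF z] False subsetD[OF CL(2)[OF c], of "h z"] by (auto simp: A_def)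
    then show ?thesis using y(2)[OF c] adj_sym by blast
  qed
  have V'V: "?V' \<subseteq> V1" by (rule inner)
  define f where "f z = (if z = r1 then x else if z = r2 then y else if z \<in> ?V' then g z else h z)" for z
  let ?D = "insert r1 (insert r2 (?V' \<union> (V2 \<union> WC)))"
  have OD: "V1 \<subseteq> Q" "V2 \<subseteq> Q" "W1 \<subseteq> Q" "WC \<subseteq> W1" "r1 \<notin> Q" "r2 \<notin> Q"
    by (auto simp: V1_def V2_def W1_def Q_def WC_def)
  have f1: "f r1 = x" "f r2 = y" using r by (auto simp: f_def)
  have f2: "f z = g z" if "z \<in> ?V'" for z using that V'V OD by (auto simp: f_def)
  have f3: "f z = h z" if "z \<in> V2 \<union> WC" for z
  proof -
    have "z \<notin> ?V'" using that V'V OD(4) O_disj by blast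
    moreover have "z \<in> Q" using that OD by blast
    ultimately show ?thesis using OD by (auto simp: f_def)
  qed
  have gx: "g z \<noteq> x" if "z \<in> ?V'" for z using g(2)[OF that] adj_irrefl by auto
  have hx: "h z \<noteq> x" if "z \<in> V2 \<union> WC" for z using h(3)[OF that] by (auto simp: F_def)
  have gh: "g u \<noteq> h v" if "u \<in> ?V'" "v \<in> V2 \<union> WC" for u v
    using h(3)[OF that(2)] imageI[OF that(1), of g] by (auto simp: F_def)
  show ?thesis
  proof (rule complete)
    show "?D \<subseteq> vertices T" using r OD V'V by (auto simp: Q_def)
    show "inj_on f ?D"
    proof -
      have "inj_on f ?V'" using g(1) f2 by (simp cong: inj_on_cong)
      moreover have "inj_on f (V2 \<union> WC)" using h(1) inj_on_cong[of "V2 \<union> WC" f h, OF f3] by blast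
      moreover have "f ` ?V' \<inter> f ` (V2 \<union> WC) = {}"
      proof -
        have "f u \<noteq> f v" if "u \<in> ?V'" "v \<in> V2 \<union> WC" for u v
          using gh[OF that] f2[OF that(1)] f3[OF that(2)] by simp
        then show ?thesis by blast
      qed
      ultimately have "inj_on f (?V' \<union> (V2 \<union> WC))" by (auto simp: inj_on_Un)
      moreover have "f r2 \<notin> f ` (?V' \<union> (V2 \<union> WC))"
      proof
        assume "f r2 \<in> f ` (?V' \<union> (V2 \<union> WC))"
        then obtain z where "z \<in> ?V' \<union> (V2 \<union> WC)" "f z = y" using f1 by (metis imageE)
        then show False using f2[of z] f3[of z] g(4)[of z] hy[of z] by (metis Un_iff)
      qed
      moreover have "f r1 \<notin> f ` insert r2 (?V' \<union> (V2 \<union> WC))"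
      proof
        assume "f r1 \<in> f ` insert r2 (?V' \<union> (V2 \<union> WC))"
        then obtain z where z: "z \<in> insert r2 (?V' \<union> (V2 \<union> WC))" "f z = x" using f1 by (metis imageE)
        then have "z \<noteq> r2" using xy adj_irrefl f1 by auto
        then show False using z f2[of z] f3[of z] gx[of z] hx[of z] by (metis Un_iff insertE)
      qed
      ultimately show ?thesis by (simp only: inj_on_insert) blast
    qed
    show "f ` ?D \<subseteq> V"
    proof -
      have "g z \<in> V" if "z \<in> ?V'" for z using g(2)[OF that] adjV2 by blast
      moreover have "h z \<in> V" if "z \<in> V2 \<union> WC" for z
        using h(2)[OF that] nbV by (auto simp: A_def intro: adjV2 split: if_splits)
      ultimately show ?thesis using f1 f2 f3 xy adjV adjV2 by auto
    qed
    show "adj (f r1) (f r2)" using f1 xy by simp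
    show "\<pi> z \<in> ?D \<and> adj (f (\<pi> z)) (f z)" if z: "z \<in> ?D \<inter> Q" for z
    proof -
      consider "z \<in> ?V'" | "z \<in> V2" | "z \<in> WC" "z \<notin> V2" using z OD by auto
      then show ?thesis
      proof cases
        case 1
        then have "\<pi> z = r1" using V'V by (auto simp: V1_def)
        then show ?thesis using f1 f2[OF 1] g(2)[OF 1] by simp
      next
        case 2
        then have "\<pi> z = r2" by (auto simp: V2_def)
        then show ?thesis using f1 f3[of z] h(2)[of z] 2 by (simp add: A_def)
      next
        case 3
        then have "\<pi> z \<in> ?V'" by (auto simp: WC_def)
        then show ?thesis using f2[of "\<pi> z"] f3[of z] h(2)[of z] 3 by (simp add: A_def)
      qed
    qed
    show "\<pi> z \<in> ?D \<and> f (\<pi> z) \<in> L" if z: "z \<in> vertices T - ?D" for z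
    proof -
      have "z \<in> Q" using z by (simp add: Q_def)
      then consider "z \<in> V1" | "z \<in> W1" "z \<notin> WC" | "z \<in> W2" using z unfolding O_eq by auto
      then show ?thesis
      proof cases
        case 1
        then show ?thesis using f1 xy by (simp add: V1_def)
      next
        case 2
        then have "\<pi> z \<in> ?V'" "g (\<pi> z) \<notin> C" by (auto simp: WC_def)
        then show ?thesis using f2[of "\<pi> z"] g(3)[of "\<pi> z"] by auto
      next
        case 3
        then have "\<pi> z \<in> V2" by (simp add: W2_def)
        then show ?thesis using f3[of "\<pi> z"] h(2)[of "\<pi> z"] by (auto simp: A_def)
      qed
    qed
  qed auto
qed

text \<open>All inner vertices go to \<open>L\<close>. The children of \<open>r2\<close> are placed
  first, because \<open>a\<close> may have few neighbours in \<open>L\<close>; \<open>b\<close> has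
  enough of them to avoid everything placed before.\<close>

lemma embed_in_L:
  assumes ab: "adj b a" "a \<in> L" "b \<in> L" and b: "k \<le> 2 * card (nb b \<inter> L)"
    and a: "card (\<pi> ` W2) < card (nb a \<inter> L)"
    and small: "2 * (card (\<pi> ` W1) + card (\<pi> ` W2)) < k"
  shows "hosts V T"
proof -
  let ?V1 = "\<pi> ` W1" and ?V2 = "\<pi> ` W2"
  have "\<exists>g. inj_on g ?V2 \<and> (\<forall>z\<in>?V2. g z \<in> nb a \<inter> L - {b})"
  proof (rule greedy_choice)
    have "card (nb a \<inter> L) - card {b} \<le> card (nb a \<inter> L - {b})"
      by (rule diff_card_le_card_Diff) simp
    then show "card ?V2 \<le> card (nb a \<inter> L - {b})" using a by simp
  qed simp
  then obtain g where g: "inj_on g ?V2" "\<And>z. z \<in> ?V2 \<Longrightarrow> adj a (g z)" "\<And>z. z \<in> ?V2 \<Longrightarrow> g z \<in> L"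
    "\<And>z. z \<in> ?V2 \<Longrightarrow> g z \<noteq> b" by auto
  have "\<exists>h. inj_on h ?V1 \<and> (\<forall>z\<in>?V1. h z \<in> nb b \<inter> L - insert a (g ` ?V2))"
  proof (rule greedy_choice)
    have "card (insert a (g ` ?V2)) \<le> Suc (card (g ` ?V2))" by (simp add: card_insert_if)
    also have "card (g ` ?V2) = card ?V2" using g(1) by (rule card_image)
    finally have 1: "card (insert a (g ` ?V2)) \<le> Suc (card ?V2)" .
    have "card ?V1 + card ?V2 < card (nb b \<inter> L)" using b small by presburger
    with 1 have "card ?V1 \<le> card (nb b \<inter> L) - card (insert a (g ` ?V2))" by linarith
    also have "\<dots> \<le> card (nb b \<inter> L - insert a (g ` ?V2))"
      by (rule diff_card_le_card_Diff) simp
    finally show "card ?V1 \<le> card (nb b \<inter> L - insert a (g ` ?V2))" .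
  qed simp
  then obtain h where h: "inj_on h ?V1" "\<And>z. z \<in> ?V1 \<Longrightarrow> adj b (h z)" "\<And>z. z \<in> ?V1 \<Longrightarrow> h z \<in> L"
    "\<And>z. z \<in> ?V1 \<Longrightarrow> h z \<noteq> a" "\<And>z. z \<in> ?V1 \<Longrightarrow> h z \<notin> g ` ?V2" by auto
  define f where "f z = (if z = r1 then b else if z = r2 then a else if z \<in> ?V1 then h z else g z)" for z
  have VV: "?V1 \<subseteq> V1" "?V2 \<subseteq> V2" by (rule inner)+
  have OD: "V1 \<subseteq> Q" "V2 \<subseteq> Q" "r1 \<notin> Q" "r2 \<notin> Q"
    by (auto simp: V1_def V2_def Q_def)
  let ?D = "insert r1 (insert r2 (?V1 \<union> ?V2))"
  have f1: "f r1 = b" "f r2 = a" using r by (auto simp: f_def)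
  have f2: "f z = h z" if "z \<in> ?V1" for z using that VV OD by (auto simp: f_def)
  have f3: "f z = g z" if "z \<in> ?V2" for z
  proof -
    have "z \<in> V2" using that VV by blast
    then have "z \<notin> ?V1" "z \<in> Q" using VV OD O_disj by blast+
    then show ?thesis using OD by (auto simp: f_def)
  qed
  have ga: "g z \<noteq> a" if "z \<in> ?V2" for z using g(2)[OF that] adj_irrefl by auto
  have hb: "h z \<noteq> b" if "z \<in> ?V1" for z using h(2)[OF that] adj_irrefl by auto
  show ?thesis
  proof (rule complete)
    show "?D \<subseteq> vertices T" using r OD VV by (auto simp: Q_def)
    show "inj_on f ?D"
    proof -
      have "inj_on f ?V1" using h(1) f2 by (simp cong: inj_on_cong)
      moreover have "inj_on f ?V2" using g(1) f3 by (simp cong: inj_on_cong)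
      moreover have "f ` ?V1 \<inter> f ` ?V2 = {}"
      proof -
        have "f u \<noteq> f v" if "u \<in> ?V1" "v \<in> ?V2" for u v
          using h(5)[OF that(1)] that(2) f2[OF that(1)] f3[OF that(2)] by auto
        then show ?thesis by blast
      qed
      ultimately have "inj_on f (?V1 \<union> ?V2)" by (auto simp: inj_on_Un)
      moreover have "f r2 \<notin> f ` (?V1 \<union> ?V2)"
      proof
        assume "f r2 \<in> f ` (?V1 \<union> ?V2)"
        then obtain z where "z \<in> ?V1 \<union> ?V2" "f z = a" using f1 by (metis imageE)
        then show False using f2[of z] f3[of z] h(4)[of z] ga[of z] by (metis Un_iff)
      qed
      moreover have "f r1 \<notin> f ` insert r2 (?V1 \<union> ?V2)"
      proof
        assume "f r1 \<in> f ` insert r2 (?V1 \<union> ?V2)"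
        then obtain z where z: "z \<in> insert r2 (?V1 \<union> ?V2)" "f z = b" using f1 by (metis imageE)
        then have "z \<noteq> r2" using ab adj_irrefl f1 by auto
        then show False using z f2[of z] f3[of z] hb[of z] g(4)[of z] by (metis Un_iff insertE)
      qed
      ultimately show ?thesis by (simp only: inj_on_insert) blast
    qed
    show "f ` ?D \<subseteq> V" using f1 f2 f3 g(3) h(3) ab LV by auto
    show "adj (f r1) (f r2)" using f1 ab by simp
    show "\<pi> z \<in> ?D \<and> adj (f (\<pi> z)) (f z)" if z: "z \<in> ?D \<inter> Q" for z
    proof -
      consider "z \<in> ?V1" | "z \<in> ?V2" using z OD by auto
      then show ?thesis
      proof cases
        case 1
        then have "\<pi> z = r1" using VV by (auto simp: V1_def)
        then show ?thesis using f1 f2[OF 1] h(2)[OF 1] by simp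
      next
        case 2
        then have "\<pi> z = r2" using VV by (auto simp: V2_def)
        then show ?thesis using f1 f3[OF 2] g(2)[OF 2] by simp
      qed
    qed
    show "\<pi> z \<in> ?D \<and> f (\<pi> z) \<in> L" if z: "z \<in> vertices T - ?D" for z
    proof -
      have "z \<in> Q" using z by (simp add: Q_def)
      then consider "z \<in> V1" | "z \<in> V2" | "z \<in> W1" | "z \<in> W2" unfolding O_eq by auto
      then show ?thesis
      proof cases
        case 1
        then show ?thesis using f1 ab by (simp add: V1_def)
      next
        case 2
        then show ?thesis using f1 ab by (simp add: V2_def)
      next
        case 3
        then show ?thesis using f2[of "\<pi> z"] h(3)[of "\<pi> z"] by auto
      next
        case 4
        then show ?thesis using f3[of "\<pi> z"] g(3)[of "\<pi> z"] by auto
      qed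
    qed
  qed auto
qed

lemma hosts_tree_small:
  assumes small: "2 * (card V2 + card W1) < k"
  shows "hosts V T"
proof (rule ccontr)
  assume no: "\<not> hosts V T"
  let ?p = "card (\<pi> ` W1)" and ?q = "card (\<pi> ` W2)"
  define D where "D = V - L - C"
  have pq: "2 * (?p + ?q) < k" using small inner(3) inner_le(1) by presburger
  have finC: "finite C" "finite D" "finite B" using finV LV by (auto simp: C_def D_def B_def intro: finite_subset)
  have CL: "nb c \<inter> L = nb c" if "c \<in> V - L" for c using that by (auto dest: indep)
  have E1: "card (nb x \<inter> (L \<union> C)) \<le> ?p" if "adj x c" "x \<in> L" "c \<in> C" for x c
  proof (rule ccontr)
    assume "\<not> ?thesis"
    moreover have "k \<le> 2 * card (nb c \<inter> L)" "c \<notin> L" using that(3) CL by (auto simp: C_def)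
    ultimately show False using no embed_via_C[OF that(1,2), OF _ _ _ small] by auto
  qed
  have Bge: "?p + ?q < card (nb b \<inter> L)" if "b \<in> B" for b
    using that pq by (auto simp: B_def)
  have BC: "\<not> adj b c" if "b \<in> B" "c \<in> C" for b c
  proof
    assume bc: "adj b c"
    have "card (nb b \<inter> L) \<le> card (nb b \<inter> (L \<union> C))" by (intro card_mono) auto
    then show False using E1[OF bc _ that(2)] Bge[OF that(1)] that by (auto simp: B_def)
  qed
  have E2: "card (nb x \<inter> (L \<union> C)) \<le> ?p" if "adj x b" "x \<in> L" "b \<in> B" for x b
  proof (rule ccontr)
    assume "\<not> ?thesis"
    moreover have "k \<le> 2 * card (nb b \<inter> L)" using that(3) by (auto simp: B_def)
    ultimately show False using no embed_via_C[OF that(1,2), OF _ _ _ small] BC[OF that(3)] by auto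
  qed
  have E3: "card (nb a \<inter> L) \<le> ?q" if "adj b a" "a \<in> L" "b \<in> B" for a b
  proof (rule ccontr)
    assume "\<not> ?thesis"
    moreover have "k \<le> 2 * card (nb b \<inter> L)" "b \<in> L" using that(3) by (auto simp: B_def)
    ultimately show False using no embed_in_L[OF that(1,2)] pq by auto
  qed
  have BB: "\<not> adj b b'" if "b \<in> B" "b' \<in> B" for b b'
    using E3[of b b'] Bge[of b'] that by (auto simp: B_def)
  have BL: "B \<subseteq> L" by (auto simp: B_def)
  define A where "A = L - B"
  have finA: "finite A" by (simp add: A_def)
  have split: "card (nb v) = card (nb v \<inter> (L \<union> C)) + card (nb v \<inter> D)" for v
  proof -
    have "nb v = (nb v \<inter> (L \<union> C)) \<union> (nb v \<inter> D)" using nbV by (auto simp: D_def)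
    moreover have "card ((nb v \<inter> (L \<union> C)) \<union> (nb v \<inter> D)) = card (nb v \<inter> (L \<union> C)) + card (nb v \<inter> D)"
      by (intro card_Un_disjoint) (auto simp: D_def C_def)
    ultimately show ?thesis by simp
  qed
  \<comment> \<open>Vertices of \<open>B\<close> may send edges to \<open>A\<close> instead of
    \<open>D\<close>. The term \<open>2 * card (nb a \<inter> B)\<close> on the side of
    \<open>A\<close> compensates for these edges in the double count.\<close>
  have Ab: "k + 1 + 2 * card (nb a \<inter> B) \<le> 2 * card (nb a \<inter> D)" if a: "a \<in> A" for a
  proof -
    have aL: "a \<in> L" "a \<notin> B" using a by (auto simp: A_def)
    have kd: "k \<le> card (nb a \<inter> (L \<union> C)) + card (nb a \<inter> D)" using Ldeg[OF aL(1)] split by simp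
    have Bq: "card (nb a \<inter> B) \<le> card (nb a \<inter> L)" using BL by (intro card_mono) auto
    consider b where "b \<in> B" "adj a b" | "nb a \<inter> B = {}" "nb a \<inter> C \<noteq> {}" | "nb a \<inter> B = {}" "nb a \<inter> C = {}"
      by (metis Int_iff equals0I mem_nb)
    then show ?thesis
    proof cases
      case 1
      then show ?thesis using E2[OF 1(2) aL(1) 1(1)] E3[OF adj_sym[OF 1(2)] aL(1) 1(1)] kd Bq pq by presburger
    next
      case 2
      then obtain c where "c \<in> C" "adj a c" by auto
      then show ?thesis using E1[of a c] aL kd pq 2(1) by auto
    next
      case 3
      then have "nb a \<inter> (L \<union> C) = nb a \<inter> L" by auto
      moreover have "2 * card (nb a \<inter> L) < k" using aL by (auto simp: B_def)
      ultimately show ?thesis using kd 3(1) by simp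
    qed
  qed
  have Bb: "k \<le> card (nb b \<inter> A) + card (nb b \<inter> D)" if b: "b \<in> B" for b
  proof -
    have "nb b \<inter> (L \<union> C) = nb b \<inter> A" using BC[OF b] BB[OF b] by (auto simp: A_def)
    then show ?thesis using Ldeg[of b] split[of b] b BL by auto
  qed
  have "(\<Sum>v\<in>L. 2 * card (nb v \<inter> D)) = (\<Sum>v\<in>A. 2 * card (nb v \<inter> D)) + (\<Sum>v\<in>B. 2 * card (nb v \<inter> D))"
    using BL sum.subset_diff[OF BL, of "\<lambda>v. 2 * card (nb v \<inter> D)"] by (simp add: A_def)
  moreover have "(k + 1) * card A + 2 * (\<Sum>a\<in>A. card (nb a \<inter> B)) \<le> (\<Sum>v\<in>A. 2 * card (nb v \<inter> D))"
  proof -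
    have "(\<Sum>a\<in>A. k + 1 + 2 * card (nb a \<inter> B)) \<le> (\<Sum>v\<in>A. 2 * card (nb v \<inter> D))"
      using Ab by (intro sum_mono) auto
    moreover have "(\<Sum>a\<in>A. k + 1 + 2 * card (nb a \<inter> B)) = (k + 1) * card A + 2 * (\<Sum>a\<in>A. card (nb a \<inter> B))"
      unfolding sum.distrib sum_distrib_left by simp
    ultimately show ?thesis by simp
  qed
  moreover have "(\<Sum>b\<in>B. 2 * k) \<le> (\<Sum>b\<in>B. 2 * card (nb b \<inter> A) + 2 * card (nb b \<inter> D))"
    using Bb by (intro sum_mono) fastforce
  moreover have "(\<Sum>a\<in>A. card (nb a \<inter> B)) = (\<Sum>b\<in>B. card (nb b \<inter> A))"
    using finA finC by (intro double_count)
  ultimately have "(k + 1) * card A + 2 * k * card B \<le> (\<Sum>v\<in>L. 2 * card (nb v \<inter> D))"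
    by (simp add: sum.distrib sum_distrib_left[symmetric] algebra_simps)
  also have "\<dots> = (\<Sum>d\<in>D. 2 * card (nb d \<inter> L))"
    using double_count[of L D] finC by (simp add: sum_distrib_left[symmetric])
  also have "\<dots> \<le> (\<Sum>d\<in>D. k - 1)"
  proof (intro sum_mono)
    fix d assume "d \<in> D"
    then have d: "d \<in> V - L" "\<not> k \<le> 2 * card (nb d)" by (auto simp: D_def C_def)
    show "2 * card (nb d \<inter> L) \<le> k - 1" using d(2) unfolding CL[OF d(1)] by linarith
  qed
  also have "\<dots> = (k - 1) * card D" by simp
  also have "\<dots> \<le> (k - 1) * card L"
  proof -
    have "card D \<le> card (V - L)" using finV by (intro card_mono) (auto simp: D_def)
    then show ?thesis using half by simp
  qed
  finally have 1: "(k + 1) * card A + 2 * k * card B \<le> (k - 1) * card L" .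
  have cL: "card L = card A + card B"
    using BL finC by (simp add: A_def card_Diff_subset card_mono)
  have "(k + 1) * card B \<le> 2 * k * card B" using k_pos by simp
  then have "(k + 1) * card L \<le> (k + 1) * card A + 2 * k * card B"
    unfolding cL add_mult_distrib2 by (rule add_left_mono)
  then have "(k + 1) * card L \<le> (k - 1) * card L" using 1 by (rule order_trans)
  moreover have "card L > 0" using Lne by (simp add: card_gt_0_iff)
  ultimately have "k + 1 \<le> k - 1" by (metis mult_le_cancel2)
  then show False by simp
qed

end

text \<open>The two ends of the central edge are interchangeable. By \<open>card_O\<close> the four
  sizes add up to \<open>k - 1\<close>, so \<open>hosts_tree_small\<close> applies in at least one
  orientation.\<close>

sublocale lks_tree \<subseteq> swap: lks_tree adj L V k T r2 r1 \<pi>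
  using cardT r edgesT levels by unfold_locales (auto simp: insert_commute)

lemma (in lks_tree) hosts_tree: "hosts V T"
proof (cases "2 * (card V2 + card W1) < k")
  case True
  then show ?thesis by (rule hosts_tree_small)
next
  case False
  have "swap.V1 = V2" "swap.V2 = V1"
    by (auto simp: swap.V1_def V1_def swap.V2_def V2_def swap.Q_def Q_def)
  moreover from this have "swap.W1 = W2"
    by (auto simp: swap.W1_def W2_def swap.Q_def Q_def)
  ultimately show ?thesis using swap.hosts_tree_small card_O False by simp
qed

section \<open>Trees of diameter at most five\<close>

locale tree_graph =
  fixes T :: "'a sgraph"
  assumes tree: "is_tree T"
begin

definition E :: "'a \<Rightarrow> 'a \<Rightarrow> bool" where
  "E u v \<longleftrightarrow> {u, v} \<in> edges T"

lemma simpleT: "simple_graph T"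
  using tree by (simp add: is_tree_def)

lemma finV: "finite (vertices T)"
  using simpleT by (simp add: simple_graph_def)

lemma edgeD: "e \<in> edges T \<Longrightarrow> \<exists>u v. e = {u, v} \<and> u \<noteq> v \<and> u \<in> vertices T \<and> v \<in> vertices T"
  using simpleT unfolding simple_graph_def by (meson nsets2_E subsetD)

sublocale sym_graph E
proof
  show "E u v \<Longrightarrow> E v u" for u v by (simp add: E_def insert_commute)
  show "\<not> E u u" for u using edgeD[of "{u, u}"] by (auto simp: E_def doubleton_eq_iff)
qed

abbreviation "gp \<equiv> gpath (vertices T)"

lemma is_path_eq: "is_path T p \<longleftrightarrow> gp p"
  by (simp add: is_path_def gpath_def E_def)

lemma E_vertices: "E u v \<Longrightarrow> u \<in> vertices T \<and> v \<in> vertices T \<and> u \<noteq> v"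
  using edgeD[of "{u, v}"] by (auto simp: E_def doubleton_eq_iff)

lemma connected: "u \<in> vertices T \<Longrightarrow> v \<in> vertices T \<Longrightarrow> \<exists>p. gp p \<and> hd p = u \<and> last p = v"
  using tree by (auto simp: is_tree_def connected_graph_def path_between_def is_path_eq)

lemma no_cycle: "gp p \<Longrightarrow> 3 \<le> length p \<Longrightarrow> \<not> E (last p) (hd p)"
  using tree by (auto simp: is_tree_def acyclic_graph_def is_path_eq E_def)

lemma gpath_Cons: "xs \<noteq> [] \<Longrightarrow> gpath X (x # xs) \<longleftrightarrow> x \<in> X \<and> x \<notin> set xs \<and> E x (hd xs) \<and> gpath X xs"
  using gpath_append[of "[x]" xs X] by auto

text \<open>If the paths diverge after \<open>u\<close>, follow the first to its first vertex
  \<open>z\<close> on the second; returning along the second closes a cycle.\<close>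

lemma unique_path: "gp p \<Longrightarrow> gp q \<Longrightarrow> hd p = hd q \<Longrightarrow> last p = last q \<Longrightarrow> p = q"
proof (induction p arbitrary: q)
  case Nil
  then show ?case by (simp add: gpath_def)
next
  case (Cons u p')
  obtain q' where q: "q = u # q'"
    using Cons.prems gpath_ne[OF Cons.prems(2)] by (cases q) auto
  have dq: "distinct q" "distinct (u # p')" using Cons.prems by (auto simp: gpath_def)
  show ?case
  proof (cases "p' = [] \<or> q' = []")
    case True
    then show ?thesis
    proof
      assume "p' = []"
      then have "last q = u" using Cons.prems by simp
      then have "q' = []" using dq q by (cases q' rule: rev_cases) auto
      then show ?thesis using q \<open>p' = []\<close> by simp
    next
      assume "q' = []"
      then have "last (u # p') = u" using Cons.prems q by simp
      then have "p' = []" using dq by (cases p' rule: rev_cases) auto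
      then show ?thesis using q \<open>q' = []\<close> by simp
    qed
  next
    case False
    then have p': "gp p'" "E u (hd p')" "u \<in> vertices T" "u \<notin> set p'"
      and q': "gp q'" "E u (hd q')" "u \<notin> set q'"
      using Cons.prems by (auto simp: q gpath_Cons)
    have l: "last p' = last q'" using Cons.prems False q by simp
    show ?thesis
    proof (cases "hd p' = hd q'")
      case True
      then show ?thesis using Cons.IH[OF p'(1) q'(1) _ l] q by simp
    next
      case neq: False
      have "\<exists>x\<in>set p'. x \<in> set q'" using l False by (metis last_in_set)
      from split_list_first_prop[OF this]
      obtain as z bs where p2: "p' = as @ z # bs" "z \<in> set q'" "\<forall>y\<in>set as. y \<notin> set q'"
        by blast
      then obtain cs ds where q2: "q' = cs @ z # ds" by (meson split_list)
      have r1: "gp (u # as @ [z])"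
        using gpath_takeI[OF Cons.prems(1), of "length (u # as @ [z])"] by (simp add: p2(1))
      \<comment> \<open>For empty \<open>cs\<close> the second path goes straight from
        \<open>u\<close> to \<open>z\<close>, and the edge itself closes the cycle.\<close>
      show ?thesis
      proof (cases "cs = []")
        case True
        then have "as \<noteq> []" using neq p2(1) q2 by auto
        then have "3 \<le> length (u # as @ [z])" by (cases as) auto
        then show ?thesis using no_cycle[OF r1] q'(2) adj_sym True q2 by auto
      next
        case False
        have c: "gp cs" "E (last cs) z"
          using q'(1) False unfolding q2 by (auto simp: gpath_append)
        have "set (u # as @ [z]) \<inter> set (rev cs) = {}"
          using p2(3) q'(3) dq q q2 by auto
        then have "gp ((u # as @ [z]) @ rev cs)"
          using r1 c False adj_sym by (subst gpath_append) (auto simp: hd_rev)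
        moreover have "3 \<le> length ((u # as @ [z]) @ rev cs)" using False by (cases cs) auto
        moreover have "last ((u # as @ [z]) @ rev cs) = hd q'"
          using False q2 by (simp add: last_rev)
        ultimately show ?thesis using no_cycle[of "(u # as @ [z]) @ rev cs"] q'(2) adj_sym by auto
      qed
    qed
  qed
qed

text \<open>Being the only path between its ends, a path in a tree realises their distance.\<close>

lemma path_length_le_diameter:
  assumes "gp p" shows "length p \<le> Suc (graph_diameter T)"
proof -
  let ?u = "hd p" and ?v = "last p"
  have uv: "?u \<in> vertices T" "?v \<in> vertices T"
    using assms by (auto simp: gpath_def)
  have "graph_dist T ?u ?v = length p - 1"
    unfolding graph_dist_def
  proof (rule Least_equality)
    show "\<exists>q. path_between T ?u q ?v \<and> length p - 1 = length q - 1"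
      using assms by (auto simp: path_between_def is_path_eq)
    show "length p - 1 \<le> n" if "\<exists>q. path_between T ?u q ?v \<and> n = length q - 1" for n
    proof -
      obtain q where "gp q" "hd q = ?u" "last q = ?v" "n = length q - 1"
        using \<open>\<exists>q. path_between T ?u q ?v \<and> n = length q - 1\<close> by (auto simp: path_between_def is_path_eq)
      then show ?thesis using unique_path[OF assms, of q] by simp
    qed
  qed
  moreover have "graph_dist T ?u ?v \<le> graph_diameter T"
    unfolding graph_diameter_def
  proof (rule Max_ge)
    have "{graph_dist T u v |u v. u \<in> vertices T \<and> v \<in> vertices T}
      = (\<lambda>(u, v). graph_dist T u v) ` (vertices T \<times> vertices T)" by auto
    then show "finite {graph_dist T u v |u v. u \<in> vertices T \<and> v \<in> vertices T}"
      using finV by simp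
  qed (use uv in blast)
  ultimately show ?thesis by simp
qed

text \<open>The central edge is the edge \<open>xs ! s\<close>, \<open>xs ! Suc s\<close> of a longest path \<open>xs\<close>; by maximality,
  a vertex whose path to \<open>xs\<close> ends in \<open>xs ! i\<close> has distance at most \<open>min i (d - i)\<close> to it.\<close>

lemma bicentred:
  assumes diam: "graph_diameter T \<le> 5" and ne: "1 \<le> card (edges T)"
  obtains r1 r2 \<pi> where "card (vertices T) = Suc (card (edges T))"
    "r1 \<in> vertices T" "r2 \<in> vertices T" "r1 \<noteq> r2"
    "edges T \<subseteq> insert {r1, r2} {{x, \<pi> x} | x. x \<in> vertices T - {r1, r2}}"
    "\<And>x. x \<in> vertices T - {r1, r2} \<Longrightarrow>
      \<pi> x \<in> {r1, r2} \<or> \<pi> x \<in> vertices T - {r1, r2} \<and> \<pi> (\<pi> x) \<in> {r1, r2}"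
proof -
  have "edges T \<noteq> {}" using ne by auto
  then obtain u0 v0 where uv0: "E u0 v0" using edgeD by (metis E_def all_not_in_conv)
  have p0: "gp [u0, v0]" using uv0 E_vertices by (auto simp: gpath_Cons)
  have "\<forall>q. gp q \<longrightarrow> length q < Suc (card (vertices T))"
    using gpath_length[OF finV] by (auto simp: less_Suc_eq_le)
  then obtain xs where xs: "gp xs" and xmax: "\<And>q. gp q \<Longrightarrow> length q \<le> length xs"
    using ex_has_greatest_nat[of gp _ length] p0 by blast
  define d where "d = length xs - 1"
  have d1: "1 \<le> d" using xmax[OF p0] by (simp add: d_def)
  have lx: "length xs = Suc d" using d1 by (simp add: d_def)
  have d5: "d \<le> 5" using path_length_le_diameter[OF xs] lx diam by simp
  \<comment> \<open>For \<open>d = 5\<close> this is the middle edge; the minimum keeps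
    \<open>Suc s\<close> on shorter paths. In every case at most two edges of \<open>xs\<close> lie
    on either side of the central edge.\<close>
  define s where "s = min 2 (d - 1)"
  have s: "s \<le> 2" "Suc s \<le> d" "d \<le> s + 3" using d1 d5 by (auto simp: s_def)
  define r1 where "r1 = xs ! s"
  define r2 where "r2 = xs ! Suc s"
  have dx: "distinct xs" "set xs \<subseteq> vertices T" using xs by (auto simp: gpath_def)
  have r: "r1 \<in> vertices T" "r2 \<in> vertices T" "r1 \<noteq> r2"
    using dx s lx by (auto simp: r1_def r2_def nth_eq_iff_index_eq)
  have r12: "E r1 r2"
    using xs successively_nth[of E xs s] s lx by (auto simp: gpath_def r1_def r2_def)
  define \<pi> where "\<pi> x = (SOME p. gp p \<and> hd p = x \<and> last p = r1) ! 1" for x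
  have \<pi>: "\<pi> x = p ! 1" if "gp p" "hd p = x" "last p = r1" for x p
  proof -
    have "(SOME p. gp p \<and> hd p = x \<and> last p = r1) = p"
      by (rule some_equality) (use that unique_path in auto)
    then show ?thesis by (simp add: \<pi>_def)
  qed
  have \<pi>2: "\<pi> x = y" if "gp (x # y # q)" "last (y # q) = r1" for x y q
    using \<pi>[of "x # y # q" x] that by simp
  have up: "\<exists>y q. gp (x # y # q) \<and> last (y # q) = r1" if x: "x \<in> vertices T" "x \<noteq> r1" for x
  proof -
    obtain p where p: "gp p" "hd p = x" "last p = r1" using connected x r by blast
    then obtain p' where p': "p = x # p'" using gpath_ne by (cases p) auto
    then obtain y q where "p' = y # q" using p x by (cases p') auto
    then have "gp (x # y # q)" "last (y # q) = r1" using p p' by auto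
    then show ?thesis by blast
  qed
  have e: "e \<in> edges T \<longleftrightarrow> (\<exists>x\<in>vertices T - {r1}. e = {x, \<pi> x})" for e
  proof
    assume "\<exists>x\<in>vertices T - {r1}. e = {x, \<pi> x}"
    then obtain x where x: "x \<in> vertices T" "x \<noteq> r1" "e = {x, \<pi> x}" by auto
    obtain y q where y: "gp (x # y # q)" "last (y # q) = r1" using up[OF x(1,2)] by blast
    then have "E x y" by (auto simp: gpath_Cons)
    then show "e \<in> edges T" using \<pi>2[OF y] x by (simp add: E_def)
  next
    assume "e \<in> edges T"
    then obtain u v where uv: "e = {u, v}" "u \<noteq> v" "u \<in> vertices T" "v \<in> vertices T" using edgeD by blast
    then have Euv: "E u v" using \<open>e \<in> edges T\<close> by (simp add: E_def)
    obtain p where p: "gp p" "hd p = u" "last p = r1" using connected uv r by blast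
    have pne: "p \<noteq> []" using p gpath_ne by auto
    \<comment> \<open>The end of the edge that is farther from \<open>r1\<close> has the other end
      as its parent; whether \<open>v\<close> lies on the path from \<open>u\<close> decides which
      one it is.\<close>
    show "\<exists>x\<in>vertices T - {r1}. e = {x, \<pi> x}"
    proof (cases "v \<in> set p")
      case False
      then have "gp (v # p)" using p Euv adj_sym uv pne by (subst gpath_Cons) auto
      moreover have "p = u # tl p" using p pne by (cases p) auto
      ultimately have "\<pi> v = u" using \<pi>2[of v u "tl p"] p by metis
      moreover have "v \<noteq> r1" using False p pne by auto
      ultimately show ?thesis using uv by auto
    next
      case True
      then obtain cs ds where cd: "p = cs @ v # ds" by (meson split_list)
      have cne: "cs \<noteq> []" using cd p uv by (cases cs) auto
      have "gp (cs @ [v])"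
        using gpath_takeI[OF p(1), of "length (cs @ [v])"] by (simp add: cd)
      moreover have "gp [u, v]" using Euv uv by (auto simp: gpath_Cons)
      moreover have "hd (cs @ [v]) = u" using p cd cne by simp
      ultimately have "cs @ [v] = [u, v]" using unique_path[of "cs @ [v]" "[u, v]"] by simp
      then have "p = u # v # ds" using cd by simp
      then have "\<pi> u = v" using \<pi>2[of u v ds] p by simp
      moreover have "u \<noteq> r1"
      proof
        assume "u = r1"
        then have "p = [u]" using unique_path[OF p(1), of "[u]"] p uv by simp
        then show False using True uv by simp
      qed
      ultimately show ?thesis using uv by auto
    qed
  qed
  have \<pi>r2: "\<pi> r2 = r1"
    by (rule \<pi>2[of r2 r1 "[]"]) (use r r12 adj_sym in \<open>auto simp: gpath_Cons\<close>)
  show ?thesis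
  proof (rule that[of r1 r2 \<pi>])
    show "edges T \<subseteq> insert {r1, r2} {{x, \<pi> x} | x. x \<in> vertices T - {r1, r2}}"
    proof
      fix f assume "f \<in> edges T"
      then obtain x where "x \<in> vertices T - {r1}" "f = {x, \<pi> x}" using e by auto
      then show "f \<in> insert {r1, r2} {{x, \<pi> x} | x. x \<in> vertices T - {r1, r2}}"
        using \<pi>r2 by (cases "x = r2") auto
    qed
    show "card (vertices T) = Suc (card (edges T))"
    proof -
      have "edges T = (\<lambda>x. {x, \<pi> x}) ` (vertices T - {r1})" using e by auto
      moreover have "inj_on (\<lambda>x. {x, \<pi> x}) (vertices T - {r1})"
      proof (rule inj_onI, rule ccontr)
        fix x y assume x: "x \<in> vertices T - {r1}" and y: "y \<in> vertices T - {r1}"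
          and eq: "{x, \<pi> x} = {y, \<pi> y}" and "x \<noteq> y"
        then have xy: "\<pi> x = y" "\<pi> y = x" by (auto simp: doubleton_eq_iff)
        obtain z q where zq: "gp (x # z # q)" "last (z # q) = r1" using up[of x] x by auto
        then have zy: "z = y" using \<pi>2 xy by metis
        then have "q \<noteq> []" using zq y by auto
        then have "gp (y # hd q # tl q)" "last (hd q # tl q) = r1"
          using zq zy by (auto simp: gpath_Cons)
        then have "\<pi> y = hd q" by (rule \<pi>2)
        then show False using xy zq \<open>q \<noteq> []\<close> by (auto simp: gpath_def)
      qed
      ultimately have "card (edges T) = card (vertices T - {r1})" by (simp add: card_image)
      then show ?thesis using card.remove[OF finV r(1)] by simp
    qed
    fix x assume x: "x \<in> vertices T - {r1, r2}"
    obtain p where p: "gp p" "hd p = x" "last p = r1" using connected x r by blast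
    have pne: "p \<noteq> []" using p gpath_ne by auto
    have "r1 \<in> set xs" using s lx by (simp add: r1_def)
    then have "\<exists>y\<in>set p. y \<in> set xs" using p pne last_in_set[of p] by auto
    from split_list_first_prop[OF this]
    obtain as z bs where p2: "p = as @ z # bs" "z \<in> set xs" "\<forall>y\<in>set as. y \<notin> set xs"
      by blast
    obtain i where i: "i \<le> d" "z = xs ! i" using p2(2) lx by (auto simp: in_set_conv_nth less_Suc_eq_le)
    \<comment> \<open>\<open>as\<close> avoids \<open>xs\<close>, so the way from \<open>x\<close>
      can be continued along \<open>xs\<close> in either direction from \<open>z\<close>. Maximality
      of \<open>xs\<close> then bounds \<open>as\<close> by both arms.\<close>
    have join: "gp (as @ q) \<and> (hd (as @ q) = x)" if q: "gp q" "hd q = z" "set q \<subseteq> set xs" for q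
    proof (cases "as = []")
      case True
      then show ?thesis using q p p2 by simp
    next
      case False
      have "gp as" "E (last as) z" using p(1) False unfolding p2(1) by (auto simp: gpath_append)
      then have "gp (as @ q)" using q False gpath_ne[OF q(1)] p2(3) by (subst gpath_append) auto
      then show ?thesis using False p p2 by simp
    qed
    have ji: "length as \<le> i"
    proof -
      have "gp (drop i xs)" using gpath_dropI[OF xs] i lx by simp
      moreover have "hd (drop i xs) = z" using i lx by (simp add: hd_drop_conv_nth)
      ultimately have "gp (as @ drop i xs)" using join by (simp add: set_drop_subset)
      from xmax[OF this] show ?thesis using i lx by simp
    qed
    have jd: "length as \<le> d - i"
    proof -
      have "gp (rev (take (Suc i) xs))" using gpath_takeI[OF xs] by simp
      moreover have "hd (rev (take (Suc i) xs)) = z"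
        using i lx by (simp add: hd_rev take_Suc_conv_app_nth)
      ultimately have "gp (as @ rev (take (Suc i) xs))" using join by (simp add: set_take_subset)
      from xmax[OF this] show ?thesis using i lx by simp
    qed
    \<comment> \<open>For \<open>i \<le> s\<close> the path from \<open>x\<close> to
      \<open>r1\<close> has at most \<open>i + (s - i) \<le> 2\<close> edges; otherwise at most
      \<open>(d - i) + (i - s) \<le> 3\<close>, the last of which is the central edge.\<close>
    show "\<pi> x \<in> {r1, r2} \<or> \<pi> x \<in> vertices T - {r1, r2} \<and> \<pi> (\<pi> x) \<in> {r1, r2}"
    proof (cases "i \<le> s")
      case True
      let ?q = "take (Suc (s - i)) (drop i xs)"
      have "gp ?q" using gpath_takeI[OF gpath_dropI[OF xs]] i lx by simp
      moreover have "hd ?q = z" using i lx by (simp add: hd_drop_conv_nth)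
      moreover have "set ?q \<subseteq> set xs" by (meson set_drop_subset set_take_subset subset_trans)
      ultimately have q: "gp (as @ ?q)" "hd (as @ ?q) = x" using join by auto
      have ql: "length ?q = Suc (s - i)" using i lx True s by simp
      have "last ?q = r1" using i lx True s ql by (simp add: last_conv_nth r1_def)
      moreover have "?q \<noteq> []" using ql by (metis length_0_conv nat.distinct(1))
      ultimately have "last (as @ ?q) = r1" by (metis last_appendR)
      then have "p = as @ ?q" using unique_path[OF p(1) q(1)] p q by simp
      then have "length p \<le> 3" using ql ji True s by simp
      then consider "p = [x, r1]" | y where "p = [x, y, r1]"
        using p pne x
        by (cases p; cases "tl p"; cases "tl (tl p)") (auto split: if_splits)
      then show ?thesis
      proof cases
        case 1
        then show ?thesis using \<pi>[OF p] by simp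
      next
        case 2
        have "\<pi> x = y" using \<pi>[OF p] 2 by simp
        moreover have "gp [y, r1]" using p(1) 2 by (auto simp: gpath_Cons)
        then have "\<pi> y = r1" "y \<in> vertices T" using \<pi>2[of y r1 "[]"] by (auto simp: gpath_def)
        moreover have "y \<noteq> r1" using p(1) 2 by (auto simp: gpath_def)
        ultimately show ?thesis by auto
      qed
    next
      case False
      let ?q = "rev (take (Suc (i - s)) (drop s xs))"
      have "gp ?q" using gpath_takeI[OF gpath_dropI[OF xs]] s lx by simp
      moreover have ql: "length ?q = Suc (i - s)" using i lx False s by simp
      moreover have hq: "hd ?q = z" using i lx False ql by (simp add: hd_rev last_conv_nth)
      moreover have "set ?q \<subseteq> set xs" by (metis set_rev set_drop_subset set_take_subset subset_trans)
      ultimately have q: "gp (as @ ?q)" "hd (as @ ?q) = x" using join by auto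
      have lq: "last ?q = r1" using s lx by (simp add: last_rev hd_drop_conv_nth r1_def)
      moreover have "?q \<noteq> []" using ql by (metis length_0_conv nat.distinct(1))
      ultimately have "last (as @ ?q) = r1" by (metis last_appendR)
      then have pq: "p = as @ ?q" using unique_path[OF p(1) q(1)] p q by simp
      then have lp: "length p \<le> 4" "2 \<le> length p" using ql jd False s i(1) by auto
      have "p ! (length p - 2) = r2"
      proof -
        have "?q ! (i - s - 1) = r2" using ql False i lx s by (simp add: rev_nth r2_def)
        moreover have "length p - 2 = length as + (i - s - 1)" using pq ql False by simp
        ultimately show ?thesis unfolding pq by (simp add: nth_append)
      qed
      then consider "p = [x, r1]" "x = r2" | "p = [x, r2, r1]" | y where "p = [x, y, r2, r1]"
        using p pne lp
        by (cases p; cases "tl p"; cases "tl (tl p)"; cases "tl (tl (tl p))") (auto split: if_splits)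
      then show ?thesis
      proof cases
        case 1
        then show ?thesis using x by simp
      next
        case 2
        then show ?thesis using \<pi>[OF p] by simp
      next
        case 3
        have "\<pi> x = y" using \<pi>[OF p] 3 by simp
        moreover have "gp [y, r2, r1]" using p(1) 3 by (auto simp: gpath_Cons)
        then have "\<pi> y = r2" "y \<in> vertices T" using \<pi>2[of y r2 "[r1]"] by (auto simp: gpath_def)
        moreover have "y \<noteq> r1" "y \<noteq> r2" using p(1) 3 by (auto simp: gpath_def)
        ultimately show ?thesis by auto
      qed
    qed
  qed (use r in auto)
qed

end

section \<open>Cycles through all vertices of large degree\<close>

context sym_graph
begin

text \<open>Two adjacent vertices count as a cycle, so that a path with two vertices can also be
  closed.\<close>

definition cyc :: "'v set \<Rightarrow> 'v list \<Rightarrow> bool" where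
  "cyc X cs \<longleftrightarrow> gpath X cs \<and> 2 \<le> length cs \<and> adj (last cs) (hd cs)"

lemma cyc_rotate1: "cyc X cs \<Longrightarrow> cyc X (rotate1 cs)"
proof -
  assume c: "cyc X cs"
  then obtain x y ys where cs: "cs = x # y # ys"
    by (cases cs; cases "tl cs") (auto simp: cyc_def)
  have "gpath X (y # ys)" "x \<in> X" "x \<notin> set (y # ys)" "adj x y" "adj (last (y # ys)) x"
    using c gpath_append[of "[x]" "y # ys" X] by (auto simp: cs cyc_def)
  then have "gpath X ((y # ys) @ [x])" by (subst gpath_append) auto
  then show ?thesis using \<open>adj x y\<close> by (simp add: cs cyc_def)
qed

lemma cyc_rotate: "cyc X cs \<Longrightarrow> cyc X (rotate m cs)"
  by (induction m) (auto simp: cyc_rotate1)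

lemma cyc_adj:
  assumes "cyc X cs" "i < length cs"
  shows "adj (cs ! i) (cs ! (Suc i mod length cs))"
proof (cases "Suc i = length cs")
  case True
  then have "cs ! i = last cs" "cs ! 0 = hd cs"
    using assms by (metis diff_Suc_1 last_conv_nth list.size(3) nat.distinct(1))
      (use True in \<open>metis hd_conv_nth list.size(3) nat.distinct(1)\<close>)
  then show ?thesis using assms True by (simp add: cyc_def)
next
  case False
  then show ?thesis using assms successively_nth[of adj cs i] by (simp add: cyc_def gpath_def)
qed

lemma cyc_path_from:
  assumes "cyc X cs" "w \<in> set cs"
  obtains q where "gpath X q" "hd q = w" "set q = set cs"
proof -
  obtain i where i: "i < length cs" "w = cs ! i" using assms(2) by (auto simp: in_set_conv_nth)
  have "gpath X (rotate i cs)" using cyc_rotate[OF assms(1)] by (simp add: cyc_def)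
  moreover have "hd (rotate i cs) = w"
  proof -
    have "cs \<noteq> []" using assms by auto
    then have "rotate i cs ! 0 = w" using i by (simp add: nth_rotate)
    then show ?thesis using \<open>cs \<noteq> []\<close> by (simp add: hd_conv_nth)
  qed
  ultimately show ?thesis using that by simp
qed

text \<open>Otherwise the ends have no common neighbour off \<open>p\<close> and no crossing pair of
  neighbours on \<open>p\<close>, so their degrees add up to at most
  \<open>(length p - 1) + (card X - length p)\<close>.\<close>

lemma close_path:
  assumes fin: "finite X" and p: "gpath X p" "2 \<le> length p"
    and deg: "card X \<le> card (nb (hd p) \<inter> X) + card (nb (last p) \<inter> X)"
  shows "\<exists>cs. cyc X cs \<and> set p \<subseteq> set cs"
proof (rule ccontr)
  assume no: "\<not> ?thesis"
  let ?u = "hd p" and ?v = "last p"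
  have ne: "p \<noteq> []" and dp: "distinct p" "set p \<subseteq> X" using p by (auto simp: gpath_def)
  have out: "nb ?u \<inter> (X - set p) \<inter> (nb ?v \<inter> (X - set p)) = {}"
  proof (rule ccontr)
    assume "\<not> ?thesis"
    then obtain w where "w \<in> nb ?u \<inter> (X - set p) \<inter> (nb ?v \<inter> (X - set p))" by blast
    then have w: "w \<in> X - set p" "adj ?u w" "adj ?v w" by auto
    have "gpath X (p @ [w])" using p w ne by (subst gpath_append) auto
    then have "cyc X (p @ [w])" using w ne adj_sym p by (auto simp: cyc_def)
    then show False using no by auto
  qed
  have cr: "\<not> (adj ?v (p ! t) \<and> adj ?u (p ! Suc t))" if t: "Suc t < length p" for t
  proof
    assume h: "adj ?v (p ! t) \<and> adj ?u (p ! Suc t)"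
    obtain F G where FG: "p = F @ G" "F \<noteq> []" "G \<noteq> []" "last F = p ! t" "hd G = p ! Suc t"
      using split_at[OF t] by metis
    have d: "gpath X F" "gpath X G" "set F \<inter> set G = {}" using p(1) FG by (auto simp: gpath_append)
    have lh: "last G = ?v" "hd F = ?u" using FG by auto
    have "gpath X (F @ rev G)"
      using d FG(2-5) h lh adj_sym by (subst gpath_append) (auto simp: hd_rev)
    moreover have "hd (F @ rev G) = ?u" "last (F @ rev G) = p ! Suc t"
      using FG(2,3,5) lh by (auto simp: last_rev)
    moreover have "length (F @ rev G) = length p" "set (F @ rev G) = set p" using FG(1) by auto
    ultimately have "cyc X (F @ rev G) \<and> set p \<subseteq> set (F @ rev G)"
      using p h adj_sym by (simp add: cyc_def)
    then show False using no by blast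
  qed
  have "card (nb ?v \<inter> set p) = card {t. Suc t < length p \<and> adj ?v (p ! t)}"
  proof -
    have "\<not> adj ?v (p ! (length p - 1))" using ne adj_irrefl by (simp add: last_conv_nth)
    from not_last_index[of "\<lambda>t. adj ?v (p ! t)", OF this] show ?thesis
      by (simp add: card_nb_list[OF dp(1)])
  qed
  moreover have "card (nb ?u \<inter> set p) \<le> card {t. Suc t < length p \<and> adj ?u (p ! Suc t)}"
    using card_shift_le[of "length p" "\<lambda>t. adj ?u (p ! t)"] ne adj_irrefl
    by (auto simp: card_nb_list[OF dp(1)] hd_conv_nth split: if_splits)
  moreover have "card {t. Suc t < length p \<and> adj ?v (p ! t)} + card {t. Suc t < length p \<and> adj ?u (p ! Suc t)}
      \<le> length p - 1"
    by (rule card_no_consecutive[of "length p" "\<lambda>t. adj ?v (p ! t)" "\<lambda>t. adj ?u (p ! t)"]) (rule cr)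
  ultimately have 1: "card (nb ?v \<inter> set p) + card (nb ?u \<inter> set p) \<le> length p - 1" by linarith
  have 2: "card (nb ?u \<inter> (X - set p)) + card (nb ?v \<inter> (X - set p)) \<le> card X - length p"
  proof -
    have "card (nb ?u \<inter> (X - set p)) + card (nb ?v \<inter> (X - set p))
      = card (nb ?u \<inter> (X - set p) \<union> nb ?v \<inter> (X - set p))"
      using fin out by (intro card_Un_disjoint[symmetric]) auto
    also have "\<dots> \<le> card (X - set p)" using fin by (intro card_mono) auto
    also have "\<dots> = card X - length p" using dp fin by (simp add: card_Diff_subset distinct_card)
    finally show ?thesis .
  qed
  have 3: "card (nb z \<inter> X) = card (nb z \<inter> set p) + card (nb z \<inter> (X - set p))" for z
  proof -
    have "nb z \<inter> X = (nb z \<inter> set p) \<union> (nb z \<inter> (X - set p))" using dp by auto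
    moreover have "card ((nb z \<inter> set p) \<union> (nb z \<inter> (X - set p)))
        = card (nb z \<inter> set p) + card (nb z \<inter> (X - set p))"
      using fin by (intro card_Un_disjoint) auto
    ultimately show ?thesis by simp
  qed
  have "length p \<le> card X" using gpath_length[OF fin p(1)] .
  then show False using deg 1 2 3[of ?u] 3[of ?v] p(2) by linarith
qed

text \<open>Only vertices outside \<open>M\<close> are cut off; the new ends lie in
  \<open>M\<close>, where a degree bound is available.\<close>

lemma trim:
  assumes "gpath X p" "set p \<inter> M \<noteq> {}"
  obtains q where "gpath X q" "hd q \<in> M" "last q \<in> M" "set q \<inter> M = set p \<inter> M"
proof -
  have half: "\<exists>q. gpath X q \<and> hd q \<in> M \<and> last q = last p \<and> set q \<inter> M = set p \<inter> M"
    if p: "gpath X p" "set p \<inter> M \<noteq> {}" for p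
  proof -
    have "\<exists>x\<in>set p. x \<in> M" using p by auto
    from split_list_first_prop[OF this]
    obtain as x bs where p2: "p = as @ x # bs" "x \<in> M" "\<forall>y\<in>set as. y \<notin> M" by blast
    have "gpath X (drop (length as) p)" using p(1) p2(1) by (intro gpath_dropI) auto
    then have "gpath X (x # bs)" by (simp add: p2(1))
    then show ?thesis using p2 by (intro exI[of _ "x # bs"]) auto
  qed
  obtain q where q: "gpath X q" "hd q \<in> M" "set q \<inter> M = set p \<inter> M"
    using half[OF assms] by blast
  have "gpath X (rev q)" "set (rev q) \<inter> M \<noteq> {}" using q assms by auto
  from half[OF this] obtain q' where q': "gpath X q'" "hd q' \<in> M" "last q' = last (rev q)"
    "set q' \<inter> M = set (rev q) \<inter> M" by blast
  then show ?thesis using q gpath_ne[OF q(1)] by (intro that[of q']) (auto simp: last_rev)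
qed

text \<open>A path with the most vertices of \<open>M\<close> misses none. A missing
  \<open>x\<close> would share a neighbour \<open>w\<close> with an end of the path;
  \<open>w\<close> lies on the path, and the cycle closing the path, opened at \<open>w\<close>,
  could be prolonged by \<open>x\<close>.\<close>

lemma cycle_through:
  assumes fin: "finite X" and M: "M \<subseteq> X" "2 \<le> card M"
    and deg: "\<And>u. u \<in> M \<Longrightarrow> card X \<le> 2 * card (nb u \<inter> X)"
  obtains cs where "cyc X cs" "M \<subseteq> set cs"
proof -
  have finM: "finite M" using fin M finite_subset by blast
  obtain m0 where m0: "m0 \<in> M" using M by fastforce
  let ?f = "\<lambda>q. card (set q \<inter> M)"
  have "gpath X [m0]" using m0 M by auto
  moreover have "\<forall>q. gpath X q \<longrightarrow> ?f q < Suc (card M)"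
    using finM by (auto simp: less_Suc_eq_le intro: card_mono)
  ultimately obtain p0 where p0: "gpath X p0" and pmax: "\<And>q. gpath X q \<Longrightarrow> ?f q \<le> ?f p0"
    using ex_has_greatest_nat[of "gpath X" _ ?f] by blast
  have "?f [m0] \<le> ?f p0" by (rule pmax) fact
  then have "set p0 \<inter> M \<noteq> {}" using m0 by auto
  then obtain p where p: "gpath X p" "hd p \<in> M" "last p \<in> M" "set p \<inter> M = set p0 \<inter> M"
    using trim[OF p0] by metis
  have pne: "p \<noteq> []" using p gpath_ne by auto
  have better: False if q: "gpath X q" "insert x (set p \<inter> M) \<subseteq> set q" "x \<in> M" "x \<notin> set p" for q x
  proof -
    have "Suc (?f p) = card (insert x (set p \<inter> M))" using q finM by simp
    also have "\<dots> \<le> ?f q" using q finM by (intro card_mono) auto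
    finally show False using pmax[OF q(1)] p(4) by simp
  qed
  have closed: "\<exists>cs. cyc X cs \<and> set p \<subseteq> set cs" if "2 \<le> length p"
  proof (rule close_path[OF fin p(1) that])
    show "card X \<le> card (nb (hd p) \<inter> X) + card (nb (last p) \<inter> X)"
      using deg[OF p(2)] deg[OF p(3)] by linarith
  qed
  have MP: "M \<subseteq> set p"
  proof (rule ccontr)
    assume "\<not> M \<subseteq> set p"
    then obtain x where x: "x \<in> M" "x \<notin> set p" by auto
    let ?u = "hd p"
    have u: "?u \<in> set p" "?u \<in> X" "x \<in> X" "x \<noteq> ?u" using pne x p(2) M by auto
    have nxu: "\<not> adj x ?u"
    proof
      assume "adj x ?u"
      then have "gpath X ([x] @ p)" using x u p pne by (subst gpath_append) auto
      then show False by (rule better[OF _ _ x]) auto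
    qed
    have "\<exists>w\<in>X. adj x w \<and> adj ?u w"
    proof (rule ccontr)
      assume "\<not> ?thesis"
      then have "nb x \<inter> X \<inter> (nb ?u \<inter> X) = {}" by auto
      then have "card (nb x \<inter> X) + card (nb ?u \<inter> X) = card (nb x \<inter> X \<union> nb ?u \<inter> X)"
        using fin by (intro card_Un_disjoint[symmetric]) auto
      also have "\<dots> \<le> card (X - {x, ?u})"
        using nxu adj_sym adj_irrefl fin by (intro card_mono) auto
      also have "\<dots> < card X" using u fin by (intro psubset_card_mono) auto
      finally show False using deg[OF x(1)] deg[OF p(2)] by linarith
    qed
    then obtain w where w: "w \<in> X" "adj x w" "adj ?u w" by blast
    have wp: "w \<in> set p"
    proof (rule ccontr)
      assume wn: "w \<notin> set p"
      have "x \<noteq> w" using w adj_irrefl by auto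
      then have "gpath X ([x] @ [w] @ p)" using wn w x u p pne adj_sym by (subst gpath_append3) auto
      then show False by (rule better[OF _ _ x]) auto
    qed
    have "w \<noteq> ?u" using w adj_irrefl by auto
    then have "2 \<le> length p" using wp pne by (cases p; cases "tl p") auto
    then obtain cs where cs: "cyc X cs" "set p \<subseteq> set cs" using closed by blast
    show False
    proof (cases "x \<in> set cs")
      case True
      then show False using cs by (intro better[OF _ _ x, of cs]) (auto simp: cyc_def)
    next
      case False
      obtain q where q: "gpath X q" "hd q = w" "set q = set cs"
        using cyc_path_from[OF cs(1)] cs(2) wp by blast
      have "gpath X ([x] @ q)"
        using q False w u gpath_ne[OF q(1)] by (subst gpath_append) auto
      then show False using q cs by (intro better[OF _ _ x, of "[x] @ q"]) auto
    qed
  qed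
  have "card M \<le> length p"
    using card_mono[OF _ MP] card_length[of p] by simp
  then obtain cs where "cyc X cs" "set p \<subseteq> set cs" using closed M by auto
  then show ?thesis using MP that by blast
qed

end

section \<open>Odd distance: windows on cycles\<close>

context lks
begin

text \<open>Otherwise \<open>L\<close> sends at least \<open>k\<close> edges per vertex to
  \<open>V - L\<close>, which is no larger and receives at most \<open>k - 1\<close> per
  vertex.\<close>

lemma LL_edge: "\<exists>u\<in>L. \<exists>v\<in>L. adj u v"
proof (rule ccontr)
  assume no: "\<not> ?thesis"
  have "k * card L \<le> (\<Sum>u\<in>L. card (nb u \<inter> (V - L)))"
  proof -
    have "card (nb u \<inter> (V - L)) \<ge> k" if "u \<in> L" for u
    proof -
      have "nb u \<inter> (V - L) = nb u" using no that nbV by (auto intro: adjV2)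
      then show ?thesis using Ldeg[OF that] by simp
    qed
    then have "(\<Sum>u\<in>L. k) \<le> (\<Sum>u\<in>L. card (nb u \<inter> (V - L)))" by (intro sum_mono) auto
    then show ?thesis by (simp add: mult.commute)
  qed
  also have "\<dots> = (\<Sum>s\<in>V - L. card (nb s \<inter> L))"
    using finV by (intro double_count) auto
  also have "\<dots> \<le> (\<Sum>s\<in>V - L. k - 1)"
  proof (intro sum_mono)
    fix s assume "s \<in> V - L"
    moreover have "card (nb s \<inter> L) \<le> card (nb s)" by (intro card_mono) auto
    ultimately show "card (nb s \<inter> L) \<le> k - 1" using Sdeg[of s] by simp
  qed
  also have "\<dots> = (k - 1) * card (V - L)" by simp
  also have "\<dots> \<le> (k - 1) * card L" using half by simp
  finally have "k \<le> k - 1" using Lne by (simp add: card_gt_0_iff)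
  then show False using k_pos by simp
qed

text \<open>One of the vertices \<open>c\<close> places after the two consecutive ones is in
  \<open>L\<close>, because two neighbours cannot both be outside. Rotation moves this pair to the
  positions wanted.\<close>

lemma cyc_spine:
  assumes cs: "cyc V cs" and len: "a + c + e < length cs"
    and LL: "cs ! (i mod length cs) \<in> L" "cs ! (Suc i mod length cs) \<in> L"
  shows "spine a c e"
proof -
  let ?N = "length cs"
  define \<sigma> where "\<sigma> j \<longleftrightarrow> cs ! (j mod ?N) \<in> L" for j
  have one: "\<sigma> j \<or> \<sigma> (Suc j)" for j
  proof -
    have "j mod ?N < ?N" using len by (intro mod_less_divisor) linarith
    from cyc_adj[OF cs this] show ?thesis using indep by (auto simp: \<sigma>_def mod_Suc_eq)
  qed
  have "\<exists>j. \<sigma> j \<and> \<sigma> (j + c)"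
  proof (cases "\<sigma> (i + c)")
    case True
    then show ?thesis using LL by (auto simp: \<sigma>_def)
  next
    case False
    then have "\<sigma> (Suc i + c)" using one[of "i + c"] by simp
    then show ?thesis using LL by (auto simp: \<sigma>_def)
  qed
  then obtain j where j: "\<sigma> j" "\<sigma> (j + c)" by blast
  \<comment> \<open>Modulo the length, \<open>(?N - 1) * a\<close> is \<open>- a\<close>; rotating
    by \<open>m\<close> brings position \<open>j\<close> to position \<open>a\<close> without
    subtraction.\<close>
  define m where "m = j + (?N - 1) * a"
  have mod: "(m + a + x) mod ?N = (j + x) mod ?N" for x
  proof -
    have eq: "m + a + x = (j + x) + ?N * a"
      using len by (cases ?N) (auto simp: m_def algebra_simps)
    show ?thesis unfolding eq by (rule mod_mult_self2)
  qed
  let ?r = "rotate m cs"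
  have "gpath V ?r" using cyc_rotate[OF cs] by (simp add: cyc_def)
  moreover have "?r ! a = cs ! (j mod ?N)"
    using nth_rotate[of a cs m] len mod[of 0] by (simp add: add.commute)
  moreover have "?r ! (a + c) = cs ! ((j + c) mod ?N)"
    using nth_rotate[of "a + c" cs m] len mod[of c] by (simp add: add.assoc)
  ultimately show ?thesis using j len
    by (intro spineI[of ?r a a]) (auto simp: \<sigma>_def)
qed

end

lemma card_even_less: "card {i. i < 2 * m \<and> even (i::nat)} = m"
proof -
  have "{i. i < 2 * m \<and> even i} = (*) 2 ` {..<m}" by auto
  moreover have "inj_on ((*) 2) {..<m}" by (auto simp: inj_on_def)
  ultimately show ?thesis by (simp add: card_image)
qed

lemma card_indices:
  assumes "distinct xs" "M \<subseteq> set xs"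
  shows "card M = card {i. i < length xs \<and> xs ! i \<in> M}"
proof -
  have "M = (!) xs ` {i. i < length xs \<and> xs ! i \<in> M}"
    using assms(2) by (auto simp: in_set_conv_nth) (metis (mono_tags, lifting) image_eqI in_set_conv_nth mem_Collect_eq subsetD)
  moreover have "inj_on ((!) xs) {i. i < length xs \<and> xs ! i \<in> M}"
    using assms(1) by (auto simp: inj_on_def nth_eq_iff_index_eq)
  ultimately show ?thesis by (metis card_image)
qed

context lks
begin

lemma cardV_le: "card V \<le> 2 * card L"
  using half card_Diff_subset[of L V] LV card_mono[OF finV LV] by simp

lemma k_less: "k < card V"
proof -
  obtain u where u: "u \<in> L" using Lne by auto
  have "k \<le> card (nb u)" using Ldeg u by simp
  also have "\<dots> \<le> card (V - {u})" using nbV adj_irrefl finV by (intro card_mono) auto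
  also have "\<dots> < card V" using u LV finV by (intro psubset_card_mono) auto
  finally show ?thesis .
qed

text \<open>Two consecutive vertices in \<open>L\<close> have disjoint neighbourhoods outside a longest cycle.\<close>

lemma long_cycle:
  assumes cs: "cyc V cs" "L \<subseteq> set cs" and max: "\<And>cs'. cyc V cs' \<Longrightarrow> L \<subseteq> set cs' \<Longrightarrow> length cs' \<le> length cs"
    and LL: "i < length cs" "cs ! i \<in> L" "cs ! (Suc i mod length cs) \<in> L"
  shows "2 * k + 2 \<le> card V + length cs"
proof -
  let ?N = "length cs"
  \<comment> \<open>The two consecutive vertices of \<open>L\<close> become the last and the first
    one, so a common neighbour off the cycle could be appended.\<close>
  define r where "r = rotate (Suc i) cs"
  have r: "cyc V r" "set r = set cs" "length r = ?N" using cyc_rotate[OF cs(1), of "Suc i"] by (auto simp: r_def)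
  have ne: "r \<noteq> []" using r LL by auto
  have dr: "distinct r" "set r \<subseteq> V" using r by (auto simp: cyc_def gpath_def)
  have hl: "hd r = cs ! (Suc i mod ?N)" "last r = cs ! i"
  proof -
    show "hd r = cs ! (Suc i mod ?N)"
      using ne LL nth_rotate[of 0 cs "Suc i"] by (simp add: hd_conv_nth r_def)
    have "Suc i + (?N - 1) = i + ?N" using LL by simp
    then have "(Suc i + (?N - 1)) mod ?N = i" using LL by simp
    moreover have "?N - 1 < ?N" using LL by simp
    ultimately show "last r = cs ! i"
      using ne r(3) nth_rotate[of "?N - 1" cs "Suc i"] by (simp add: last_conv_nth r_def)
  qed
  let ?u = "hd r" and ?v = "last r"
  have dis: "(nb ?u - set r) \<inter> (nb ?v - set r) = {}"
  proof (rule ccontr)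
    assume "\<not> ?thesis"
    then obtain w where w: "w \<notin> set r" "w \<in> nb ?u" "w \<in> nb ?v" by blast
    have "gpath V (r @ [w])"
      using w r(1) ne adjV2[of ?u w] by (subst gpath_append) (auto simp: cyc_def)
    then have "cyc V (r @ [w])" using w ne r(1) adj_sym by (auto simp: cyc_def)
    from max[OF this] show False using cs r by auto
  qed
  have deg: "k + 1 \<le> card (nb z - set r) + ?N" if z: "z \<in> set r" "z \<in> L" for z
  proof -
    have "card (nb z \<inter> set r) \<le> card (set r - {z})"
      using adj_irrefl by (intro card_mono) auto
    also have "\<dots> = ?N - 1" using z distinct_card[OF dr(1)] r(3) by simp
    finally have "card (nb z \<inter> set r) \<le> ?N - 1" .
    moreover have "card (nb z - set r) = card (nb z) - card (nb z \<inter> set r)"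
      by (simp add: card_Diff_subset_Int)
    ultimately show ?thesis using Ldeg[OF z(2)] LL(1) by linarith
  qed
  have "card (nb ?u - set r) + card (nb ?v - set r) = card ((nb ?u - set r) \<union> (nb ?v - set r))"
    using dis by (intro card_Un_disjoint[symmetric]) auto
  also have "\<dots> \<le> card (V - set r)" using finV by (intro card_mono) (auto intro: adjV2)
  also have "\<dots> = card V - ?N" using dr distinct_card[OF dr(1)] r(3) finV by (simp add: card_Diff_subset)
  finally have 1: "card (nb ?u - set r) + card (nb ?v - set r) \<le> card V - ?N" .
  have "?N \<le> card V" using gpath_length[OF finV, of r] r by (simp add: cyc_def)
  moreover have "?u \<in> set r" "?v \<in> set r" using ne by auto
  ultimately show ?thesis using 1 deg[of ?u] deg[of ?v] hl LL by simp
qed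

text \<open>Strict alternation makes \<open>L\<close> exactly half of the cycle; since
  \<open>card V \<le> 2 * card L\<close>, the cycle passes through every vertex.\<close>

lemma cyc_alternating:
  assumes cs: "cyc V cs" "L \<subseteq> set cs" and h: "cs ! 0 \<in> L"
    and noLL: "\<And>i. i < length cs \<Longrightarrow> \<not> (cs ! i \<in> L \<and> cs ! (Suc i mod length cs) \<in> L)"
  shows "even (length cs)" "length cs = card V" "i < length cs \<Longrightarrow> cs ! i \<in> L \<longleftrightarrow> even i"
proof -
  let ?N = "length cs"
  have N2: "2 \<le> ?N" using cs by (simp add: cyc_def)
  have step: "cs ! (Suc i mod ?N) \<in> L \<longleftrightarrow> cs ! i \<notin> L" if "i < ?N" for i
    using noLL[OF that] indep[OF cyc_adj[OF cs(1) that]] by auto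
  have alt: "i < ?N \<Longrightarrow> cs ! i \<in> L \<longleftrightarrow> even i" for i
  proof (induction i)
    case 0
    then show ?case using h by simp
  next
    case (Suc i)
    then show ?case using step[of i] by simp
  qed
  show ev: "even ?N"
  proof -
    obtain N' where N': "?N = Suc N'" using N2 by (cases ?N) auto
    have "cs ! 0 \<in> L \<longleftrightarrow> cs ! N' \<notin> L" using step[of N'] N' by simp
    then show ?thesis using h alt[of N'] N' by simp
  qed
  then obtain m where m: "?N = 2 * m" by (auto elim: evenE)
  have d: "distinct cs" "set cs \<subseteq> V" using cs by (auto simp: cyc_def gpath_def)
  have "card L = card {i. i < 2 * m \<and> even i}"
    using card_indices[OF d(1) cs(2)] alt m by (auto intro!: arg_cong[of _ _ card])
  then have "card L = m" by (simp add: card_even_less)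
  then show "?N = card V" using cardV_le gpath_length[OF finV, of cs] cs m by (simp add: cyc_def)
  show "i < ?N \<Longrightarrow> cs ! i \<in> L \<longleftrightarrow> even i" by (rule alt)
qed

section \<open>A chord inside \<open>L\<close> of an alternating Hamiltonian cycle\<close>

context
  fixes cs j
  assumes cs: "cyc V cs" and N: "even (length cs)" "length cs = card V"
    and alt: "\<And>i. i < length cs \<Longrightarrow> cs ! i \<in> L \<longleftrightarrow> even i"
    and j: "even j" "0 < j" "j < length cs" "adj (cs ! 0) (cs ! j)"
begin

lemma hd_in_L: "cs ! 0 \<in> L"
proof -
  have "0 < length cs" using j by linarith
  from alt[OF this] show ?thesis by simp
qed

text \<open>The path \<open>cs ! 1, \<dots>, cs ! j, cs ! 0\<close>, and then backwards from the
  last vertex to \<open>cs ! Suc j\<close>, uses the chord once. It meets \<open>L\<close> at the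
  odd positions before \<open>j\<close> and at the even positions from \<open>j\<close> on, so an
  odd window across this seam can have both ends in \<open>L\<close>.\<close>

lemma chord_path:
  assumes c: "odd c" and a: "a < j" "j + e < length cs" and acn: "a + c + e + 1 < length cs"
  shows "spine a c e"
proof -
  let ?N = "length cs"
  have gp: "gpath V cs" and d: "distinct cs" using cs by (auto simp: cyc_def gpath_def)
  have jN: "Suc j < ?N" using j N by (metis Suc_lessI even_Suc)
  let ?A = "take j (drop 1 cs)" and ?B = "[cs ! 0]" and ?C = "rev (drop (Suc j) cs)"
  have lA: "length ?A = j" and lC: "length ?C = ?N - Suc j" using j by auto
  have ne: "?A \<noteq> []" "?B \<noteq> []" "?C \<noteq> []" using j jN by auto
  have gA: "gpath V ?A" using j by (intro gpath_takeI gpath_dropI gp) auto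
  have gC: "gpath V ?C" using jN gpath_dropI[OF gp, of "Suc j"] by simp
  have gB: "gpath V ?B" using gp j by (auto simp: gpath_def)
  have lastA: "last ?A = cs ! j"
    using ne(1) lA j by (simp add: last_conv_nth)
  have hdC: "hd ?C = last cs" using jN by (simp add: hd_rev)
  have h0: "hd cs = cs ! 0" using gpath_ne[OF gp] by (simp add: hd_conv_nth)
  have cs0: "cs = cs ! 0 # drop 1 cs" using j by (cases cs) auto
  have dd: "cs ! 0 \<notin> set (drop 1 cs)" "distinct (drop 1 cs)"
    using d cs0 by (metis distinct.simps(2))+
  have dj: "drop 1 cs = ?A @ drop (Suc j) cs"
    using append_take_drop_id[of j "drop 1 cs"] by (simp add: add.commute)
  have "set ?A \<inter> set (drop (Suc j) cs) = {}"
    using dd(2) dj by (metis distinct_append)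
  moreover have "cs ! 0 \<notin> set ?A" "cs ! 0 \<notin> set (drop (Suc j) cs)"
    using dd(1) dj by (metis Un_iff set_append)+
  ultimately have gx: "gpath V (?A @ ?B @ ?C)"
    using gA gB gC lastA hdC j(4) cs h0 adj_sym
    by (subst gpath_append3[OF ne]) (auto simp: cyc_def)
  let ?x = "?A @ ?B @ ?C"
  have lx: "length ?x = ?N" using lA lC jN by simp
  have x1: "?x ! t \<in> L \<longleftrightarrow> odd t" if t: "t < j" for t
  proof -
    have "?x ! t = cs ! Suc t" using t lA j by (simp add: nth_append)
    then show ?thesis using alt[of "Suc t"] t j by simp
  qed
  have x2: "?x ! t \<in> L \<longleftrightarrow> even t" if t: "j \<le> t" "t < ?N" for t
  proof (cases "t = j")
    case True
    have "?x ! t = cs ! 0" using True lA by (simp add: nth_append)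
    then show ?thesis using hd_in_L True j by simp
  next
    case False
    define q where "q = t - Suc j"
    have q: "t = Suc (j + q)" "q < ?N - Suc j" using False t by (auto simp: q_def)
    have "?x ! t = ?C ! q" using q(1) lA by (simp add: nth_append)
    also have "\<dots> = cs ! (?N - Suc q)" using q(2) by (simp add: rev_nth Suc_diff_Suc)
    finally have *: "?x ! t = cs ! (?N - Suc q)" .
    have "\<not> ?N < Suc q" "?N - Suc q < ?N" using q(2) by linarith+
    then show ?thesis
      using alt[of "?N - Suc q"] q(1) N(1) j(1) unfolding * by (simp add: even_diff_nat)
  qed
  \<comment> \<open>If the window from \<open>a\<close> ends by \<open>j\<close>, it is moved so as
    to end at \<open>j\<close>. Otherwise it starts at the first odd position from \<open>a\<close>
    on, and its end lies past the seam.\<close>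
  show ?thesis
  proof (cases "a + c \<le> j")
    case True
    have "spine a c e"
    proof (rule spineI[OF gx, of a "j - c"])
      have cj: "c \<le> j" "0 < c" using True c by (auto intro: odd_pos)
      then show "?x ! (j - c) \<in> L" using x1[of "j - c"] j(1,2) c by (simp add: even_diff_nat)
      show "?x ! (j - c + c) \<in> L" using x2[of j] j cj by simp
    qed (use True a lx in auto)
    then show ?thesis .
  next
    case False
    define t where "t = (if odd a then a else Suc a)"
    have t: "odd t" "a \<le> t" "t \<le> Suc a" "t < j"
      using a(1) j(1) by (auto simp: t_def) (metis Suc_lessI even_Suc)
    show ?thesis
    proof (rule spineI[OF gx, of a t])
      show "?x ! t \<in> L" using x1 t by simp
      have "t + c < ?N" using t acn by simp
      then show "?x ! (t + c) \<in> L" using x2[of "t + c"] t False c by simp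
      show "t + c + e < length ?x" using t acn lx by simp
    qed (use t in auto)
  qed
qed

text \<open>If neither orientation of \<open>chord_path\<close> fits, \<open>j\<close> is so large
  that the cycle \<open>cs ! 0, \<dots>, cs ! j\<close> closed by the chord has room for the spine.
  The ends of the chord are consecutive on it and both in \<open>L\<close>.\<close>

lemma chord_spine:
  assumes c: "odd c" "c \<le> l" "a + c + e + l = k" and lc: "card V div 2 \<le> l + c"
    and jn: "length cs \<le> 2 * j"
  shows "spine a c e"
proof -
  let ?N = "length cs"
  have c1: "1 \<le> c" using c by (simp add: Suc_leI odd_pos)
  have kN: "k < ?N" using k_less N by simp
  have acn: "a + c + e + 1 < ?N" using c kN c1 by linarith
  have N2: "?N \<le> 2 * l + 2 * c" using lc N by (auto elim!: evenE)
  have aj: "a < j" "e < j" using jn kN N2 c(3) by linarith+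
  show ?thesis
  proof (cases "j + e < ?N \<or> j + a < ?N")
    case True
    then show ?thesis
    proof
      assume "j + e < ?N"
      then show ?thesis using chord_path c(1) aj acn by blast
    next
      assume "j + a < ?N"
      then have "spine e c a" using chord_path[of c e a] c(1) aj acn by (simp add: add.commute add.left_commute)
      then show ?thesis by (rule spine_rev)
    qed
  next
    case False
    let ?r = "take (Suc j) cs"
    have lr: "length ?r = Suc j" using j by simp
    have gp: "gpath V cs" using cs by (simp add: cyc_def)
    have "cyc V ?r"
    proof -
      have "last ?r = cs ! j" using j by (simp add: take_Suc_conv_app_nth)
      moreover have "hd ?r = cs ! 0" using j by (cases cs) auto
      ultimately show ?thesis using gpath_takeI[OF gp, of "Suc j"] lr j adj_sym by (simp add: cyc_def)
    qed
    \<comment> \<open>With \<open>?N \<le> 2 * (l + c) \<le> 4 * l\<close>, the spine has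
      \<open>k - l < 3 * ?N / 4\<close> edges, and \<open>a + e = k - (l + c) < ?N / 2\<close>, so
      the smaller arm is below \<open>?N / 4\<close> and \<open>j > 3 * ?N / 4\<close>.\<close>
    moreover have "a + c + e < length ?r" using False lr c N2 kN by linarith
    moreover have "?r ! (j mod length ?r) \<in> L" "?r ! (Suc j mod length ?r) \<in> L"
      using alt[of j] hd_in_L j lr by auto
    ultimately show ?thesis by (rule cyc_spine)
  qed
qed

end

lemma spine_odd_dense:
  assumes c: "odd c" "c \<le> l" "a + c + e + l = k" and lc: "card V div 2 \<le> l + c"
    and n: "card V \<le> 2 * k"
  shows "spine a c e"
proof -
  have c1: "1 \<le> c" using c by (simp add: Suc_leI odd_pos)
  have L2: "2 \<le> card L" using cardV_le k_less c c1 by linarith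
  have "\<exists>cs. cyc V cs \<and> L \<subseteq> set cs"
  proof (rule cycle_through[OF finV LV L2])
    show "card V \<le> 2 * card (nb u \<inter> V)" if "u \<in> L" for u
    proof -
      have "nb u \<inter> V = nb u" using nbV[of u] by auto
      then show ?thesis using Ldeg[OF that] n by simp
    qed
  qed blast
  then obtain cs0 where cs0: "cyc V cs0 \<and> L \<subseteq> set cs0" by blast
  have "\<forall>q. cyc V q \<and> L \<subseteq> set q \<longrightarrow> length q < Suc (card V)"
    using gpath_length[OF finV] by (auto simp: cyc_def less_Suc_eq_le)
  from ex_has_greatest_nat[of "\<lambda>q. cyc V q \<and> L \<subseteq> set q" cs0 length, OF cs0 this]
  obtain cs where cs: "cyc V cs" "L \<subseteq> set cs"
    and max: "\<And>q. cyc V q \<Longrightarrow> L \<subseteq> set q \<Longrightarrow> length q \<le> length cs" by blast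
  let ?N = "length cs"
  have N2: "2 \<le> ?N" using cs by (simp add: cyc_def)
  show ?thesis
  proof (cases "\<exists>i<?N. cs ! i \<in> L \<and> cs ! (Suc i mod ?N) \<in> L")
    case True
    then obtain i where i: "i < ?N" "cs ! i \<in> L" "cs ! (Suc i mod ?N) \<in> L" by blast
    have 1: "2 * k + 2 \<le> card V + ?N" by (rule long_cycle[OF cs max i])
    have 2: "card L \<le> ?N" using card_mono[OF _ cs(2)] card_length[of cs] by simp
    have "a + c + e < ?N" using 1 2 cardV_le c lc by linarith
    then show ?thesis using cyc_spine[OF cs(1), of a c e i] i by simp
  next
    case False
    obtain u v where uv: "u \<in> L" "v \<in> L" "adj u v" using LL_edge by blast
    obtain iu where iu: "iu < ?N" "u = cs ! iu" using uv cs(2) by (metis in_set_conv_nth subsetD)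
    \<comment> \<open>The edge inside \<open>L\<close> serves as the chord from position
      \<open>0\<close>; \<open>jn\<close> demands that its other end be at least half the cycle away
      in the direction of \<open>r\<close>.\<close>
    have main: ?thesis if r: "cyc V r" "L \<subseteq> set r" "length r = ?N" "r ! 0 \<in> L"
      and noLL: "\<And>i. i < ?N \<Longrightarrow> \<not> (r ! i \<in> L \<and> r ! (Suc i mod ?N) \<in> L)"
      and w: "w \<in> L" "adj (r ! 0) w" and jn: "\<And>j. j < ?N \<Longrightarrow> r ! j = w \<Longrightarrow> ?N \<le> 2 * j" for r w
    proof -
      obtain j where j: "j < ?N" "r ! j = w" using w(1) r by (metis in_set_conv_nth subsetD)
      have noLL': "\<not> (r ! i \<in> L \<and> r ! (Suc i mod length r) \<in> L)" if "i < length r" for i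
        using noLL[of i] that r(3) by simp
      have al: "even ?N" "?N = card V" "i < ?N \<Longrightarrow> r ! i \<in> L \<longleftrightarrow> even i" for i
        using cyc_alternating(1)[OF r(1,2,4) noLL'] cyc_alternating(2)[OF r(1,2,4) noLL']
          cyc_alternating(3)[OF r(1,2,4) noLL', of i] unfolding r(3) by blast+
      have "even j" using al(3)[OF j(1)] j w by simp
      moreover have "0 < j" using j w adj_irrefl by (cases j) auto
      ultimately show ?thesis
        using chord_spine[of r j, OF r(1), unfolded r(3), OF al(1,2,3) _ _ j(1) _ c lc] jn[OF j] j w
        by blast
    qed
    have rot: "cyc V (rotate m cs)" "L \<subseteq> set (rotate m cs)" "length (rotate m cs) = ?N" for m
      using cyc_rotate[OF cs(1)] cs(2) by auto
    have noLL: "\<not> (rotate m cs ! i \<in> L \<and> rotate m cs ! (Suc i mod ?N) \<in> L)" if "i < ?N" for m i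
    proof -
      have "rotate m cs ! i = cs ! ((m + i) mod ?N)" using that by (simp add: nth_rotate)
      moreover have "rotate m cs ! (Suc i mod ?N) = cs ! (Suc ((m + i) mod ?N) mod ?N)"
      proof -
        have "Suc i mod ?N < ?N" using N2 by (intro mod_less_divisor) linarith
        from nth_rotate[OF this, of m] show ?thesis by (simp add: mod_simps)
      qed
      moreover have "(m + i) mod ?N < ?N" using N2 by (intro mod_less_divisor) linarith
      ultimately show ?thesis using False by auto
    qed
    obtain iv where iv: "iv < ?N" "v = cs ! iv" using uv cs(2) by (metis in_set_conv_nth subsetD)
    have dcs: "distinct cs" using cs by (auto simp: cyc_def gpath_def)
    have pos: "rotate p cs ! 0 = cs ! p" "\<And>j. j < ?N \<Longrightarrow> rotate p cs ! j = cs ! q \<Longrightarrow> (p + j) mod ?N = q"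
      if "p < ?N" "q < ?N" for p q
    proof -
      have "0 < ?N" using that by linarith
      from nth_rotate[OF this, of p] show "rotate p cs ! 0 = cs ! p" using that by simp
      show "(p + j) mod ?N = q" if "j < ?N" "rotate p cs ! j = cs ! q" for j
        using that nth_rotate[of j cs p] dcs \<open>q < ?N\<close> N2
        by (metis bot_nat_0.extremum_strict mod_less_divisor neq0_conv nth_eq_iff_index_eq)
    qed
    have dist: "(p + j) mod ?N = q \<Longrightarrow> j < ?N \<Longrightarrow> p < ?N \<Longrightarrow> q < ?N \<Longrightarrow> p + j = q \<or> p + j = q + ?N" for p q j
      by (cases "p + j < ?N") (auto simp: le_mod_geq not_less)
    \<comment> \<open>The two arcs between \<open>u\<close> and \<open>v\<close> add up to the whole
      cycle, so one of them covers at least half of it.\<close>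
    consider "\<And>j. j < ?N \<Longrightarrow> (iu + j) mod ?N = iv \<Longrightarrow> ?N \<le> 2 * j"
      | "\<And>j. j < ?N \<Longrightarrow> (iv + j) mod ?N = iu \<Longrightarrow> ?N \<le> 2 * j"
    proof -
      have "(\<forall>j<?N. (iu + j) mod ?N = iv \<longrightarrow> ?N \<le> 2 * j) \<or> (\<forall>j<?N. (iv + j) mod ?N = iu \<longrightarrow> ?N \<le> 2 * j)"
      proof (rule ccontr)
        assume "\<not> ?thesis"
        then obtain j j' where "j < ?N" "(iu + j) mod ?N = iv" "2 * j < ?N"
          "j' < ?N" "(iv + j') mod ?N = iu" "2 * j' < ?N" by (auto simp: not_le)
        moreover have "iu \<noteq> iv" using iu iv uv adj_irrefl by auto
        ultimately show False using dist[of iu j iv] dist[of iv j' iu] iu iv by linarith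
      qed
      then show ?thesis using that by blast
    qed
    then show ?thesis
    proof cases
      case 1
      show ?thesis
      proof (rule main[OF rot, of iu v])
        show "rotate iu cs ! 0 \<in> L" "adj (rotate iu cs ! 0) v" using pos(1)[OF iu(1) iv(1)] iu uv by auto
        show "?N \<le> 2 * j" if "j < ?N" "rotate iu cs ! j = v" for j
          using 1 pos(2)[OF iu(1) iv(1), of j] that iv by simp
      qed (use noLL uv in auto)
    next
      case 2
      show ?thesis
      proof (rule main[OF rot, of iv u])
        show "rotate iv cs ! 0 \<in> L" "adj (rotate iv cs ! 0) u"
          using pos(1)[OF iv(1) iu(1)] iv uv adj_sym by auto
        show "?N \<le> 2 * j" if "j < ?N" "rotate iv cs ! j = u" for j
          using 2 pos(2)[OF iv(1) iu(1), of j] that iu by simp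
      qed (use noLL uv in auto)
    qed
  qed
qed

end

section \<open>Odd distance in the tight case, and the choice between the cases\<close>

context lks
begin

text \<open>The dummy vertex \<open>None\<close>, adjacent to everything, raises all degrees by one, so that
  a cycle through \<open>L\<close> exists in the extended graph; deleting \<open>None\<close> leaves a path.\<close>

lemma path_through:
  assumes n: "card V \<le> 2 * k + 1"
  obtains zs where "gpath V zs" "L \<subseteq> set zs"
proof -
  define adj' where "adj' x y = (case x of None \<Rightarrow> (case y of None \<Rightarrow> False | Some v \<Rightarrow> v \<in> V)
    | Some u \<Rightarrow> (case y of None \<Rightarrow> u \<in> V | Some v \<Rightarrow> adj u v))" for x y
  interpret o: sym_graph adj'
    by unfold_locales (auto simp: adj'_def adj_sym adj_irrefl split: option.splits)
  let ?X = "insert None (Some ` V)" and ?M = "insert None (Some ` L)"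
  have cX: "card ?X = Suc (card V)" using finV by (simp add: card_image)
  have cM: "card ?M = Suc (card L)" by (simp add: card_image)
  obtain cs where cs: "o.cyc ?X cs" "?M \<subseteq> set cs"
  proof (rule o.cycle_through[of ?X ?M])
    have "card L > 0" using Lne by (simp add: card_gt_0_iff)
    then show "2 \<le> card ?M" using cM by simp
    show "card ?X \<le> 2 * card (o.nb u \<inter> ?X)" if u: "u \<in> ?M" for u
    proof (cases u)
      case None
      have "o.nb None \<inter> ?X = Some ` V" by (auto simp: adj'_def)
      then show ?thesis using None cX k_less by (simp add: card_image)
    next
      case (Some w)
      then have w: "w \<in> L" using u by auto
      have "o.nb (Some w) \<inter> ?X = insert None (Some ` nb w)"
        using w LV by (auto simp: adj'_def image_iff intro: adjV2)
      then have "card (o.nb u \<inter> ?X) = Suc (card (nb w))" using Some by (simp add: card_image)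
      then show ?thesis using Ldeg[OF w] cX n by simp
    qed
  qed (use finV LV in auto)
  obtain q where q: "o.gpath ?X q" "hd q = None" "set q = set cs"
    using o.cyc_path_from[OF cs(1)] cs(2) by blast
  obtain q' where q': "q = None # q'" using q o.gpath_ne[OF q(1)] by (cases q) auto
  have d: "distinct q'" "None \<notin> set q'" "set q' \<subseteq> ?X" using q(1) by (auto simp: q' o.gpath_def)
  define zs where "zs = map the q'"
  have q'zs: "q' = map Some zs"
    using d(2) by (auto simp: zs_def map_idI intro!: nth_equalityI) (metis not_None_eq nth_mem option.sel)
  have L: "L \<subseteq> set zs"
  proof
    fix x assume "x \<in> L"
    then have "Some x \<in> set q" using cs(2) q(3) by auto
    then show "x \<in> set zs" by (auto simp: q' q'zs)
  qed
  have ne: "zs \<noteq> []" using L Lne by auto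
  have "successively adj' q'" using q(1) by (cases q') (auto simp: q' o.gpath_def)
  then have "successively adj zs" by (simp add: q'zs successively_map adj'_def)
  moreover have "distinct zs" using d(1) by (simp add: q'zs distinct_map)
  moreover have "set zs \<subseteq> V" using d(3) by (auto simp: q'zs)
  ultimately have "gpath V zs" using ne by (simp add: gpath_def)
  then show ?thesis using L that by blast
qed

text \<open>If the claim fails, the path through \<open>L\<close> alternates and begins in
  \<open>L\<close>, so an edge inside \<open>L\<close> joins two even positions. A long edge starts
  a path that runs back along \<open>zs\<close>; a short one is a shortcut, behind which the parity
  of \<open>L\<close> is reversed.\<close>

lemma spine_odd_tight:
  assumes c: "odd c" "c \<le> l" "c + l = k" and n: "card V = 2 * k + 1"
  shows "spine 0 c 0"
proof (rule ccontr)
  assume no: "\<not> spine 0 c 0"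
  have "card V \<le> 2 * k + 1" using n by simp
  then obtain zs where zs: "gpath V zs" "L \<subseteq> set zs" by (rule path_through)
  let ?N = "length zs"
  have d: "distinct zs" "set zs \<subseteq> V" using zs by (auto simp: gpath_def)
  have cL: "k + 1 \<le> card L" using cardV_le n by linarith
  have NL: "card L \<le> ?N" using card_mono[OF _ zs(2)] card_length[of zs] by simp
  \<comment> \<open>From \<open>k + 1 \<le> card L\<close> and \<open>2 * c \<le> k\<close>. For two
    consecutive positions there is thus always room for windows of length \<open>c\<close> on the
    left or on the right.\<close>
  have N: "2 * c + 1 \<le> ?N" using NL cL c by linarith
  have NV: "?N \<le> 2 * k + 1" using gpath_length[OF finV zs(1)] n by simp
  define \<sigma> where "\<sigma> i \<longleftrightarrow> zs ! i \<in> L" for i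
  have one: "\<sigma> i \<or> \<sigma> (Suc i)" if "Suc i < ?N" for i
    using path_indep[OF zs(1) that] by (simp add: \<sigma>_def)
  have two: "\<not> (\<sigma> t \<and> \<sigma> (t + c))" if "t + c < ?N" for t
    using spineI[OF zs(1), of 0 t c 0] that no by (auto simp: \<sigma>_def)
  have step: "\<sigma> (Suc t) \<longleftrightarrow> \<not> \<sigma> t" if t: "Suc t < ?N" for t
  proof -
    have "\<not> (\<sigma> t \<and> \<sigma> (Suc t))"
    proof
      assume s: "\<sigma> t \<and> \<sigma> (Suc t)"
      show False
      proof (cases "c \<le> t")
        case True
        then have "Suc (t - c) < ?N" using t by simp
        then show ?thesis using True two[of "t - c"] two[of "Suc (t - c)"] one[of "t - c"] s t
          by (simp add: Suc_diff_le)
      next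
        case False
        then show ?thesis using two[of t] two[of "Suc t"] one[of "t + c"] s N by simp
      qed
    qed
    then show ?thesis using one[OF t] by blast
  qed
  have alt: "i < ?N \<Longrightarrow> \<sigma> i \<longleftrightarrow> (\<sigma> 0 \<longleftrightarrow> even i)" for i
  proof (induction i)
    case 0
    then show ?case by simp
  next
    case (Suc i)
    then show ?case using step[of i] by auto
  qed
  have cnt: "card L = card {i. i < ?N \<and> \<sigma> i}" using card_indices[OF d(1) zs(2)] by (simp add: \<sigma>_def)
  \<comment> \<open>Otherwise \<open>L\<close> would occupy only odd positions among at most
    \<open>2 * k + 1\<close>, hence have at most \<open>k\<close> vertices.\<close>
  have s0: "\<sigma> 0"
  proof (rule ccontr)
    assume n0: "\<not> \<sigma> 0"
    have "{i. i < ?N \<and> \<sigma> i} \<subseteq> Suc ` {i. i < 2 * k \<and> even i}"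
    proof
      fix i assume "i \<in> {i. i < ?N \<and> \<sigma> i}"
      then have "i < 2 * k + 1" "odd i" using alt[of i] n0 NV by auto
      then show "i \<in> Suc ` {i. i < 2 * k \<and> even i}" by (cases i) auto
    qed
    then have "card {i. i < ?N \<and> \<sigma> i} \<le> card (Suc ` {i. i < 2 * k \<and> even i})"
      by (intro card_mono) auto
    also have "\<dots> = k" by (simp add: card_image card_even_less)
    finally show False using cnt cL by simp
  qed
  have alt': "i < ?N \<Longrightarrow> \<sigma> i \<longleftrightarrow> even i" for i using alt s0 by simp
  obtain u v where uv: "u \<in> L" "v \<in> L" "adj u v" using LL_edge by blast
  obtain iu iv where iuv: "iu < ?N" "u = zs ! iu" "iv < ?N" "v = zs ! iv"
    using uv zs(2) by (metis in_set_conv_nth subsetD)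
  have "iu \<noteq> iv" using iuv uv adj_irrefl by auto
  then obtain i j where ij: "i < j" "j < ?N" "adj (zs ! i) (zs ! j)" "\<sigma> i" "\<sigma> j"
  proof -
    assume *: thesis if "i < j" "j < ?N" "adj (zs ! i) (zs ! j)" "\<sigma> i" "\<sigma> j" for i j
    show thesis
    proof (cases "iu < iv")
      case True
      then show ?thesis using *[of iu iv] iuv uv by (simp add: \<sigma>_def)
    next
      case False
      then show ?thesis using *[of iv iu] iuv uv adj_sym \<open>iu \<noteq> iv\<close> by (simp add: \<sigma>_def)
    qed
  qed
  have ev: "even i" "even j" using ij alt' by auto
  have c1: "0 < c" using c(1) by (rule odd_pos)
  show False
  proof (cases "c \<le> j - i")
    case True
    \<comment> \<open>The edge from \<open>zs ! i\<close> to \<open>zs ! j\<close> and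
      \<open>c - 1\<close> steps back along \<open>zs\<close> form the spine. It ends at position
      \<open>j - c + 1\<close>, which is even because \<open>c\<close> is odd.\<close>
    have ci: "i < j - c + 1" "j - c + 1 \<le> j" using True c1 ij(1) by linarith+
    have g1: "gpath V (rev (take c (drop (j - c + 1) zs)))"
      using ci ij(2) c1 by (simp, intro gpath_takeI gpath_dropI zs(1)) auto
    let ?R = "rev (take c (drop (j - c + 1) zs))"
    have lR: "length ?R = c" using True ij c1 by simp
    have neR: "?R \<noteq> []" using lR c1 by (metis less_numeral_extra(3) list.size(3))
    have hR: "hd ?R = zs ! j"
    proof -
      let ?X = "take c (drop (j - c + 1) zs)"
      have lX: "length ?X = c" using lR by (simp only: length_rev)
      have "?X \<noteq> []" using neR by (simp only: rev_is_Nil_conv not_False_eq_True)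
      from last_conv_nth[OF this] have "hd ?R = ?X ! (c - 1)" unfolding lX hd_rev .
      also have "\<dots> = zs ! (j - c + 1 + (c - 1))"
        using c1 ci ij by (subst nth_take) (auto intro!: nth_drop)
      also have "j - c + 1 + (c - 1) = j" using True c1 ij by simp
      finally show ?thesis .
    qed
    have last: "last ?R = zs ! (j - c + 1)"
      using neR ci ij by (simp add: last_rev hd_drop_conv_nth)
    have "zs ! i \<notin> set ?R"
    proof
      assume "zs ! i \<in> set ?R"
      then have "zs ! i \<in> set (drop (j - c + 1) zs)" by (auto dest: in_set_takeD)
      then obtain t where "t < ?N - (j - c + 1)" "zs ! i = zs ! (j - c + 1 + t)"
        by (auto simp: in_set_conv_nth)
      then show False using d(1) ci ij by (auto simp: nth_eq_iff_index_eq)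
    qed
    then have g: "gpath V ([zs ! i] @ ?R)"
      using g1 neR hR ij d(2) by (subst gpath_append) (auto simp del: rev_take)
    have "odd (j - c)" using ev c(1) True by (simp add: even_diff_nat)
    then have "\<sigma> (j - c + 1)" using alt'[of "j - c + 1"] ci ij by simp
    then have "([zs ! i] @ ?R) ! (0 + c) \<in> L"
      using last lR neR c1 by (simp add: nth_Cons' last_conv_nth \<sigma>_def del: rev_take)
    then have "spine 0 c 0"
      using spineI[OF g, of 0 0 c 0] lR ij by (simp add: \<sigma>_def del: rev_take)
    then show False using no by simp
  next
    case False
    let ?x = "take (Suc i) zs @ drop j zs"
    have lt: "length (take (Suc i) zs) = Suc i" using ij by simp
    have lx: "length ?x = Suc i + (?N - j)" using ij by simp
    have ne: "take (Suc i) zs \<noteq> []" "drop j zs \<noteq> []" using ij by auto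
    have "set (take (Suc i) zs) \<inter> set (drop j zs) = {}"
      using ij d(1) by (intro set_take_disj_set_drop_if_distinct) auto
    moreover have "last (take (Suc i) zs) = zs ! i" "hd (drop j zs) = zs ! j"
      using ij by (auto simp: take_Suc_conv_app_nth hd_drop_conv_nth)
    ultimately have g: "gpath V ?x"
      using ij gpath_takeI[OF zs(1), of "Suc i"] gpath_dropI[OF zs(1) ij(2)]
      by (subst gpath_append[OF ne]) auto
    have x1: "?x ! t \<in> L" if "t \<le> i" "even t" for t
      using that alt'[of t] ij by (simp add: nth_append \<sigma>_def)
    have x2: "?x ! t \<in> L" if "i < t" "t < Suc i + (?N - j)" "odd t" for t
    proof -
      have "?x ! t = zs ! (j + (t - Suc i))" using that lt ij by (simp add: nth_append)
      moreover have "even (j + (t - Suc i))" using that ev by (simp add: even_diff_nat)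
      moreover have "j + (t - Suc i) < ?N" using that ij by simp
      ultimately show ?thesis using alt' by (simp add: \<sigma>_def)
    qed
    \<comment> \<open>Truncated subtraction: for \<open>c > Suc i\<close> the window starts at
      \<open>0\<close>. In both cases \<open>s\<close> is even and the window spans the shortcut, so
      its odd end \<open>s + c\<close> is in \<open>L\<close> as well.\<close>
    define s where "s = Suc i - c"
    have s: "s \<le> i" "even s" "i < s + c" "s + c < Suc i + (?N - j)"
    proof -
      show "s \<le> i" "i < s + c" using c1 by (auto simp: s_def)
      show "even s" using ev c(1) by (simp add: s_def even_diff_nat)
      show "s + c < Suc i + (?N - j)"
      proof (cases "c \<le> Suc i")
        case True
        then show ?thesis using ij by (simp add: s_def)
      next
        case F: False
        have "j < i + c" using False ij by linarith
        then show ?thesis using F N by (simp add: s_def)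
      qed
    qed
    have "spine 0 c 0"
      by (rule spineI[OF g, of 0 s c 0])
        (use s x1[of s] x2[of "s + c"] c(1) lx in auto)
    then show False using no by simp
  qed
qed

lemma hosts_caterpillar_class:
  assumes T: "T \<in> caterpillar_class k l c" and c: "1 \<le> c" "c \<le> l"
    and dis: "even c \<or> card V div 2 \<le> l + c"
  shows "hosts V T"
proof -
  obtain a b d e where abde: "b + d = l" "a + b + c + d + e = k" and iso: "graph_iso T (caterpillar a b c d e)"
    and s: "simple_graph T" using T by (auto simp: caterpillar_class_def)
  have k: "a + c + e + l = k" using abde by simp
  have "spine a c e"
  proof (cases "even c")
    case True
    then show ?thesis using spine_even c k by blast
  next
    case False
    then have n2: "card V div 2 \<le> l + c" using dis by simp
    show ?thesis
    proof (cases "card V \<le> 2 * k")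
      case True
      then show ?thesis using spine_odd_dense[OF False c(2) k n2] by simp
    next
      case F: False
      \<comment> \<open>Since \<open>card V div 2 \<le> l + c \<le> k\<close>, equality holds
        throughout and both outer arms vanish.\<close>
      then have "k \<le> card V div 2" by simp
      then have "a = 0" "e = 0" "c + l = k" "card V = 2 * k + 1" using n2 k F by linarith+
      then show ?thesis using spine_odd_tight[OF False c(2)] by simp
    qed
  qed
  then have "hosts V (caterpillar a b c d e)" using caterpillar_hosts c abde by blast
  then show ?thesis by (rule hosts_iso[OF s iso])
qed

lemma hosts_small_diameter:
  assumes T: "is_tree T" "card (edges T) = k" "graph_diameter T \<le> 5"
  shows "hosts V T"
proof -
  interpret t: tree_graph T by unfold_locales (rule T)
  have ne: "1 \<le> card (edges T)" using T k_pos by simp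
  show ?thesis
  proof (rule t.bicentred[OF T(3) ne])
    fix r1 r2 \<pi>
    assume a: "card (vertices T) = Suc (card (edges T))"
      "r1 \<in> vertices T" "r2 \<in> vertices T" "r1 \<noteq> r2"
      "edges T \<subseteq> insert {r1, r2} {{x, \<pi> x} | x. x \<in> vertices T - {r1, r2}}"
      "\<And>x. x \<in> vertices T - {r1, r2} \<Longrightarrow>
        \<pi> x \<in> {r1, r2} \<or> \<pi> x \<in> vertices T - {r1, r2} \<and> \<pi> (\<pi> x) \<in> {r1, r2}"
    interpret lks_tree adj L V k T r1 r2 \<pi>
    proof unfold_locales
      show "card (vertices T) = Suc k" using a(1) T(2) by simp
    qed (rule a | assumption)+
    show ?thesis by (rule hosts_tree)
  qed
qed

end

section \<open>From colour classes to host graphs\<close>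

lemma colour_class_contains:
  fixes T :: "'a sgraph"
  assumes k: "1 \<le> k" and n: "1 \<le> n" and T: "is_tree T" "card (edges T) = k"
    and half: "n \<le> 2 * card {u. u < n \<and> k \<le> card {v. v < n \<and> v \<noteq> u \<and> col {u, v} = x}}"
    and cls: "graph_diameter T \<le> 5 \<or>
      (\<exists>l c. l \<ge> 1 \<and> c \<ge> 1 \<and> l \<ge> c \<and> T \<in> caterpillar_class k l c \<and> (even c \<or> l + c \<ge> n div 2))"
  shows "contains_copy (colour_class n col x) T"
proof -
  define N where "N u = {v. v < n \<and> v \<noteq> u \<and> col {u, v} = x}" for u
  define L where "L = {u. u < n \<and> k \<le> card (N u)}"
  define adj where "adj u v \<longleftrightarrow> u < n \<and> v \<in> N u \<and> (u \<in> L \<or> v \<in> L)" for u v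
  have finN: "finite (N u)" for u by (simp add: N_def)
  have Lsub: "L \<subseteq> {..<n}" by (auto simp: L_def)
  have cL: "n \<le> 2 * card L" using half by (simp add: L_def N_def)
  interpret sym_graph adj
    by unfold_locales (auto simp: adj_def N_def L_def insert_commute)
  interpret lks adj L "{..<n}" k
  proof unfold_locales
    fix u
    show "k \<le> card (nb u)" if "u \<in> L"
    proof -
      have "nb u = N u" using that Lsub by (auto simp: adj_def)
      then show ?thesis using that by (simp add: L_def)
    qed
    show "card (nb u) < k" if u: "u \<in> {..<n} - L"
    proof -
      have "card (nb u) \<le> card (N u)" using finN by (intro card_mono) (auto simp: adj_def)
      moreover have "\<not> k \<le> card (N u)" using u by (auto simp: L_def)
      ultimately show ?thesis by linarith
    qed
    show "card ({..<n} - L) \<le> card L"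
      using cL Lsub by (simp add: card_Diff_subset finite_subset[OF Lsub])
    show "L \<noteq> {}" using cL n by auto
  qed (use k Lsub in \<open>auto simp: adj_def\<close>)
  have "hosts {..<n} T"
    using cls
  proof
    assume "graph_diameter T \<le> 5"
    then show ?thesis by (rule hosts_small_diameter[OF T])
  next
    assume "\<exists>l c. l \<ge> 1 \<and> c \<ge> 1 \<and> l \<ge> c \<and> T \<in> caterpillar_class k l c \<and> (even c \<or> l + c \<ge> n div 2)"
    then show ?thesis using hosts_caterpillar_class by auto
  qed
  then obtain f where f: "inj_on f (vertices T)" "f ` vertices T \<subseteq> {..<n}"
    "\<And>u v. {u, v} \<in> edges T \<Longrightarrow> u \<noteq> v \<Longrightarrow> adj (f u) (f v)" by (auto simp: hosts_def)
  have "f ` e \<in> edges (colour_class n col x)" if e: "e \<in> edges T" for e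
  proof -
    interpret t: tree_graph T by unfold_locales (rule T)
    obtain u v where uv: "e = {u, v}" "u \<noteq> v" using t.edgeD[OF e] by blast
    then have "adj (f u) (f v)" using f(3) e by simp
    then show ?thesis using uv by (auto simp: adj_def N_def colour_class_def insert_commute)
  qed
  then show ?thesis unfolding contains_copy_def using f by (intro exI[of _ f]) (auto simp: colour_class_def)
qed

theorem corollary4:
  fixes k m :: nat and T1 :: "'a sgraph" and T2 :: "'b sgraph"
  assumes "k \<ge> 1" and "m \<ge> 1"
    and "is_tree T1" and "card (edges T1) = k"
    and "is_tree T2" and "card (edges T2) = m"
    and "graph_diameter T1 \<le> 5 \<or>
      (\<exists>l c. l \<ge> 1 \<and> c \<ge> 1 \<and> l \<ge> c \<and> T1 \<in> caterpillar_class k l c \<and>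
        (even c \<or> l + c \<ge> (k + m) div 2))"
    and "graph_diameter T2 \<le> 5 \<or>
      (\<exists>l c. l \<ge> 1 \<and> c \<ge> 1 \<and> l \<ge> c \<and> T2 \<in> caterpillar_class m l c \<and>
        (even c \<or> l + c \<ge> (k + m) div 2))"
  shows "ramsey_number T1 T2 \<le> k + m"
  unfolding ramsey_number_def
proof (rule Least_le)
  let ?n = "k + m"
  show "ramsey_property ?n T1 T2"
    unfolding ramsey_property_def
  proof
    fix col :: "nat set \<Rightarrow> colour"
    define N where "N x u = {v. v < ?n \<and> v \<noteq> u \<and> col {u, v} = x}" for x u
    have fin: "finite (N x u)" for x u by (simp add: N_def)
    have deg: "card (N Red u) + card (N Blue u) = ?n - 1" if "u < ?n" for u
    proof -
      have "card (N Red u) + card (N Blue u) = card (N Red u \<union> N Blue u)"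
        using fin by (intro card_Un_disjoint[symmetric]) (auto simp: N_def)
      also have "N Red u \<union> N Blue u = {..<?n} - {u}"
        by (auto simp: N_def) (metis colour.exhaust)
      finally show ?thesis using that by simp
    qed
    let ?R = "{u. u < ?n \<and> k \<le> card (N Red u)}" and ?B = "{u. u < ?n \<and> m \<le> card (N Blue u)}"
    have "{..<?n} \<subseteq> ?R \<union> ?B"
    proof
      fix u assume "u \<in> {..<?n}"
      then show "u \<in> ?R \<union> ?B" using deg[of u] assms(1,2) by auto
    qed
    then have "card {..<?n} \<le> card (?R \<union> ?B)" by (intro card_mono) auto
    then have "?n \<le> card (?R \<union> ?B)" by simp
    also have "\<dots> \<le> card ?R + card ?B" by (rule card_Un_le)
    finally consider "?n \<le> 2 * card ?R" | "?n \<le> 2 * card ?B" by linarith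
    then show "contains_copy (colour_class ?n col Red) T1 \<or> contains_copy (colour_class ?n col Blue) T2"
    proof cases
      case 1
      then show ?thesis
        using colour_class_contains[of k ?n T1 col Red] assms by (simp add: N_def)
    next
      case 2
      then show ?thesis
        using colour_class_contains[of m ?n T2 col Blue] assms by (simp add: N_def)
    qed
  qed
qed

end
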